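(* There exist ranking and unranking algorithms with the following guarantees, where all implied constants are absolute. (a) Let $n\ge 2$ and let $\vec{s}=\langle s_1,\ldots,s_n\rangle$ be any sequence of positive integers with $\sum_{i=1}^n s_i=2n-2$. Let $\vec{C}_{n,\vec{s}}$ be the set of trees $T$ on the vertex set $\{1,\ldots,n\}$, rooted at $1$ with all edges directed towards $1$, such that $\deg_T(i)=s_i$ for all $i$. After preprocessing that depends only on $\vec{s}$, there is a bijection $\mathrm{rank}:\vec{C}_{n,\vec{s}}\to\{0,1,\ldots,|\vec{C}_{n,\vec{s}}|-1\}$ such that: given $T\in\vec{C}_{n,\vec{s}}$, $\mathrm{rank}(T)$ is computed using at most $O(n^2)$ comparisons of numbers $y\le n$ plus $O(n)$ operations of multiplication, division, addition, subtraction and comparison on numbers $x<|\vec{C}_{n,\vec{s}}|$, so that ranking takes $O(n^2\log n)$ bit operations; and given $m\in\{0,\ldots,|\vec{C}_{n,\vec{s}}|-1\}$, the tree $T\in \vec{C}_{n,\vec{s}}$ with $\mathrm{rank}(T)=m$ is computed using at most $O(n^2\log n)$ bit operations. (b) Let $n\ge 2$ and let $S=\{1^{\alpha_1},\ldots,(n-1)^{\alpha_{n-1}}\}$ be a multiset (the integer $i$ occurring with multiplicity $\alpha_i\ge 0$) with $\sum_{i=1}^{n-1}\alpha_i\cdot i=2n-2$ and $\sum_{i=1}^{n-1}\alpha_i=n$. Let $\vec{C}_{n,S}$ be the set of trees $T$ on the vertex set $\{1,\ldots,n\}$, rooted at $1$ with all edges directed towards $1$, such that the multiset $\{\deg_T(1),\ldots,\deg_T(n)\}$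 equals $S$. After preprocessing that depends only on $S$, there is a bijection $\mathrm{rank}:\vec{C}_{n,S}\to\{0,1,\ldots,|\vec{C}_{n,S}|-1\}$ such that: given $T\in\vec{C}_{n,S}$, $\mathrm{rank}(T)$ is computed using at most $O(n^2)$ comparisons of numbers $y\le n$ plus $O(n)$ operations of multiplication, division, addition, subtraction and comparison on numbers $x<|\vec{C}_{n,S}|$, so that ranking takes $O(n^2\log n)$ bit operations; and given $m\in\{0,\ldots,|\vec{C}_{n,S}|-1\}$, the tree $T\in\vec{C}_{n,S}$ with $\mathrm{rank}(T)=m$ is computed using at most $O(n^2\log n)$ bit operations.
   Context: The degree $\deg_T(i)$ is the degree of the vertex $i$ when $T$ is regarded as an undirected tree. A tree rooted at $1$ with all edges directed towards $1$ is represented as the list of pairs $\langle i,t_i\rangle$, $i=2,\ldots,n$, where $(i,t_i)$ is the unique directed edge out of $i$. A ranking algorithm for a finite set $X$ computes a bijection from $X$ to $\{0,\ldots,|X|-1\}$; an unranking algorithm computes its inverse. "Preprocessing depending only on $\vec{s}$ (respectively $S$)" means that tables of binomial coefficients, and of products of binomial coefficients, determined by $\vec{s}$ (respectively $S$) may be computed in advance; their computation is not counted in the cost and they are available for table look-up. *)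

theory Defs
  imports Complex_Main "HOL-Library.Multiset" "HOL-Library.Log_Nat"
begin

section \<open>Trees rooted at 1\<close>

text \<open>An undirected graph is given by its vertex set and its symmetric adjacency relation.\<close>

definition is_cycle :: "('a \<times> 'a) set \<Rightarrow> 'a list \<Rightarrow> bool" where
  "is_cycle E vs \<longleftrightarrow> 3 \<le> length vs \<and> distinct vs \<and>
     (\<forall>i<length vs. (vs ! i, vs ! (Suc i mod length vs)) \<in> E)"

definition is_tree :: "'a set \<Rightarrow> ('a \<times> 'a) set \<Rightarrow> bool" where
  "is_tree V E \<longleftrightarrow> V \<noteq> {} \<and> E \<subseteq> V \<times> V \<and> sym E \<and> irrefl E \<and>
     (\<forall>u\<in>V. \<forall>v\<in>V. (u, v) \<in> E\<^sup>*) \<and> (\<nexists>vs. is_cycle E vs)"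

text \<open>A rooted tree is its set of directed edges. Each undirected edge carries exactly one
  direction (\<^term>\<open>asym T\<close>); all edges point towards 1 when every vertex reaches 1 along them.\<close>

definition rooted_tree :: "nat \<Rightarrow> (nat \<times> nat) set \<Rightarrow> bool" where
  "rooted_tree n T \<longleftrightarrow> asym T \<and> is_tree {1..n} (T \<union> T\<inverse>) \<and> (\<forall>v\<in>{1..n}. (v, 1) \<in> T\<^sup>*)"

definition deg :: "(nat \<times> nat) set \<Rightarrow> nat \<Rightarrow> nat" where
  "deg T i = card {j. (i, j) \<in> T \<union> T\<inverse>}"

definition trees_with_degree_sequence :: "nat \<Rightarrow> nat list \<Rightarrow> (nat \<times> nat) set set" where
  "trees_with_degree_sequence n s = {T. rooted_tree n T \<and> (\<forall>i\<in>{1..n}. deg T i = s ! (i - 1))}"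

definition trees_with_degree_multiset :: "nat \<Rightarrow> nat multiset \<Rightarrow> (nat \<times> nat) set set" where
  "trees_with_degree_multiset n S =
     {T. rooted_tree n T \<and> image_mset (deg T) (mset_set {1..n}) = S}"

definition parent :: "(nat \<times> nat) set \<Rightarrow> nat \<Rightarrow> nat" where
  "parent T i = (THE j. (i, j) \<in> T)"


section \<open>Algorithms\<close>

text \<open>Algorithms are programs for a random access machine with registers, arrays and read-only
  two-dimensional tables, all holding natural numbers. The only loops are counting loops, so every
  program terminates and its meaning is a function. Running a program records the list of elementary
  operations performed, from which both the operation counts and the bit cost are read off.\<close>

record mem =
  reg :: "string \<Rightarrow> nat"
  arr :: "string \<Rightarrow> nat \<Rightarrow> nat"

type_synonym tables = "string \<Rightarrow> nat \<Rightarrow> nat \<Rightarrow> nat"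

datatype exp =
    Const nat
  | Reg string
  | Elem string exp
  | Look string exp exp

datatype arith = Plus | Minus | Times | Divide

datatype comparison = Equal | Less | LessEq

datatype com =
    Skip
  | Assign string exp
  | Store string exp exp
  | Arith string arith exp exp
  | Seq com com
  | Cond comparison exp exp com com
  | For string exp exp com

datatype event =
    Move nat
  | Calc nat nat nat  \<comment> \<open>two operands and the result\<close>
  | Comp nat nat

fun arith_op :: "arith \<Rightarrow> nat \<Rightarrow> nat \<Rightarrow> nat" where
  "arith_op Plus x y = x + y"
| "arith_op Minus x y = x - y"
| "arith_op Times x y = x * y"
| "arith_op Divide x y = x div y"

fun compare :: "comparison \<Rightarrow> nat \<Rightarrow> nat \<Rightarrow> bool" where
  "compare Equal x y \<longleftrightarrow> x = y"
| "compare Less x y \<longleftrightarrow> x < y"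
| "compare LessEq x y \<longleftrightarrow> x \<le> y"

primrec eval_exp :: "tables \<Rightarrow> mem \<Rightarrow> exp \<Rightarrow> nat" where
  "eval_exp tb \<sigma> (Const c) = c"
| "eval_exp tb \<sigma> (Reg x) = reg \<sigma> x"
| "eval_exp tb \<sigma> (Elem a e) = arr \<sigma> a (eval_exp tb \<sigma> e)"
| "eval_exp tb \<sigma> (Look t e f) = tb t (eval_exp tb \<sigma> e) (eval_exp tb \<sigma> f)"

text \<open>Every number read is paid for, indices into arrays and tables included.\<close>

primrec fetch :: "tables \<Rightarrow> mem \<Rightarrow> exp \<Rightarrow> event list" where
  "fetch tb \<sigma> (Const c) = [Move c]"
| "fetch tb \<sigma> (Reg x) = [Move (reg \<sigma> x)]"
| "fetch tb \<sigma> (Elem a e) = fetch tb \<sigma> e @ [Move (eval_exp tb \<sigma> (Elem a e))]"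
| "fetch tb \<sigma> (Look t e f) =
     fetch tb \<sigma> e @ fetch tb \<sigma> f @ [Move (eval_exp tb \<sigma> (Look t e f))]"

text \<open>The bounds of a counting loop are evaluated once. The test for entering the loop and, after
  each iteration, the test of the counter against the upper bound are recorded as comparisons;
  stepping the counter is recorded as a move.\<close>

primrec run :: "tables \<Rightarrow> com \<Rightarrow> mem \<Rightarrow> mem \<times> event list" where
  "run tb Skip \<sigma> = (\<sigma>, [])"
| "run tb (Assign x e) \<sigma> =
     (let v = eval_exp tb \<sigma> e
      in (\<sigma>\<lparr>reg := (reg \<sigma>)(x := v)\<rparr>, fetch tb \<sigma> e @ [Move v]))"
| "run tb (Store a e f) \<sigma> =
     (let i = eval_exp tb \<sigma> e; v = eval_exp tb \<sigma> f
      in (\<sigma>\<lparr>arr := (arr \<sigma>)(a := (arr \<sigma> a)(i := v))\<rparr>,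
          fetch tb \<sigma> e @ fetch tb \<sigma> f @ [Move v]))"
| "run tb (Arith x p e f) \<sigma> =
     (let u = eval_exp tb \<sigma> e; v = eval_exp tb \<sigma> f; w = arith_op p u v
      in (\<sigma>\<lparr>reg := (reg \<sigma>)(x := w)\<rparr>,
          fetch tb \<sigma> e @ fetch tb \<sigma> f @ [Calc u v w, Move w]))"
| "run tb (Seq c d) \<sigma> =
     (let (\<sigma>1, tr1) = run tb c \<sigma>; (\<sigma>2, tr2) = run tb d \<sigma>1 in (\<sigma>2, tr1 @ tr2))"
| "run tb (Cond p e f c d) \<sigma> =
     (let u = eval_exp tb \<sigma> e; v = eval_exp tb \<sigma> f;
          (\<sigma>1, tr1) = (if compare p u v then run tb c \<sigma> else run tb d \<sigma>)
      in (\<sigma>1, fetch tb \<sigma> e @ fetch tb \<sigma> f @ [Comp u v] @ tr1))"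
| "run tb (For x e f c) \<sigma> =
     (let lo = eval_exp tb \<sigma> e; hi = eval_exp tb \<sigma> f;
          (\<sigma>1, tr1) =
            fold (\<lambda>i (\<tau>, tr).
                    let (\<tau>', tr') = run tb c (\<tau>\<lparr>reg := (reg \<tau>)(x := i)\<rparr>)
                    in (\<tau>', tr @ [Move i] @ tr' @ [Comp i hi]))
              [lo..<Suc hi] (\<sigma>, [])
      in (\<sigma>1, fetch tb \<sigma> e @ fetch tb \<sigma> f @ [Comp lo hi] @ tr1))"


section \<open>Costs\<close>

text \<open>Bit operations are counted by the logarithmic cost criterion for random access machines
  (Aho, Hopcroft, Ullman): an operation costs the total binary length of the numbers it involves.
  This is the measure in which linearly many arithmetic operations on numbers of
  $O(n \log n)$ bits amount to $O(n^2 \log n)$ bit operations.\<close>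

definition bit_length :: "nat \<Rightarrow> nat" where
  "bit_length x = max 1 (floorlog 2 x)"

fun event_bits :: "event \<Rightarrow> nat" where
  "event_bits (Move x) = bit_length x"
| "event_bits (Calc x y z) = bit_length x + bit_length y + bit_length z"
| "event_bits (Comp x y) = bit_length x + bit_length y"

definition bit_operations :: "event list \<Rightarrow> nat" where
  "bit_operations tr = sum_list (map event_bits tr)"

fun small_comparison :: "nat \<Rightarrow> event \<Rightarrow> bool" where
  "small_comparison n (Comp x y) \<longleftrightarrow> x \<le> n \<and> y \<le> n"
| "small_comparison n _ \<longleftrightarrow> False"

text \<open>All arithmetic, whatever the size of the operands, and all comparisons that are not
  comparisons of numbers up to \<open>n\<close>.\<close>

fun number_operation :: "nat \<Rightarrow> event \<Rightarrow> bool" where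
  "number_operation n (Calc x y z) \<longleftrightarrow> True"
| "number_operation n (Comp x y) \<longleftrightarrow> \<not> (x \<le> n \<and> y \<le> n)"
| "number_operation n (Move x) \<longleftrightarrow> False"

fun numbers :: "event \<Rightarrow> nat set" where
  "numbers (Move x) = {x}"
| "numbers (Calc x y z) = {x, y, z}"
| "numbers (Comp x y) = {x, y}"


section \<open>Preprocessing, ranking and unranking\<close>

definition binomial_product :: "nat \<Rightarrow> nat \<Rightarrow> bool" where
  "binomial_product n v \<longleftrightarrow>
     (\<exists>ps. (\<forall>(a, b)\<in>set ps. a \<le> n) \<and> v = (\<Prod>(a, b)\<leftarrow>ps. a choose b))"

text \<open>Tables have indices in \<open>{0..n}\<close>, hence polynomial size; in particular they cannot be
  indexed by encodings of trees.\<close>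

definition binomial_tables :: "nat \<Rightarrow> tables \<Rightarrow> bool" where
  "binomial_tables n tb \<longleftrightarrow>
     (\<forall>t i j. binomial_product n (tb t i j) \<and> (\<not> (i \<le> n \<and> j \<le> n) \<longrightarrow> tb t i j = 0))"

definition instance_mem :: "nat \<Rightarrow> string \<Rightarrow> (nat \<Rightarrow> nat) \<Rightarrow> mem" where
  "instance_mem n a f = \<lparr>reg = (\<lambda>_. 0)(''n'' := n), arr = (\<lambda>_ _. 0)(a := f)\<rparr>"

definition sequence_instance :: "nat \<Rightarrow> nat list \<Rightarrow> mem" where
  "sequence_instance n s = instance_mem n ''s'' (\<lambda>i. if i \<in> {1..n} then s ! (i - 1) else 0)"

definition multiset_instance :: "nat \<Rightarrow> nat multiset \<Rightarrow> mem" where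
  "multiset_instance n S = instance_mem n ''alpha'' (count S)"

text \<open>As input and as output, a tree is its list of pairs \<open>\<langle>i, parent i\<rangle>\<close>,
  \<open>i = 2, \<dots>, n\<close>, held in the array \<open>tree\<close>.\<close>

definition with_tree :: "nat \<Rightarrow> (nat \<times> nat) set \<Rightarrow> mem \<Rightarrow> mem" where
  "with_tree n T \<sigma> =
     \<sigma>\<lparr>arr := (arr \<sigma>)(''tree'' := (\<lambda>i. if i \<in> {2..n} then parent T i else 0))\<rparr>"

definition stored_tree :: "nat \<Rightarrow> mem \<Rightarrow> (nat \<times> nat) set" where
  "stored_tree n \<sigma> = {(i, arr \<sigma> ''tree'' i) | i. i \<in> {2..n}}"

definition with_number :: "nat \<Rightarrow> mem \<Rightarrow> mem" where
  "with_number m \<sigma> = \<sigma>\<lparr>reg := (reg \<sigma>)(''m'' := m)\<rparr>"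

definition computes_rank ::
  "real \<Rightarrow> nat \<Rightarrow> (nat \<times> nat) set set \<Rightarrow> tables \<Rightarrow> mem \<Rightarrow> com \<Rightarrow>
   ((nat \<times> nat) set \<Rightarrow> nat) \<Rightarrow> bool" where
  "computes_rank K n X tb \<sigma> P rank \<longleftrightarrow>
     (\<forall>T\<in>X. \<forall>\<sigma>' tr. run tb P (with_tree n T \<sigma>) = (\<sigma>', tr) \<longrightarrow>
        reg \<sigma>' ''rank'' = rank T \<and>
        real (length (filter (small_comparison n) tr)) \<le> K * real n ^ 2 \<and>
        real (length (filter (number_operation n) tr)) \<le> K * real n \<and>
        (\<forall>e\<in>set tr. number_operation n e \<longrightarrow> (\<forall>x\<in>numbers e. x < card X)) \<and>
        real (bit_operations tr) \<le> K * (real n ^ 2 * log 2 (real n)))"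

definition computes_unrank ::
  "real \<Rightarrow> nat \<Rightarrow> (nat \<times> nat) set set \<Rightarrow> tables \<Rightarrow> mem \<Rightarrow> com \<Rightarrow>
   ((nat \<times> nat) set \<Rightarrow> nat) \<Rightarrow> bool" where
  "computes_unrank K n X tb \<sigma> P rank \<longleftrightarrow>
     (\<forall>m<card X. \<forall>\<sigma>' tr. run tb P (with_number m \<sigma>) = (\<sigma>', tr) \<longrightarrow>
        stored_tree n \<sigma>' \<in> X \<and> rank (stored_tree n \<sigma>') = m \<and>
        real (bit_operations tr) \<le> K * (real n ^ 2 * log 2 (real n)))"

end

theory Submission
  imports Defs
begin

text \<open>A tree rooted at 1 with prescribed degrees is encoded by its Pruefer code, a word of length
  \<open>n - 2\<close> in which vertex \<open>v\<close> occurs \<open>deg v - 1\<close> times. A word with prescribed letter counts is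
  ranked letter by letter: the occurrences of the first letter form a subset of the positions,
  ranked by the combinatorial number system, and the rest of the word is ranked recursively;
  the ranks are the digits of a mixed radix number with binomial radices. Hence the rank is a sum
  of one table entry for each position of the word, so that $O(n)$ additions suffice, and no partial
  sum exceeds the rank.

  If the letters are processed in the order of increasing degree, then these tables depend only on
  the multiset of degrees. For (b), the word of degrees is therefore ranked first, with all its
  weights multiplied by the number of trees with a given degree sequence, and the rank of the Pruefer
  code is added.

  To unrank, the digits are obtained by $O(n)$ divisions of big numbers. Expanding one digit into a
  subset of size \<open>c\<close> takes $O(n)$ operations on numbers of at most $(c + 1) \log n$ bits, and the sizes
  \<open>c\<close> sum up to at most \<open>n\<close>.\<close>

section \<open>Verifying programs together with their traces\<close>

text \<open>Two budgets shape the verification. A trace may hold quadratically many events on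
  numbers up to \<open>n\<close>, but only linearly many on numbers of order n log n bits; so
  ranking is split into a part without any arithmetic and a final summation. The lengths of traces
  are bounded by syntax, since every loop runs over a part of 1..n, and the semantic proofs then
  only have to bound the size of the numbers. Placing a letter is the exception: its numbers grow
  with the multiplicity of the letter, so the costs of the rounds are accumulated in a loop
  invariant. A table has only two small indices, yet the weight of an occurrence depends on its
  letter, on the number of equal letters that follow, and on its position. Once the order of the
  letters is fixed, the running number of the occurrence determines the first two, so this number
  and the position suffice. The root needs no special treatment: a Pruefer code of n - 1 letters
  always ends in 1, and without this letter every vertex, 1 included, occurs one time less than its
  degree. The constant 10000 is a round bound with much slack.\<close>

primrec exp_size :: "exp \<Rightarrow> nat" where
  "exp_size (Const c) = 1"
| "exp_size (Reg x) = 1"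
| "exp_size (Elem a e) = Suc (exp_size e)"
| "exp_size (Look t e f) = Suc (exp_size e + exp_size f)"

text \<open>Bound on the length of a trace, read off the syntax: a loop is charged \<open>n\<close>
  rounds, each with two extra events, the move of the counter and the test after the body. A
  conditional is charged for both branches, which is crude but keeps the bound a closed formula in
  \<open>n\<close>.\<close>

primrec steps :: "nat \<Rightarrow> com \<Rightarrow> nat" where
  "steps n Skip = 0"
| "steps n (Assign x e) = exp_size e + 1"
| "steps n (Store a e f) = exp_size e + exp_size f + 1"
| "steps n (Arith x p e f) = exp_size e + exp_size f + 2"
| "steps n (Seq c d) = steps n c + steps n d"
| "steps n (Cond p e f c d) = exp_size e + exp_size f + 1 + (steps n c + steps n d)"
| "steps n (For x e f c) = exp_size e + exp_size f + 1 + n * (steps n c + 2)"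

primrec written_regs :: "com \<Rightarrow> string set" where
  "written_regs Skip = {}"
| "written_regs (Assign x e) = {x}"
| "written_regs (Store a e f) = {}"
| "written_regs (Arith x p e f) = {x}"
| "written_regs (Seq c d) = written_regs c \<union> written_regs d"
| "written_regs (Cond p e f c d) = written_regs c \<union> written_regs d"
| "written_regs (For x e f c) = insert x (written_regs c)"

primrec written_arrs :: "com \<Rightarrow> string set" where
  "written_arrs Skip = {}"
| "written_arrs (Assign x e) = {}"
| "written_arrs (Store a e f) = {a}"
| "written_arrs (Arith x p e f) = {}"
| "written_arrs (Seq c d) = written_arrs c \<union> written_arrs d"
| "written_arrs (Cond p e f c d) = written_arrs c \<union> written_arrs d"
| "written_arrs (For x e f c) = written_arrs c"

text \<open>The frame condition: what a command cannot write stays as it was. It comes from the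
  syntax alone, so postconditions and invariants need only mention what changes.\<close>

definition agree :: "com \<Rightarrow> mem \<Rightarrow> mem \<Rightarrow> bool" where
  "agree c \<sigma> \<tau> \<longleftrightarrow> (\<forall>y. y \<notin> written_regs c \<longrightarrow> reg \<tau> y = reg \<sigma> y) \<and>
     (\<forall>a. a \<notin> written_arrs c \<longrightarrow> arr \<tau> a = arr \<sigma> a)"

lemma length_fetch [simp]: "length (fetch tb \<sigma> e) = exp_size e"
  by (induction e) auto

text \<open>The three conjuncts before \<open>Q\<close> are wanted after every command and are
  therefore built in. \<open>Q\<close> also receives the accumulated cost, for a measure \<mu> that
  is constantly 0 wherever the length of the trace says enough.\<close>

definition wp :: "tables \<Rightarrow> nat \<Rightarrow> (event \<Rightarrow> bool) \<Rightarrow> (event \<Rightarrow> nat) \<Rightarrow> com \<Rightarrow> mem \<Rightarrow>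
    (mem \<Rightarrow> nat \<Rightarrow> bool) \<Rightarrow> bool" where
  "wp tb n P \<mu> c \<sigma> Q \<longleftrightarrow> (\<forall>\<sigma>' tr. run tb c \<sigma> = (\<sigma>', tr) \<longrightarrow>
     (\<forall>e\<in>set tr. P e) \<and> length tr \<le> steps n c \<and> agree c \<sigma> \<sigma>' \<and> Q \<sigma>' (sum_list (map \<mu> tr)))"

lemma wp_conseq:
  assumes "wp tb n P \<mu> c \<sigma> Q" "\<And>\<sigma>' b. agree c \<sigma> \<sigma>' \<Longrightarrow> Q \<sigma>' b \<Longrightarrow> Q' \<sigma>' b"
  shows "wp tb n P \<mu> c \<sigma> Q'"
  using assms unfolding wp_def by blast

text \<open>Fragments whose cost per event is bounded are verified without cost tracking and then
  charged for their number of steps.\<close>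

lemma wp_charge:
  assumes "wp tb n P (\<lambda>_. 0) c \<sigma> Q" "\<And>e. P e \<Longrightarrow> P' e \<and> \<mu> e \<le> k"
    "\<And>\<sigma>' b. agree c \<sigma> \<sigma>' \<Longrightarrow> Q \<sigma>' 0 \<Longrightarrow> b \<le> k * steps n c \<Longrightarrow> Q' \<sigma>' b"
  shows "wp tb n P' \<mu> c \<sigma> Q'"
proof -
  have le: "sum_list (map \<mu> tr) \<le> k * length tr" if "\<forall>e\<in>set tr. P e" for tr
    using that assms(2) by (induction tr) (auto simp: add_mono)
  show ?thesis
    unfolding wp_def
  proof (intro allI impI)
    fix \<sigma>' tr assume r: "run tb c \<sigma> = (\<sigma>', tr)"
    have *: "\<forall>e\<in>set tr. P e" "length tr \<le> steps n c" "agree c \<sigma> \<sigma>'" "Q \<sigma>' 0"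
      using assms(1) r unfolding wp_def by (auto simp: map_replicate_const sum_list_replicate)
    have "sum_list (map \<mu> tr) \<le> k * steps n c"
      using le[OF *(1)] *(2) by (meson le_trans mult_le_mono2)
    then show "(\<forall>e\<in>set tr. P' e) \<and> length tr \<le> steps n c \<and> agree c \<sigma> \<sigma>' \<and> Q' \<sigma>' (sum_list (map \<mu> tr))"
      using * assms(2,3) by blast
  qed
qed

lemma wp_Skip: "Q \<sigma> 0 \<Longrightarrow> wp tb n P \<mu> Skip \<sigma> Q"
  by (auto simp: wp_def agree_def)

text \<open>Atomic commands demand the postcondition for every cost, so their individual costs are
  forgotten and recovered afterwards from \<open>steps\<close> by \<open>wp_charge\<close>.\<close>

lemma wp_Assign:
  assumes "\<forall>ev\<in>set (fetch tb \<sigma> e @ [Move (eval_exp tb \<sigma> e)]). P ev"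
    "\<And>b. Q (\<sigma>\<lparr>reg := (reg \<sigma>)(x := eval_exp tb \<sigma> e)\<rparr>) b"
  shows "wp tb n P \<mu> (Assign x e) \<sigma> Q"
  using assms by (auto simp: wp_def agree_def Let_def)

lemma wp_Store:
  assumes "\<forall>ev\<in>set (fetch tb \<sigma> e @ fetch tb \<sigma> f). P ev"
    "\<And>b. Q (\<sigma>\<lparr>arr := (arr \<sigma>)(a := (arr \<sigma> a)(eval_exp tb \<sigma> e := eval_exp tb \<sigma> f))\<rparr>) b"
    "P (Move (eval_exp tb \<sigma> f))"
  shows "wp tb n P \<mu> (Store a e f) \<sigma> Q"
  using assms by (auto simp: wp_def agree_def Let_def)

lemma wp_Arith:
  assumes "\<forall>ev\<in>set (fetch tb \<sigma> e @ fetch tb \<sigma> f). P ev"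
    "P (Calc (eval_exp tb \<sigma> e) (eval_exp tb \<sigma> f) (arith_op p (eval_exp tb \<sigma> e) (eval_exp tb \<sigma> f)))"
    "P (Move (arith_op p (eval_exp tb \<sigma> e) (eval_exp tb \<sigma> f)))"
    "\<And>b. Q (\<sigma>\<lparr>reg := (reg \<sigma>)(x := arith_op p (eval_exp tb \<sigma> e) (eval_exp tb \<sigma> f))\<rparr>) b"
  shows "wp tb n P \<mu> (Arith x p e f) \<sigma> Q"
  using assms by (auto simp: wp_def agree_def Let_def)

lemma wp_Seq:
  assumes "wp tb n P \<mu> c \<sigma> (\<lambda>\<sigma>1 b1. wp tb n P \<mu> d \<sigma>1 (\<lambda>\<sigma>2 b2. Q \<sigma>2 (b1 + b2)))"
  shows "wp tb n P \<mu> (Seq c d) \<sigma> Q"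
  unfolding wp_def
proof (intro allI impI)
  fix \<sigma>' tr assume r: "run tb (Seq c d) \<sigma> = (\<sigma>', tr)"
  obtain \<sigma>1 tr1 where 1: "run tb c \<sigma> = (\<sigma>1, tr1)" by fastforce
  obtain tr2 where 2: "run tb d \<sigma>1 = (\<sigma>', tr2)" "tr = tr1 @ tr2"
    using r 1 by (auto split: prod.splits)
  show "(\<forall>e\<in>set tr. P e) \<and> length tr \<le> steps n (Seq c d) \<and> agree (Seq c d) \<sigma> \<sigma>' \<and>
      Q \<sigma>' (sum_list (map \<mu> tr))"
    using assms 1 2 unfolding wp_def by (auto simp: agree_def)
qed

lemma wp_Cond:
  assumes "\<forall>ev\<in>set (fetch tb \<sigma> e @ fetch tb \<sigma> f). P ev"
    "P (Comp (eval_exp tb \<sigma> e) (eval_exp tb \<sigma> f))"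
    "\<And>b0. compare p (eval_exp tb \<sigma> e) (eval_exp tb \<sigma> f) \<Longrightarrow> wp tb n P \<mu> c \<sigma> (\<lambda>\<sigma>' b. Q \<sigma>' (b0 + b))"
    "\<And>b0. \<not> compare p (eval_exp tb \<sigma> e) (eval_exp tb \<sigma> f) \<Longrightarrow> wp tb n P \<mu> d \<sigma> (\<lambda>\<sigma>' b. Q \<sigma>' (b0 + b))"
  shows "wp tb n P \<mu> (Cond p e f c d) \<sigma> Q"
  unfolding wp_def
proof (intro allI impI)
  fix \<sigma>' tr assume r: "run tb (Cond p e f c d) \<sigma> = (\<sigma>', tr)"
  define tr0 where "tr0 = fetch tb \<sigma> e @ fetch tb \<sigma> f @ [Comp (eval_exp tb \<sigma> e) (eval_exp tb \<sigma> f)]"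
  show "(\<forall>ev\<in>set tr. P ev) \<and> length tr \<le> steps n (Cond p e f c d) \<and>
      agree (Cond p e f c d) \<sigma> \<sigma>' \<and> Q \<sigma>' (sum_list (map \<mu> tr))"
  proof (cases "compare p (eval_exp tb \<sigma> e) (eval_exp tb \<sigma> f)")
    case True
    then obtain tr1 where 1: "run tb c \<sigma> = (\<sigma>', tr1)" "tr = tr0 @ tr1"
      using r by (auto simp: Let_def tr0_def split: prod.splits)
    show ?thesis
      using assms(3)[OF True, of "sum_list (map \<mu> tr0)"] 1 assms(1,2) unfolding wp_def
      by (auto simp: agree_def tr0_def add.assoc)
  next
    case False
    then obtain tr1 where 1: "run tb d \<sigma> = (\<sigma>', tr1)" "tr = tr0 @ tr1"
      using r by (auto simp: Let_def tr0_def split: prod.splits)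
    show ?thesis
      using assms(4)[OF False, of "sum_list (map \<mu> tr0)"] 1 assms(1,2) unfolding wp_def
      by (auto simp: agree_def tr0_def add.assoc)
  qed
qed

text \<open>Unlike the rules for atomic commands and conditionals, this one tracks the cost exactly,
  because rounds of a loop may differ widely in cost. \<open>I i\<close> holds before the round with
  counter \<open>i\<close>; \<open>lo = Suc hi\<close> admits the empty loop, and the bounds 1 and
  \<open>n\<close> limit the number of rounds to \<open>n\<close>.\<close>

lemma wp_For:
  fixes lo hi :: nat
  assumes lo: "eval_exp tb \<sigma> e = lo" and hi: "eval_exp tb \<sigma> f = hi"
    and range: "1 \<le> lo" "lo \<le> Suc hi" "hi \<le> n"
    and P: "\<forall>ev\<in>set (fetch tb \<sigma> e @ fetch tb \<sigma> f). P ev" "P (Comp lo hi)"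
      "\<And>i. lo \<le> i \<Longrightarrow> i \<le> hi \<Longrightarrow> P (Move i) \<and> P (Comp i hi)"
    and init: "I lo \<sigma> (sum_list (map \<mu> (fetch tb \<sigma> e @ fetch tb \<sigma> f)) + \<mu> (Comp lo hi))"
    and step: "\<And>i \<tau> b. \<lbrakk>lo \<le> i; i \<le> hi; agree (For x e f c) \<sigma> \<tau>; I i \<tau> b\<rbrakk> \<Longrightarrow>
      wp tb n P \<mu> c (\<tau>\<lparr>reg := (reg \<tau>)(x := i)\<rparr>)
        (\<lambda>\<tau>' b'. I (Suc i) \<tau>' (b + \<mu> (Move i) + b' + \<mu> (Comp i hi)))"
    and final: "\<And>\<tau> b. agree (For x e f c) \<sigma> \<tau> \<Longrightarrow> I (Suc hi) \<tau> b \<Longrightarrow> Q \<tau> b"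
  shows "wp tb n P \<mu> (For x e f c) \<sigma> Q"
  unfolding wp_def
proof (intro allI impI)
  fix \<sigma>' tr assume r: "run tb (For x e f c) \<sigma> = (\<sigma>', tr)"
  define g where "g = (\<lambda>i (\<tau>, tr).
                    let (\<tau>', tr') = run tb c (\<tau>\<lparr>reg := (reg \<tau>)(x := i)\<rparr>)
                    in (\<tau>', tr @ [Move i] @ tr' @ [Comp i hi]))"
  define tr0 where "tr0 = fetch tb \<sigma> e @ fetch tb \<sigma> f @ [Comp lo hi]"
  \<comment> \<open>Induction on the number of completed rounds; \<open>tr0\<close> holds the events
    before the first one.\<close>
  have main: "\<exists>\<tau> tr. fold g [lo..<lo + k] (\<sigma>, []) = (\<tau>, tr) \<and> (\<forall>e\<in>set tr. P e) \<and>
      length tr \<le> k * (steps n c + 2) \<and> agree (For x e f c) \<sigma> \<tau> \<and>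
      I (lo + k) \<tau> (sum_list (map \<mu> (tr0 @ tr)))" if "lo + k \<le> Suc hi" for k
    using that
  proof (induction k)
    case 0
    then show ?case using init by (auto simp: agree_def tr0_def add.assoc)
  next
    case (Suc k)
    then obtain \<tau> tr where IH: "fold g [lo..<lo + k] (\<sigma>, []) = (\<tau>, tr)" "\<forall>e\<in>set tr. P e"
      "length tr \<le> k * (steps n c + 2)" "agree (For x e f c) \<sigma> \<tau>"
      "I (lo + k) \<tau> (sum_list (map \<mu> (tr0 @ tr)))" by auto
    obtain \<tau>' tr' where b: "run tb c (\<tau>\<lparr>reg := (reg \<tau>)(x := lo + k)\<rparr>) = (\<tau>', tr')" by fastforce
    have w: "wp tb n P \<mu> c (\<tau>\<lparr>reg := (reg \<tau>)(x := lo + k)\<rparr>)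
        (\<lambda>\<tau>' b'. I (Suc (lo + k)) \<tau>' (sum_list (map \<mu> (tr0 @ tr)) + \<mu> (Move (lo + k)) + b' + \<mu> (Comp (lo + k) hi)))"
      using Suc.prems IH by (intro step) auto
    have f: "fold g [lo..<lo + Suc k] (\<sigma>, []) = (\<tau>', tr @ [Move (lo + k)] @ tr' @ [Comp (lo + k) hi])"
      using IH b by (simp add: g_def)
    show ?case
      unfolding f using w[unfolded wp_def, rule_format, OF b] IH Suc.prems P(3)[of "lo + k"]
      by (auto simp: agree_def add_ac)
  qed
  obtain \<tau> tr1 where 1: "fold g [lo..<Suc hi] (\<sigma>, []) = (\<tau>, tr1)" "\<forall>e\<in>set tr1. P e"
      "length tr1 \<le> (Suc hi - lo) * (steps n c + 2)" "agree (For x e f c) \<sigma> \<tau>"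
      "I (Suc hi) \<tau> (sum_list (map \<mu> (tr0 @ tr1)))"
    using main[of "Suc hi - lo"] range by auto
  have 2: "\<sigma>' = \<tau>" "tr = tr0 @ tr1"
    using r 1(1) unfolding g_def tr0_def by (simp_all add: lo hi Let_def del: upt_Suc)
  have "(Suc hi - lo) * (steps n c + 2) \<le> n * (steps n c + 2)"
    using range by (intro mult_le_mono1) auto
  then have "length tr \<le> steps n (For x e f c)"
    using 1(3) 2 unfolding tr0_def by simp
  then show "(\<forall>ev\<in>set tr. P ev) \<and> length tr \<le> steps n (For x e f c) \<and>
      agree (For x e f c) \<sigma> \<sigma>' \<and> Q \<sigma>' (sum_list (map \<mu> tr))"
    using 1 2 final P unfolding tr0_def by auto
qed

text \<open>Arithmetic is excluded at any size, because every \<open>Calc\<close> counts as a number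
  operation and ranking may perform only linearly many of them.\<close>

definition small :: "nat \<Rightarrow> event \<Rightarrow> bool" where
  "small n e \<longleftrightarrow> (\<forall>x\<in>numbers e. x \<le> n) \<and> (case e of Calc x y z \<Rightarrow> False | _ \<Rightarrow> True)"

lemma small_simps [simp]:
  "small n (Move x) \<longleftrightarrow> x \<le> n"
  "small n (Comp x y) \<longleftrightarrow> x \<le> n \<and> y \<le> n"
  "\<not> small n (Calc x y z)"
  by (auto simp: small_def)

section \<open>Binary lengths of numbers and costs of events\<close>

lemma bit_length_le:
  assumes "x < 2 ^ k" "0 < k"
  shows "bit_length x \<le> k"
  using assms by (cases "x = 0") (auto simp: bit_length_def floorlog_le_iff)

lemma less_two_power_bit_length: "x < 2 ^ bit_length x"
  using floorlog_bounds[of x 2]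
  by (cases "x = 0") (auto simp: bit_length_def max_def not_less_eq_eq)

lemma bit_length_pos [simp]: "0 < bit_length x"
  by (simp add: bit_length_def)

lemma bit_length_mono: "x \<le> y \<Longrightarrow> bit_length x \<le> bit_length y"
  using less_two_power_bit_length[of y] by (intro bit_length_le) auto

lemma bit_length_power:
  assumes "0 < k" shows "bit_length (x ^ k) \<le> k * bit_length x"
proof (rule bit_length_le)
  have "x ^ k < (2 ^ bit_length x) ^ k"
    using less_two_power_bit_length[of x] assms by (intro power_strict_mono) auto
  then show "x ^ k < 2 ^ (k * bit_length x)"
    by (simp add: power_mult[symmetric] mult.commute)
qed (use assms in auto)

text \<open>The factor 3 is for arithmetic, which involves two operands and a result.\<close>

lemma event_bits_le: "(\<forall>x\<in>numbers e. x \<le> M) \<Longrightarrow> event_bits e \<le> 3 * bit_length M"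
proof (cases e)
  case (Calc x y z)
  then show "(\<forall>x\<in>numbers e. x \<le> M) \<Longrightarrow> ?thesis"
    using bit_length_mono[of x M] bit_length_mono[of y M] bit_length_mono[of z M] by simp
next
  case (Comp x y)
  then show "(\<forall>x\<in>numbers e. x \<le> M) \<Longrightarrow> ?thesis"
    using bit_length_mono[of x M] bit_length_mono[of y M] by simp
next
  case (Move x)
  then show "(\<forall>x\<in>numbers e. x \<le> M) \<Longrightarrow> ?thesis"
    using bit_length_mono[of x M] by simp
qed

lemma bit_length_le_log:
  assumes "2 \<le> n" shows "real (bit_length n) \<le> 2 * log 2 (real n)"
proof -
  \<comment> \<open>The length exceeds the logarithm by at most 1, which a second copy of the
    logarithm absorbs since \<open>n\<close> is at least 2.\<close>
  have "1 \<le> log 2 (real n)" using assms by (simp add: le_log_iff)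
  moreover have "bit_length n = nat \<lfloor>log 2 (real n)\<rfloor> + 1"
    using assms by (auto simp: bit_length_def floorlog_def)
  ultimately show ?thesis by (simp) linarith
qed

section \<open>Rooted trees as parent functions\<close>

lemma rtrancl_distinct_path:
  assumes "(u, v) \<in> R\<^sup>*"
  obtains vs where "vs \<noteq> []" "hd vs = u" "last vs = v" "distinct vs"
    "successively (\<lambda>x y. (x, y) \<in> R) vs"
proof -
  have "\<exists>vs. vs \<noteq> [] \<and> hd vs = u \<and> last vs = v \<and> distinct vs \<and> successively (\<lambda>x y. (x, y) \<in> R) vs"
    using assms
  proof (induction rule: rtrancl_induct)
    case base
    then show ?case by (intro exI[of _ "[u]"]) auto
  next
    case (step y z)
    then obtain vs where vs: "vs \<noteq> []" "hd vs = u" "last vs = y" "distinct vs"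
      "successively (\<lambda>x y. (x, y) \<in> R) vs" by blast
    show ?case
    proof (cases "z \<in> set vs")
      case True
      \<comment> \<open>A path that returns to \<open>z\<close> is cut at the earlier visit.\<close>
      then obtain xs ys where "vs = xs @ z # ys" by (meson split_list)
      then show ?thesis using vs
        by (intro exI[of _ "xs @ [z]"]) (auto simp: successively_append_iff hd_append)
    next
      case False
      then show ?thesis using vs step.hyps
        by (intro exI[of _ "vs @ [z]"]) (auto simp: successively_append_iff)
    qed
  qed
  then show thesis using that by blast
qed

text \<open>A simple path from \<open>v\<close> back to \<open>u\<close> that avoids the edge would
  close up with it to a cycle. The path has at least three vertices, since with two it would be the
  forbidden edge itself.\<close>

lemma acyclic_edge_is_bridge:
  assumes "\<nexists>vs. is_cycle E vs" "(u, v) \<in> E" "u \<noteq> v"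
  shows "(v, u) \<notin> (E - {(u, v), (v, u)})\<^sup>*"
proof
  assume "(v, u) \<in> (E - {(u, v), (v, u)})\<^sup>*"
  then obtain vs where vs: "vs \<noteq> []" "hd vs = v" "last vs = u" "distinct vs"
    "successively (\<lambda>x y. (x, y) \<in> E - {(u, v), (v, u)}) vs"
    by (rule rtrancl_distinct_path)
  have "3 \<le> length vs"
  proof (rule ccontr)
    assume "\<not> ?thesis"
    then have "length vs = 1 \<or> length vs = 2"
      using vs(1) length_0_conv[of vs] by linarith
    then show False
    proof
      assume "length vs = 1"
      then show False using vs assms(3) by (auto simp: length_Suc_conv)
    next
      assume "length vs = 2"
      then obtain a b where "vs = [a, b]" by (auto simp: length_Suc_conv numeral_2_eq_2)
      then show False using vs by auto
    qed
  qed
  moreover have "(vs ! i, vs ! (Suc i mod length vs)) \<in> E" if "i < length vs" for i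
  proof (cases "Suc i = length vs")
    case True
    then have "i = length vs - 1" by simp
    then have "vs ! i = u" "vs ! 0 = v" using vs by (simp_all add: last_conv_nth hd_conv_nth)
    then show ?thesis using True assms(2) by simp
  next
    case False
    then have "Suc i < length vs" using that by simp
    then show ?thesis using vs(5) by (auto simp: successively_conv_nth)
  qed
  ultimately have "is_cycle E vs" using vs by (auto simp: is_cycle_def)
  then show False using assms(1) by blast
qed

text \<open>A strictly decreasing height replaces the statement that iterating \<open>f\<close>
  reaches 1. It excludes cycles at once, and conditions of this form survive the removal of
  leaves.\<close>

definition parent_map :: "nat \<Rightarrow> (nat \<Rightarrow> nat) \<Rightarrow> bool" where
  "parent_map n f \<longleftrightarrow> (\<exists>h :: nat \<Rightarrow> nat. \<forall>i\<in>{2..n}. f i \<in> {1..n} \<and> h (f i) < h i)"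

definition edges_of :: "nat \<Rightarrow> (nat \<Rightarrow> nat) \<Rightarrow> (nat \<times> nat) set" where
  "edges_of n f = {(i, f i) | i. i \<in> {2..n}}"

lemma edges_of_reach:
  assumes "\<forall>i\<in>{2..n}. f i \<in> {1..n} \<and> h (f i) < (h i :: nat)" "v \<in> {1..n}"
  shows "(v, 1) \<in> (edges_of n f)\<^sup>*"
  using assms(2)
proof (induction "h v" arbitrary: v rule: less_induct)
  case less
  show ?case
  proof (cases "v = 1")
    case False
    then have v: "v \<in> {2..n}" using less.prems by auto
    then have "(v, f v) \<in> edges_of n f" by (auto simp: edges_of_def)
    moreover have "(f v, 1) \<in> (edges_of n f)\<^sup>*"
      using assms(1) v by (intro less.hyps) auto
    ultimately show ?thesis by (rule converse_rtrancl_into_rtrancl)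
  qed auto
qed

text \<open>Reachability of 1 gives every other vertex a parent closer to 1; acyclicity shows that
  there are no edges besides these.\<close>

lemma rooted_tree_imp_parent_map:
  assumes "rooted_tree n T"
  obtains f where "parent_map n f" "T = edges_of n f"
proof -
  let ?E = "T \<union> T\<inverse>"
  have asym: "asym T" and sub: "T \<subseteq> {1..n} \<times> {1..n}" and nocyc: "\<nexists>vs. is_cycle ?E vs"
    and irr: "irrefl ?E" and reach: "\<forall>v\<in>{1..n}. (v, 1) \<in> T\<^sup>*"
    using assms unfolding rooted_tree_def is_tree_def by auto
  define h where "h x = (LEAST k. (x, 1) \<in> T ^^ k)" for x
  have step: "\<exists>y. (x, y) \<in> T \<and> h y < h x" if "x \<in> {2..n}" for x
  proof -
    have "\<exists>k. (x, 1) \<in> T ^^ k" using reach that rtrancl_imp_relpow by fastforce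
    then have hx: "(x, 1) \<in> T ^^ h x" unfolding h_def by (rule LeastI_ex)
    have "h x \<noteq> 0"
    proof
      assume "h x = 0"
      then show False using hx that by simp
    qed
    then obtain k where k: "h x = Suc k" using not0_implies_Suc by blast
    then obtain y where y: "(x, y) \<in> T" "(y, 1) \<in> T ^^ k"
      using hx by (metis relpow_Suc_D2)
    then have "h y \<le> k" unfolding h_def by (intro Least_le)
    then show ?thesis using y k by auto
  qed
  define f where "f x = (SOME y. (x, y) \<in> T \<and> h y < h x)" for x
  have f: "(x, f x) \<in> T" "h (f x) < h x" if "x \<in> {2..n}" for x
    using someI_ex[OF step[OF that]] by (auto simp: f_def)
  have pm: "\<forall>i\<in>{2..n}. f i \<in> {1..n} \<and> h (f i) < h i"
    using f sub by blast
  let ?G = "edges_of n f"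
  have GT: "?G \<subseteq> T" using f by (auto simp: edges_of_def)
  \<comment> \<open>An edge outside \<open>?G\<close> would be a bridge, but both its ends reach 1 inside \<open>?G\<close>.\<close>
  have "T \<subseteq> ?G"
  proof
    fix e assume "e \<in> T"
    then obtain v a where e: "e = (v, a)" "(v, a) \<in> T" by (cases e) auto
    show "e \<in> ?G"
    proof (rule ccontr)
      assume "e \<notin> ?G"
      let ?E' = "?E - {(v, a), (a, v)}"
      have sub': "?G \<union> ?G\<inverse> \<subseteq> ?E'"
        using GT \<open>e \<notin> ?G\<close> e asymD[OF asym e(2)] by blast
      have "v \<in> {1..n}" "a \<in> {1..n}" using e sub by auto
      then have "(a, 1) \<in> ?G\<^sup>*" "(v, 1) \<in> ?G\<^sup>*" using edges_of_reach[OF pm] by auto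
      then have "(a, 1) \<in> (?G \<union> ?G\<inverse>)\<^sup>*" "(1, v) \<in> (?G \<union> ?G\<inverse>)\<^sup>*"
        by (auto intro: in_rtrancl_UnI rtrancl_converseI)
      then have "(a, v) \<in> (?G \<union> ?G\<inverse>)\<^sup>*" by (rule rtrancl_trans)
      then have "(a, v) \<in> ?E'\<^sup>*" using sub' by (meson rtrancl_mono subsetD)
      moreover have "v \<noteq> a" using irr e by (auto simp: irrefl_def)
      ultimately show False using acyclic_edge_is_bridge[OF nocyc, of v a] e by blast
    qed
  qed
  with GT have "T = ?G" by blast
  then show thesis using that[of f] pm unfolding parent_map_def by blast
qed

lemma parent_map_imp_rooted_tree:
  assumes "parent_map n f" "1 \<le> n"
  shows "rooted_tree n (edges_of n f)"
proof -
  let ?T = "edges_of n f" let ?E = "?T \<union> ?T\<inverse>"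
  obtain h :: "nat \<Rightarrow> nat" where h: "\<forall>i\<in>{2..n}. f i \<in> {1..n} \<and> h (f i) < h i"
    using assms unfolding parent_map_def by blast
  have mem: "(x, y) \<in> ?T \<longleftrightarrow> x \<in> {2..n} \<and> y = f x" for x y
    by (auto simp: edges_of_def)
  \<comment> \<open>Of all neighbours of a vertex only its parent is not strictly higher.\<close>
  have up: "(x, y) \<in> ?E \<Longrightarrow> h y \<le> h x \<Longrightarrow> y = f x" for x y
    using h unfolding Un_iff converse_iff mem by (metis not_le)
  have "asym ?T"
  proof (rule asymI)
    fix x y assume "(x, y) \<in> ?T"
    then show "(y, x) \<notin> ?T" using h unfolding mem by (metis less_asym)
  qed
  moreover have "?E \<subseteq> {1..n} \<times> {1..n}" using h by (auto simp: mem)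
  moreover have "irrefl ?E"
    unfolding irrefl_def Un_iff converse_iff mem using h by (metis less_irrefl)
  moreover have r: "\<forall>v\<in>{1..n}. (v, 1) \<in> ?T\<^sup>*" using edges_of_reach[OF h] by blast
  moreover have "(u, v) \<in> ?E\<^sup>*" if "u \<in> {1..n}" "v \<in> {1..n}" for u v
  proof -
    have "(u, 1) \<in> ?T\<^sup>*" "(v, 1) \<in> ?T\<^sup>*" using r that by auto
    then have "(u, 1) \<in> ?E\<^sup>*" "(1, v) \<in> ?E\<^sup>*"
      by (auto intro: in_rtrancl_UnI rtrancl_converseI)
    then show ?thesis by (rule rtrancl_trans)
  qed
  moreover have "\<not> is_cycle ?E vs" for vs
  proof
    assume c: "is_cycle ?E vs"
    let ?m = "length vs"
    have len: "3 \<le> ?m" and d: "distinct vs"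
      and e: "\<And>i. i < ?m \<Longrightarrow> (vs ! i, vs ! (Suc i mod ?m)) \<in> ?E"
      using c unfolding is_cycle_def by auto
    have ne: "set vs \<noteq> {}" using len by auto
    then obtain x where x: "x \<in> set vs" "\<forall>y\<in>set vs. h y \<le> h x"
      using Max_in[of "h ` set vs"] Max_ge[of "h ` set vs"] by fastforce
    then obtain i where i: "i < ?m" "vs ! i = x" by (auto simp: in_set_conv_nth)
    \<comment> \<open>The two neighbours of a highest vertex on the cycle are both its parent.\<close>
    define a where "a = Suc i mod ?m"
    define b where "b = (if i = 0 then ?m - 1 else i - 1)"
    \<comment> \<open>The cyclic successor and predecessor differ because a cycle has at least three
      vertices.\<close>
    have ab: "a < ?m" "b < ?m" "a \<noteq> b" "Suc b mod ?m = i"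
      using len i unfolding a_def b_def by (auto simp: mod_Suc)
    have "(x, vs ! a) \<in> ?E" using e[OF i(1)] i by (simp add: a_def)
    then have "vs ! a = f x" using up x ab by auto
    moreover have "(vs ! b, x) \<in> ?E" using e[OF ab(2)] i ab by simp
    then have "(x, vs ! b) \<in> ?E" by auto
    then have "vs ! b = f x" using up x ab by auto
    ultimately show False using d ab nth_eq_iff_index_eq[OF d, of a b] by simp
  qed
  moreover have "sym ?E" by (rule sym_Un_converse)
  moreover have "{1..n} \<noteq> {}" using assms(2) by simp
  ultimately show ?thesis
    unfolding rooted_tree_def is_tree_def by blast
qed

lemma parent_edges_of: "i \<in> {2..n} \<Longrightarrow> parent (edges_of n f) i = f i"
  by (auto simp: parent_def edges_of_def)

lemma deg_edges_of:
  assumes "parent_map n f"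
  shows "deg (edges_of n f) i = (if i \<in> {2..n} then 1 else 0) + card {u\<in>{2..n}. f u = i}"
proof -
  obtain h :: "nat \<Rightarrow> nat" where h: "\<forall>i\<in>{2..n}. f i \<in> {1..n} \<and> h (f i) < h i"
    using assms unfolding parent_map_def by blast
  have eq: "{j. (i, j) \<in> edges_of n f \<union> (edges_of n f)\<inverse>} =
      (if i \<in> {2..n} then {f i} else {}) \<union> {u\<in>{2..n}. f u = i}"
    by (auto simp: edges_of_def)
  \<comment> \<open>Parent and child cannot coincide, or the height would drop in both
    directions.\<close>
  have "f i \<notin> {u\<in>{2..n}. f u = i}" if "i \<in> {2..n}"
    using h that by (metis (mono_tags, lifting) less_asym mem_Collect_eq)
  then show ?thesis
    unfolding deg_def eq by (auto simp: card_insert_if)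
qed

lemma parent_map_cong:
  assumes "\<forall>i\<in>{2..n}. f i = g i" "parent_map n f" shows "parent_map n g"
  using assms unfolding parent_map_def by (metis atLeastAtMost_iff)

lemma edges_of_cong: "\<forall>i\<in>{2..n}. f i = g i \<Longrightarrow> edges_of n f = edges_of n g"
  by (auto simp: edges_of_def)

section \<open>Pruefer codes\<close>

text \<open>The array \<open>d\<close> holds the degrees in the remaining tree; 0 marks a removed vertex. The leaf
  removed next is the largest one, because an ascending scan without early exit finds it.\<close>

definition leaf :: "nat \<Rightarrow> (nat \<Rightarrow> nat) \<Rightarrow> nat" where
  "leaf n d = Max {v\<in>{2..n}. d v = 1}"

definition prune :: "nat \<Rightarrow> nat \<Rightarrow> (nat \<Rightarrow> nat) \<Rightarrow> nat \<Rightarrow> nat" where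
  "prune x p d = (let d' = d(x := 0) in d'(p := d' p - 1))"

text \<open>The root is left out: its entry in \<open>d\<close> becomes 0 with the removal of its
  last child, yet the root itself is never removed.\<close>

definition rest :: "nat \<Rightarrow> (nat \<Rightarrow> nat) \<Rightarrow> nat set" where
  "rest n d = {v\<in>{2..n}. 0 < d v}"

fun prufer_code :: "nat \<Rightarrow> nat \<Rightarrow> (nat \<Rightarrow> nat) \<Rightarrow> (nat \<Rightarrow> nat) \<Rightarrow> nat list" where
  "prufer_code n 0 d f = []"
| "prufer_code n (Suc k) d f = f (leaf n d) # prufer_code n k (prune (leaf n d) (f (leaf n d)) d) f"

fun prufer_tree :: "nat \<Rightarrow> (nat \<Rightarrow> nat) \<Rightarrow> nat list \<Rightarrow> (nat \<Rightarrow> nat) \<Rightarrow> nat \<Rightarrow> nat" where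
  "prufer_tree n d [] g = g"
| "prufer_tree n d (p # w) g = prufer_tree n (prune (leaf n d) p d) w (g(leaf n d := p))"

text \<open>Invariant of pruning: the vertices left form a tree under \<open>f\<close> with degrees
  \<open>d\<close>. The root has no parent edge, so its degree is the bare number of its
  children.\<close>

definition tree_degrees :: "nat \<Rightarrow> (nat \<Rightarrow> nat) \<Rightarrow> (nat \<Rightarrow> nat) \<Rightarrow> bool" where
  "tree_degrees n d f \<longleftrightarrow>
     (\<exists>h :: nat \<Rightarrow> nat. \<forall>v\<in>rest n d. f v \<in> insert 1 (rest n d) \<and> h (f v) < h v) \<and>
     (\<forall>v\<in>rest n d. d v = Suc (card {u\<in>rest n d. f u = v})) \<and>
     d 1 = card {u\<in>rest n d. f u = 1}"

text \<open>The counterpart for the letters still to be read. There is one letter for each vertex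
  left, and the last one is 1 because the vertex removed last hangs on the root.\<close>

definition word_degrees :: "nat \<Rightarrow> (nat \<Rightarrow> nat) \<Rightarrow> nat list \<Rightarrow> bool" where
  "word_degrees n d w \<longleftrightarrow> length w = card (rest n d) \<and> set w \<subseteq> insert 1 (rest n d) \<and>
     (\<forall>v\<in>rest n d. d v = Suc (count_list w v)) \<and> d 1 = count_list w 1 \<and>
     (w \<noteq> [] \<longrightarrow> last w = 1)"

lemma finite_rest [simp]: "finite (rest n d)" by (simp add: rest_def)

lemma one_notin_rest [simp]: "Suc 0 \<notin> rest n d" by (simp add: rest_def)

lemma leaf_in:
  assumes "v \<in> rest n d" "d v = 1"
  shows "leaf n d \<in> rest n d" "d (leaf n d) = 1"
proof -
  have "leaf n d \<in> {v\<in>{2..n}. d v = 1}"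
    unfolding leaf_def using assms by (intro Max_in) (auto simp: rest_def)
  then show "leaf n d \<in> rest n d" "d (leaf n d) = 1" by (auto simp: rest_def)
qed

lemma rest_prune:
  assumes "p \<noteq> x" "p \<in> rest n d \<Longrightarrow> 2 \<le> d p"
  shows "rest n (prune x p d) = rest n d - {x}"
proof -
  have "(v \<in> rest n (prune x p d)) = (v \<in> rest n d - {x})" for v
    using assms by (cases "v = p") (auto simp: rest_def prune_def Let_def)
  then show ?thesis by blast
qed

lemma card_children:
  assumes "x \<in> R" "finite R"
  shows "card {u\<in>R. f u = v} = card {u\<in>R - {x}. f u = v} + (if f x = v then 1 else 0)"
proof (cases "f x = v")
  case True
  then have "{u\<in>R. f u = v} = insert x {u\<in>R - {x}. f u = v}" using assms by auto
  then show ?thesis using True assms(2) by (simp add: card_insert_if)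
next
  case False
  then have "{u\<in>R. f u = v} = {u\<in>R - {x}. f u = v}" by auto
  then show ?thesis using False by simp
qed

text \<open>A remaining vertex of maximal height cannot be a parent, so its degree is 1.\<close>

lemma tree_degrees_leaf:
  assumes "tree_degrees n d f" "rest n d \<noteq> {}"
  shows "leaf n d \<in> rest n d" "d (leaf n d) = 1"
proof -
  obtain h :: "nat \<Rightarrow> nat" where h: "\<forall>v\<in>rest n d. h (f v) < h v"
    and d: "\<forall>v\<in>rest n d. d v = Suc (card {u\<in>rest n d. f u = v})"
    using assms unfolding tree_degrees_def by blast
  obtain v where v: "v \<in> rest n d" "\<forall>u\<in>rest n d. h u \<le> h v"
    using Max_in[of "h ` rest n d"] Max_ge[of "h ` rest n d"] assms(2) by fastforce
  then have "{u\<in>rest n d. f u = v} = {}" using h by force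
  then have "d v = 1" using d v by simp
  then show "leaf n d \<in> rest n d" "d (leaf n d) = 1" using leaf_in v by auto
qed

text \<open>A vertex of degree 1 is nobody's parent; its removal leaves all other parents in place,
  and the old height still works.\<close>

lemma tree_degrees_prune:
  assumes t: "tree_degrees n d f" and x: "x \<in> rest n d" "d x = 1"
  shows "f x \<in> insert 1 (rest n d)" "f x \<noteq> x"
    "rest n (prune x (f x) d) = rest n d - {x}" "tree_degrees n (prune x (f x) d) f"
proof -
  let ?d = "prune x (f x) d"
  obtain h :: "nat \<Rightarrow> nat" where h: "\<forall>v\<in>rest n d. f v \<in> insert 1 (rest n d) \<and> h (f v) < h v"
    and d: "\<forall>v\<in>rest n d. d v = Suc (card {u\<in>rest n d. f u = v})"
    and d1: "d 1 = card {u\<in>rest n d. f u = 1}"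
    using t unfolding tree_degrees_def by blast
  show fx: "f x \<in> insert 1 (rest n d)" "f x \<noteq> x" using h x by auto
  have "0 < card {u\<in>rest n d. f u = f x}" using x by (auto simp: card_gt_0_iff)
  then have "2 \<le> d (f x)" if "f x \<in> rest n d" using that d by auto
  with fx show r: "rest n ?d = rest n d - {x}" by (intro rest_prune) auto
  have "card {u\<in>rest n d. f u = x} = 0" using d x by auto
  then have nx: "f u \<noteq> x" if "u \<in> rest n d" for u using that by auto
  have x1: "x \<noteq> 1" using x by (auto simp: rest_def)
  have c: "card {u\<in>rest n d. f u = v} = card {u\<in>rest n d - {x}. f u = v} + (if f x = v then 1 else 0)" for v
    using x by (intro card_children) auto
  show "tree_degrees n ?d f"
    unfolding tree_degrees_def r
  proof (intro conjI)
    show "\<exists>h :: nat \<Rightarrow> nat. \<forall>v\<in>rest n d - {x}. f v \<in> insert 1 (rest n d - {x}) \<and> h (f v) < h v"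
      using h nx by (intro exI[of _ h]) auto
    show "\<forall>v\<in>rest n d - {x}. ?d v = Suc (card {u \<in> rest n d - {x}. f u = v})"
      using d c by (auto simp: prune_def Let_def)
    show "?d 1 = card {u \<in> rest n d - {x}. f u = 1}"
      using d1 c[of 1] x1 by (auto simp: prune_def Let_def)
  qed
qed

lemma tree_degrees_unprune:
  assumes t: "tree_degrees n (prune x p d) f" and x: "x \<in> rest n d" "d x = 1"
    and p: "f x = p" "p \<in> insert 1 (rest n d)" "p \<noteq> x" "p \<in> rest n d \<Longrightarrow> 2 \<le> d p"
      "p = 1 \<Longrightarrow> 1 \<le> d 1"
  shows "tree_degrees n d f"
proof -
  let ?d = "prune x p d"
  have r: "rest n ?d = rest n d - {x}" using p by (intro rest_prune)
  obtain h :: "nat \<Rightarrow> nat" where h: "\<forall>v\<in>rest n d - {x}. f v \<in> insert 1 (rest n d - {x}) \<and> h (f v) < h v"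
    and d: "\<forall>v\<in>rest n d - {x}. ?d v = Suc (card {u\<in>rest n d - {x}. f u = v})"
    and d1: "?d 1 = card {u\<in>rest n d - {x}. f u = 1}"
    using t unfolding tree_degrees_def r by blast
  have x1: "x \<noteq> 1" using x by (auto simp: rest_def)
  have c: "card {u\<in>rest n d. f u = v} = card {u\<in>rest n d - {x}. f u = v} + (if p = v then 1 else 0)" for v
    using x p(1) card_children[of x "rest n d" f v] by auto
  have nx: "f u \<noteq> x" if "u \<in> rest n d - {x}" for u using h that x1 by auto
  show ?thesis
    unfolding tree_degrees_def
  proof (intro conjI)
    \<comment> \<open>Put back above its parent, the leaf \<open>x\<close> gets the height of
      \<open>p\<close> plus one; the other heights can stay because nobody points to
      \<open>x\<close>.\<close>
    show "\<exists>h :: nat \<Rightarrow> nat. \<forall>v\<in>rest n d. f v \<in> insert 1 (rest n d) \<and> h (f v) < h v"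
      using h nx p by (intro exI[of _ "h(x := Suc (h p))"]) auto
    have "card {u\<in>rest n d - {x}. f u = x} = 0" using nx by auto
    then show "\<forall>v\<in>rest n d. d v = Suc (card {u \<in> rest n d. f u = v})"
    proof (intro ballI)
      fix v assume z: "card {u\<in>rest n d - {x}. f u = x} = 0" and v: "v \<in> rest n d"
      show "d v = Suc (card {u \<in> rest n d. f u = v})"
      proof (cases "v = x")
        case True
        then show ?thesis using z c[of x] x(2) p(3) by simp
      next
        case False
        then have "?d v = Suc (card {u\<in>rest n d - {x}. f u = v})" using d v by auto
        then show ?thesis using c[of v] False p(4) v by (auto simp: prune_def Let_def split: if_splits)
      qed
    qed
    show "d 1 = card {u \<in> rest n d. f u = 1}"
      using d1 c[of 1] x1 p(5) by (auto simp: prune_def Let_def split: if_splits)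
  qed
qed

text \<open>The leaf removed depends only on the current degrees, and these only on the letters
  read; so encoding and decoding visit the vertices in the same order, and one induction handles
  both. The default \<open>g\<close> stands for the tree array before decoding.\<close>

lemma prufer_code_correct:
  assumes "tree_degrees n d f" "card (rest n d) = k"
  shows "word_degrees n d (prufer_code n k d f)"
    and "prufer_tree n d (prufer_code n k d f) g = (\<lambda>v. if v \<in> rest n d then f v else g v)"
proof -
  have "word_degrees n d (prufer_code n k d f) \<and>
      prufer_tree n d (prufer_code n k d f) g = (\<lambda>v. if v \<in> rest n d then f v else g v)"
    using assms
  proof (induction k arbitrary: d g)
    case 0
    then have "rest n d = {}" by simp
    then show ?case using 0 by (auto simp: word_degrees_def tree_degrees_def)
  next
    case (Suc k)
    let ?x = "leaf n d" let ?p = "f ?x" let ?d = "prune ?x ?p d" let ?w = "prufer_code n k ?d f"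
    have "rest n d \<noteq> {}" using Suc.prems by auto
    note x = tree_degrees_leaf[OF Suc.prems(1) this]
    note p = tree_degrees_prune[OF Suc.prems(1) x]
    have ck: "card (rest n ?d) = k" using Suc.prems(2) p(3) x(1) by simp
    have IH: "word_degrees n ?d ?w"
      "prufer_tree n ?d ?w (g(?x := ?p)) = (\<lambda>v. if v \<in> rest n ?d then f v else (g(?x := ?p)) v)"
      using Suc.IH[OF p(4) ck] by auto
    have x1: "?x \<noteq> 1" using x by (auto simp: rest_def)
    have "prufer_tree n d (prufer_code n (Suc k) d f) g = (\<lambda>v. if v \<in> rest n d then f v else g v)"
      using IH(2) p(3) x(1) by (auto simp: fun_eq_iff)
    moreover have "word_degrees n d (prufer_code n (Suc k) d f)"
    proof -
      have t: "d v = Suc (card {u\<in>rest n d. f u = v})" if "v \<in> rest n d" for v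
        using Suc.prems(1) that by (simp add: tree_degrees_def)
      have t1: "d 1 = card {u\<in>rest n d. f u = 1}"
        using Suc.prems(1) by (simp add: tree_degrees_def)
      have pos: "0 < card {u\<in>rest n d. f u = ?p}" using x by (auto simp: card_gt_0_iff)
      \<comment> \<open>The leaf is gone when \<open>?w\<close> is read and cannot occur there,
        which matches its degree 1.\<close>
      have "?x \<notin> set ?w" using IH(1) p(3) x1 by (auto simp: word_degrees_def)
      then have cx: "count_list ?w ?x = 0" by simp
      have "d v = Suc (count_list (?p # ?w) v)" if v: "v \<in> rest n d" for v
      proof (cases "v = ?x")
        case True
        then show ?thesis using p(2) x(2) cx by auto
      next
        case False
        then have "?d v = Suc (count_list ?w v)" using IH(1) p(3) v by (auto simp: word_degrees_def)
        then show ?thesis using False t[OF v] pos by (auto simp: prune_def Let_def split: if_splits)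
      qed
      moreover have "?d 1 = count_list ?w 1" using IH(1) by (simp add: word_degrees_def)
      then have "d 1 = count_list (?p # ?w) 1"
        using t1 pos x1 by (auto simp: prune_def Let_def split: if_splits)
      moreover have "last (?p # ?w) = 1"
      proof (cases "?w = []")
        case True
        then have "rest n d - {?x} = {}" using IH(1) p(3) by (auto simp: word_degrees_def)
        then show ?thesis using True p(1,2) by auto
      next
        case False
        then show ?thesis using IH(1) by (auto simp: word_degrees_def)
      qed
      moreover have "length (?p # ?w) = card (rest n d)" "set (?p # ?w) \<subseteq> insert 1 (rest n d)"
        using IH(1) p ck Suc.prems(2) by (auto simp: word_degrees_def)
      ultimately show ?thesis by (auto simp: word_degrees_def)
    qed
    ultimately show ?case by blast
  qed
  then show "word_degrees n d (prufer_code n k d f)"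
    "prufer_tree n d (prufer_code n k d f) g = (\<lambda>v. if v \<in> rest n d then f v else g v)" by blast+
qed

text \<open>Pigeonhole: if all remaining vertices had degree at least 2, each would occur in
  \<open>w\<close>, and so does 1 as the last letter. That is one distinct letter more than the
  length of \<open>w\<close>.\<close>

lemma word_degrees_leaf:
  assumes "word_degrees n d w" "w \<noteq> []"
  shows "leaf n d \<in> rest n d" "d (leaf n d) = 1"
proof -
  have "\<exists>v\<in>rest n d. d v = 1"
  proof (rule ccontr)
    assume "\<not> ?thesis"
    then have "count_list w v \<noteq> 0" if "v \<in> rest n d" for v
      using assms(1) that by (auto simp: word_degrees_def)
    then have "rest n d \<subseteq> set w" by (auto simp: count_list_0_iff)
    moreover have "1 \<in> set w" using assms last_in_set[of w] by (auto simp: word_degrees_def)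
    ultimately have "card (insert 1 (rest n d)) \<le> card (set w)"
      by (intro card_mono) auto
    also have "\<dots> \<le> card (rest n d)"
      using assms(1) card_length[of w] by (simp add: word_degrees_def)
    finally show False by simp
  qed
  then show "leaf n d \<in> rest n d" "d (leaf n d) = 1" using leaf_in by blast+
qed

lemma word_degrees_prune:
  assumes w: "word_degrees n d (p # w)"
  defines "x \<equiv> leaf n d"
  shows "x \<in> rest n d" "d x = 1" "p \<in> insert 1 (rest n d)" "p \<noteq> x" "p \<in> rest n d \<Longrightarrow> 2 \<le> d p"
      "p = 1 \<Longrightarrow> 1 \<le> d 1" "rest n (prune x p d) = rest n d - {x}" "word_degrees n (prune x p d) w"
proof -
  show x: "x \<in> rest n d" "d x = 1"
    using word_degrees_leaf[OF w] by (auto simp: x_def)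
  have x1: "x \<noteq> 1" using x by (auto simp: rest_def)
  have dx: "d x = Suc (count_list (p # w) x)" using w x by (simp add: word_degrees_def)
  with x show px: "p \<noteq> x" by auto
  show p: "p \<in> insert 1 (rest n d)" "p \<in> rest n d \<Longrightarrow> 2 \<le> d p" "p = 1 \<Longrightarrow> 1 \<le> d 1"
    using w by (auto simp: word_degrees_def)
  show r: "rest n (prune x p d) = rest n d - {x}" using px p by (intro rest_prune)
  have "x \<notin> set w" using dx x by (auto simp: count_list_0_iff split: if_splits)
  moreover have "last w = 1" if "w \<noteq> []" using w that by (auto simp: word_degrees_def)
  ultimately show "word_degrees n (prune x p d) w"
    using w x p px x1 unfolding word_degrees_def r
    by (auto simp: prune_def Let_def split: if_splits)
qed

lemma prufer_tree_correct:
  assumes "word_degrees n d w"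
  shows "tree_degrees n d (prufer_tree n d w g)" "prufer_code n (length w) d (prufer_tree n d w g) = w"
proof -
  \<comment> \<open>The third claim keeps the entry of the first leaf intact while the remaining
    letters are decoded.\<close>
  have "tree_degrees n d (prufer_tree n d w g) \<and> prufer_code n (length w) d (prufer_tree n d w g) = w \<and>
      (\<forall>v. v \<notin> rest n d \<longrightarrow> prufer_tree n d w g v = g v)"
    using assms
  proof (induction w arbitrary: d g)
    case Nil
    then show ?case by (auto simp: word_degrees_def tree_degrees_def)
  next
    case (Cons p w)
    let ?x = "leaf n d" let ?d = "prune ?x p d" let ?f = "prufer_tree n ?d w (g(?x := p))"
    note x = word_degrees_prune[OF Cons.prems]
    have IH: "tree_degrees n ?d ?f" "prufer_code n (length w) ?d ?f = w"
      "\<And>v. v \<notin> rest n ?d \<Longrightarrow> ?f v = (g(?x := p)) v"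
      using Cons.IH[OF x(8)] by auto
    have fx: "?f ?x = p" using IH(3)[of ?x] x(7) by simp
    have "tree_degrees n d ?f"
      using tree_degrees_unprune[OF IH(1) x(1,2) fx x(3-6)] .
    moreover have "prufer_code n (length (p # w)) d ?f = p # w" using fx IH(2) by simp
    moreover have "?f v = g v" if "v \<notin> rest n d" for v
      using that IH(3)[of v] x(1,7) by auto
    ultimately show ?case by (simp only: prufer_tree.simps) blast
  qed
  then show "tree_degrees n d (prufer_tree n d w g)" "prufer_code n (length w) d (prufer_tree n d w g) = w" by blast+
qed

text \<open>Mediates between the code of n - 1 letters, for which the inductions work, and the
  ranked word, which lacks the final 1.\<close>

lemma prufer_code_take: "k \<le> l \<Longrightarrow> prufer_code n k d f = take k (prufer_code n l d f)"
proof (induction k arbitrary: d l)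
  case (Suc k)
  then show ?case by (cases l) auto
qed simp

lemma length_prufer_code [simp]: "length (prufer_code n k d f) = k"
  by (induction k arbitrary: d) auto

section \<open>Ranking words with prescribed letter counts\<close>

text \<open>The combinatorial number system, place by place: with \<open>l\<close> occurrences left
  and \<open>N\<close> places to the right, \<open>N choose l\<close> words have no occurrence here,
  and all of them precede those that have one.\<close>

primrec subset_rank :: "'a \<Rightarrow> 'a list \<Rightarrow> nat" where
  "subset_rank v [] = 0"
| "subset_rank v (x # xs) = (if x = v then length xs choose Suc (count_list xs v) else 0) + subset_rank v xs"

text \<open>Pascal's rule: an occurrence adds \<open>N choose l\<close> to a rank that is below
  \<open>N choose (l - 1)\<close>.\<close>

lemma subset_rank_less: "subset_rank v w < (length w choose count_list w v)"
proof (induction w)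
  case (Cons x xs)
  have "(length xs choose c) \<le> (Suc (length xs) choose c)" for c
    by (cases c) auto
  then show ?case using Cons order.strict_trans2 by fastforce
qed simp

text \<open>Where exactly one of the two words has an occurrence, its rank is at least
  \<open>N choose l\<close> and the other rank is below this number.\<close>

lemma subset_rank_inj:
  assumes "length w = length w'" "count_list w v = count_list w' v" "subset_rank v w = subset_rank v w'"
  shows "map (\<lambda>x. x = v) w = map (\<lambda>x. x = v) w'"
  using assms
proof (induction w w' rule: list_induct2)
  case (Cons x xs y ys)
  show ?case
  proof (cases "(x = v) = (y = v)")
    case True
    then show ?thesis using Cons by (auto split: if_splits)
  next
    case False
    then show ?thesis
      using Cons.prems Cons.hyps subset_rank_less[of v xs] subset_rank_less[of v ys] by (auto split: if_splits)
  qed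
qed simp

lemma subset_rank_map: "subset_rank v w = subset_rank True (map (\<lambda>x. x = v) w)"
  and count_list_map_eq: "count_list w v = count_list (map (\<lambda>x. x = v) w) True"
proof -
  show c: "count_list w v = count_list (map (\<lambda>x. x = v) w) True" for w
    by (induction w) auto
  show "subset_rank v w = subset_rank True (map (\<lambda>x. x = v) w)"
    by (induction w) (auto simp: c)
qed

text \<open>The parameter \<open>base\<close> leaves room for a less significant digit below \<open>base\<close>.\<close>

primrec multinomial :: "nat \<Rightarrow> nat list \<Rightarrow> nat" where
  "multinomial base [] = base"
| "multinomial base (c # cs) = ((c + sum_list cs) choose c) * multinomial base cs"

text \<open>If the \<open>t\<close>-th entry of \<open>word_positions os w\<close> is \<open>j\<close> and the \<open>t\<close>-th row is \<open>(N, l, B)\<close>, then this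
  occurrence has \<open>N - j\<close> positions to its right, is followed there by \<open>l - 1\<close> occurrences of the same
  letter, and contributes \<open>(N - j choose l) * B\<close> to the rank.\<close>

primrec rows :: "nat \<Rightarrow> nat list \<Rightarrow> (nat \<times> nat \<times> nat) list" where
  "rows base [] = []"
| "rows base (c # cs) = map (\<lambda>i. (c + sum_list cs, c - i, multinomial base cs)) [0..<c] @ rows base cs"

fun weight_of :: "nat \<times> nat \<times> nat \<Rightarrow> nat \<Rightarrow> nat" where
  "weight_of (N, l, B) j = ((N - j) choose l) * B"

text \<open>Positions are counted from 1, like the entries of the arrays in the programs.\<close>

definition occurrences :: "'a \<Rightarrow> 'a list \<Rightarrow> nat list" where
  "occurrences v w = map Suc (filter (\<lambda>j. w ! j = v) [0..<length w])"

text \<open>Positions refer to the word from which the earlier letters of the order have been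
  deleted, since each subset is ranked among the places left over.\<close>

primrec word_positions :: "'a list \<Rightarrow> 'a list \<Rightarrow> nat list" where
  "word_positions [] w = []"
| "word_positions (v # os) w = occurrences v w @ word_positions os (filter (\<lambda>x. x \<noteq> v) w)"

definition word_rank :: "nat \<Rightarrow> nat list \<Rightarrow> nat list \<Rightarrow> nat" where
  "word_rank base cs ps = sum_list (map2 weight_of (rows base cs) ps)"

definition words :: "'a list \<Rightarrow> ('a \<Rightarrow> nat) \<Rightarrow> 'a list set" where
  "words os c = {w. set w \<subseteq> set os \<and> (\<forall>v\<in>set os. count_list w v = c v)}"

lemma occurrences_Nil [simp]: "occurrences v [] = []" by (simp add: occurrences_def)

lemma occurrences_Cons: "occurrences v (x # xs) = (if x = v then [1] else []) @ map Suc (occurrences v xs)"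
proof -
  have "[0..<length (x # xs)] = 0 # map Suc [0..<length xs]"
    by (simp add: upt_conv_Cons map_Suc_upt del: upt_Suc)
  then show ?thesis by (simp add: occurrences_def filter_map o_def)
qed

lemma length_occurrences [simp]: "length (occurrences v w) = count_list w v"
  by (induction w) (auto simp: occurrences_Cons)

lemma occurrences_snoc: "occurrences v (xs @ [x]) = occurrences v xs @ (if x = v then [Suc (length xs)] else [])"
  by (auto simp: occurrences_def nth_append intro!: filter_cong)

lemma words_Cons:
  assumes "w \<in> words (v # os) c" "distinct (v # os)"
  shows "count_list w v = c v" "filter (\<lambda>x. x \<noteq> v) w \<in> words os c"
proof -
  have "count_list (filter (\<lambda>x. x \<noteq> v) w) u = count_list w u" if "u \<noteq> v" for u
    using that by (induction w) auto
  then show "count_list w v = c v" "filter (\<lambda>x. x \<noteq> v) w \<in> words os c"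
    using assms by (auto simp: words_def) metis
qed

lemma length_filter_neq: "length w = count_list w v + length (filter (\<lambda>x. x \<noteq> v) w)"
  by (induction w) auto

lemma words_length:
  assumes "w \<in> words os c" "distinct os"
  shows "length w = sum_list (map c os)"
  using assms
proof (induction os arbitrary: w)
  case Nil
  then show ?case by (simp add: words_def)
next
  case (Cons v os)
  then show ?case using words_Cons[OF Cons.prems] length_filter_neq[of w v] by auto
qed

lemma length_rows [simp]: "length (rows base cs) = sum_list cs"
  by (induction cs) auto

lemma length_word_positions:
  assumes "w \<in> words os c" "distinct os"
  shows "length (word_positions os w) = length w"
  using assms
proof (induction os arbitrary: w)
  case Nil
  then show ?case by (simp add: words_def)
next
  case (Cons v os)
  then show ?case using words_Cons[OF Cons.prems] length_filter_neq[of w v] by auto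
qed

lemma word_positions_range: "j \<in> set (word_positions os w) \<Longrightarrow> j \<in> {1..length w}"
proof (induction os arbitrary: w)
  case (Cons v os)
  then show ?case using le_trans[OF _ length_filter_le] by (fastforce simp: occurrences_def)
qed simp

lemma subset_rank_eq_sum:
  "sum_list (map2 weight_of (map (\<lambda>i. (length w, count_list w v - i, B)) [0..<count_list w v]) (occurrences v w))
    = subset_rank v w * B"
proof (induction w)
  case (Cons x xs)
  let ?c = "count_list xs v"
  \<comment> \<open>A letter in front moves every position and the length by one, so the differences
    \<open>N - j\<close> and with them the weights remain.\<close>
  have shift: "sum_list (map2 weight_of (map (\<lambda>i. (Suc (length xs), ?c - i, B)) [0..<?c]) (map Suc (occurrences v xs)))
      = subset_rank v xs * B"
    unfolding Cons.IH[symmetric]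
    by (simp add: zip_map1 zip_map2 map_map o_def case_prod_beta)
  show ?case
  proof (cases "x = v")
    case True
    have "[0..<Suc ?c] = 0 # map Suc [0..<?c]"
      by (simp add: upt_conv_Cons map_Suc_upt del: upt_Suc)
    then show ?thesis using True shift
      by (simp add: occurrences_Cons o_def algebra_simps del: upt_Suc)
  next
    case False
    then show ?thesis using shift by (simp add: occurrences_Cons)
  qed
qed simp

lemma word_rank_Nil [simp]: "word_rank base [] ps = 0"
  by (simp add: word_rank_def)

lemma word_rank_Cons:
  assumes "w \<in> words (v # os) c" "distinct (v # os)"
  shows "word_rank base (map c (v # os)) (word_positions (v # os) w) =
    subset_rank v w * multinomial base (map c os) +
    word_rank base (map c os) (word_positions os (filter (\<lambda>x. x \<noteq> v) w))"
proof -
  have c: "count_list w v = c v" "c v + sum_list (map c os) = length w"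
    using words_Cons[OF assms] words_length[OF assms] by auto
  show ?thesis
    using subset_rank_eq_sum[of w v "multinomial base (map c os)"] unfolding c(1)
    by (simp add: word_rank_def c del: weight_of.simps)
qed

text \<open>The lower digits together with \<open>r\<close> stay below the place value, so the
  leading digit decides, and \<open>subset_rank_less\<close> keeps it below its radix.\<close>

lemma word_rank_less:
  assumes "w \<in> words os c" "distinct os" "r < base"
  shows "word_rank base (map c os) (word_positions os w) + r < multinomial base (map c os)"
  using assms(1,2)
proof (induction os arbitrary: w)
  case (Cons v os)
  note wc = words_Cons[OF Cons.prems]
  let ?B = "multinomial base (map c os)" let ?w = "filter (\<lambda>x. x \<noteq> v) w"
  have "word_rank base (map c os) (word_positions os ?w) + r < ?B" using Cons wc by simp
  then have "subset_rank v w * ?B + (word_rank base (map c os) (word_positions os ?w) + r) < Suc (subset_rank v w) * ?B" by simp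
  also have "Suc (subset_rank v w) \<le> (length w choose c v)"
    using subset_rank_less[of v w] wc(1) by simp
  then have "Suc (subset_rank v w) * ?B \<le> (length w choose c v) * ?B" by (rule mult_le_mono1)
  finally show ?case
    using word_rank_Cons[OF Cons.prems, of base] words_length[OF Cons.prems] by simp
qed (simp add: assms)

lemma eq_if_eq_except:
  assumes "map (\<lambda>x. x = v) w = map (\<lambda>x. x = v) w'" "filter (\<lambda>x. x \<noteq> v) w = filter (\<lambda>x. x \<noteq> v) w'"
  shows "w = w'"
proof -
  have "length w = length w'" using assms(1) by (rule map_eq_imp_length_eq)
  then show ?thesis using assms
    by (induction w w' rule: list_induct2) (auto split: if_splits)
qed

text \<open>Quotient and remainder by the place value recover the leading digit and the rank of the
  rest; the leading digit determines where \<open>v\<close> stands.\<close>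

lemma word_rank_inj:
  assumes "w \<in> words os c" "w' \<in> words os c" "distinct os" "r < base" "r' < base"
    "word_rank base (map c os) (word_positions os w) + r = word_rank base (map c os) (word_positions os w') + r'"
  shows "w = w' \<and> r = r'"
  using assms(1-3,6)
proof (induction os arbitrary: w w')
  case Nil
  then show ?case by (simp add: words_def)
next
  case (Cons v os)
  let ?B = "multinomial base (map c os)"
  let ?f = "\<lambda>w. filter (\<lambda>x. x \<noteq> v) w"
  let ?R = "\<lambda>w. word_rank base (map c os) (word_positions os (?f w))"
  note wc = words_Cons[OF Cons.prems(1,3)] words_Cons[OF Cons.prems(2,3)]
  have d: "distinct os" using Cons.prems by simp
  have lt: "?R w + r < ?B" "?R w' + r' < ?B" using word_rank_less wc d assms by blast+
  have eq: "subset_rank v w * ?B + (?R w + r) = subset_rank v w' * ?B + (?R w' + r')"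
    using Cons.prems(4) word_rank_Cons[OF Cons.prems(1,3), of base] word_rank_Cons[OF Cons.prems(2,3), of base]
    by simp
  have s: "subset_rank v w = subset_rank v w'"
    using arg_cong[OF eq, of "\<lambda>x. x div ?B"] lt by simp
  have e: "?R w + r = ?R w' + r'"
    using arg_cong[OF eq, of "\<lambda>x. x mod ?B"] lt by simp
  have "length w = length w'"
    using words_length[OF Cons.prems(1,3)] words_length[OF Cons.prems(2,3)] by simp
  moreover have "count_list w v = count_list w' v" by (simp only: wc(1,3))
  ultimately have "map (\<lambda>x. x = v) w = map (\<lambda>x. x = v) w'" using s
    by (rule subset_rank_inj[of w w' v])
  moreover have "?f w = ?f w'" "r = r'" using Cons.IH[OF wc(2,4) d e] by (rule conjunct1, rule conjunct2)
  ultimately show ?case using eq_if_eq_except[of v w w'] by simp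
qed

section \<open>Unranking subsets and words\<close>

fun subset_unrank :: "nat \<Rightarrow> nat \<Rightarrow> nat \<Rightarrow> bool list" where
  "subset_unrank 0 l q = []"
| "subset_unrank (Suc N) l q = (if (N choose l) \<le> q then True # subset_unrank N (l - 1) (q - (N choose l))
     else False # subset_unrank N l q)"

lemma length_subset_unrank [simp]: "length (subset_unrank N l q) = N"
  by (induction N arbitrary: l q) auto

text \<open>The greedy choice is forced: the place is free exactly when \<open>q\<close> is below
  \<open>N choose l\<close>. The decrement of \<open>l\<close> never happens at 0, because
  \<open>q\<close> is then below 1.\<close>

lemma subset_unrank_correct:
  assumes "q < (N choose l)"
  shows "count_list (subset_unrank N l q) True = l \<and> subset_rank True (subset_unrank N l q) = q"
  using assms
proof (induction N arbitrary: l q)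
  case 0
  then show ?case by (cases l) auto
next
  case (Suc N)
  show ?case
  proof (cases "(N choose l) \<le> q")
    case True
    then obtain l' where l: "l = Suc l'" using Suc.prems by (cases l) auto
    have "q - (N choose l) < (N choose l')" using Suc.prems True l by auto
    from Suc.IH[OF this] show ?thesis using True l by simp
  next
    case False
    then show ?thesis using Suc.IH[of q l] by simp
  qed
qed

text \<open>Undoes the split of a word into the indicator of \<open>v\<close> and the word without
  \<open>v\<close>.\<close>

primrec merge :: "'a \<Rightarrow> bool list \<Rightarrow> 'a list \<Rightarrow> 'a list" where
  "merge v [] ws = []"
| "merge v (b # bs) ws = (if b then v # merge v bs ws else hd ws # merge v bs (tl ws))"

lemma merge_correct:
  assumes "length ws = count_list bs False" "v \<notin> set ws"
  shows "map (\<lambda>x. x = v) (merge v bs ws) = bs" "filter (\<lambda>x. x \<noteq> v) (merge v bs ws) = ws"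
proof -
  have "map (\<lambda>x. x = v) (merge v bs ws) = bs \<and> filter (\<lambda>x. x \<noteq> v) (merge v bs ws) = ws"
    using assms
  proof (induction bs arbitrary: ws)
    case (Cons b bs)
    then show ?case by (cases ws) (auto split: if_splits)
  qed simp
  then show "map (\<lambda>x. x = v) (merge v bs ws) = bs" "filter (\<lambda>x. x \<noteq> v) (merge v bs ws) = ws"
    by blast+
qed

fun digits :: "nat \<Rightarrow> nat list \<Rightarrow> nat \<Rightarrow> nat list" where
  "digits base [] m = []"
| "digits base (c # cs) m = (m div multinomial base cs) # digits base cs (m mod multinomial base cs)"

text \<open>The part of the number below \<open>base\<close>. When \<open>base\<close> is the number
  of trees with a given degree sequence, this is the rank of the tree among them.\<close>

fun remainder :: "nat \<Rightarrow> nat list \<Rightarrow> nat \<Rightarrow> nat" where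
  "remainder base [] m = m"
| "remainder base (c # cs) m = remainder base cs (m mod multinomial base cs)"

fun word_of_digits :: "'a list \<Rightarrow> nat list \<Rightarrow> nat list \<Rightarrow> 'a list" where
  "word_of_digits (v # os) (c # cs) (q # qs) = merge v (subset_unrank (c + sum_list cs) c q) (word_of_digits os cs qs)"
| "word_of_digits _ _ _ = []"

lemma length_digits [simp]: "length (digits base cs m) = length cs"
  by (induction cs arbitrary: m) auto

lemma multinomial_pos: "0 < base \<Longrightarrow> 0 < multinomial base cs"
  by (induction cs) auto

lemma digit_less:
  assumes "0 < base" "m < multinomial base (c # cs)"
  shows "m div multinomial base cs < ((c + sum_list cs) choose c)"
  using assms multinomial_pos[OF assms(1), of cs] by (simp add: div_less_iff_less_mult)

lemma count_list_False: "count_list bs False = length bs - count_list bs True"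
proof -
  have "length bs = count_list bs False + count_list bs True" by (induction bs) auto
  then show ?thesis by simp
qed

lemma words_ConsI:
  assumes "v \<notin> set os" "filter (\<lambda>x. x \<noteq> v) w \<in> words os c" "count_list w v = c v"
  shows "w \<in> words (v # os) c"
proof -
  have "count_list (filter (\<lambda>x. x \<noteq> v) w) u = count_list w u" if "u \<noteq> v" for u
    using that by (induction w) auto
  then show ?thesis using assms by (auto simp: words_def) metis
qed

text \<open>Each digit is a valid subset rank by \<open>digit_less\<close>, so a letter is placed by
  its digit and the word of the remaining letters is filled in around it. This gives the
  surjectivity of the rank.\<close>

lemma word_of_digits_correct:
  assumes "distinct os" "0 < base" "m < multinomial base (map c os)"
  defines "w \<equiv> word_of_digits os (map c os) (digits base (map c os) m)"
  defines "r \<equiv> remainder base (map c os) m"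
  shows "w \<in> words os c" "r < base" "m = word_rank base (map c os) (word_positions os w) + r"
proof -
  have "word_of_digits os (map c os) (digits base (map c os) m) \<in> words os c \<and>
      remainder base (map c os) m < base \<and>
      m = word_rank base (map c os) (word_positions os (word_of_digits os (map c os) (digits base (map c os) m)))
        + remainder base (map c os) m"
    using assms(1,3)
  proof (induction os arbitrary: m)
    case Nil
    then show ?case by (simp add: words_def)
  next
    case (Cons v os)
    let ?B = "multinomial base (map c os)" let ?N = "c v + sum_list (map c os)"
    let ?m = "m mod ?B" let ?q = "m div ?B" let ?bs = "subset_unrank ?N (c v) ?q"
    let ?ws = "word_of_digits os (map c os) (digits base (map c os) ?m)"
    let ?w = "merge v ?bs ?ws"
    have "?m < ?B" using multinomial_pos[OF assms(2)] by simp
    with Cons have IH: "?ws \<in> words os c" "remainder base (map c os) ?m < base"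
      "?m = word_rank base (map c os) (word_positions os ?ws) + remainder base (map c os) ?m" by auto
    have "?q < (?N choose c v)" using digit_less[OF assms(2)] Cons.prems(2) by simp
    note bs = conjunct1[OF subset_unrank_correct[OF this]] conjunct2[OF subset_unrank_correct[OF this]]
    have d: "distinct os" "v \<notin> set os" using Cons.prems by auto
    have len: "length ?ws = count_list ?bs False"
      using words_length[OF IH(1) d(1)] bs by (simp add: count_list_False)
    have nv: "v \<notin> set ?ws" using IH(1) d by (auto simp: words_def)
    note mg = merge_correct[OF len nv]
    have "count_list ?w v = c v" by (simp only: count_list_map_eq[of ?w v] mg(1) bs(1))
    then have w: "?w \<in> words (v # os) c"
      using d(2) IH(1) by (intro words_ConsI) (simp_all only: mg(2) not_False_eq_True)
    have "subset_rank v ?w = ?q" by (simp only: subset_rank_map[of v ?w] mg(1) bs(2))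
    then have "word_rank base (map c (v # os)) (word_positions (v # os) ?w) = ?q * ?B + word_rank base (map c os) (word_positions os ?ws)"
      by (simp only: word_rank_Cons[OF w Cons.prems(1), of base] mg(2))
    then have "word_rank base (map c (v # os)) (word_positions (v # os) ?w) + remainder base (map c os) ?m = m"
      using IH(3) div_mult_mod_eq[of m ?B] by linarith
    then show ?case using w IH(2) by (simp only: list.map digits.simps remainder.simps word_of_digits.simps)
  qed
  then show "w \<in> words os c" "r < base" "m = word_rank base (map c os) (word_positions os w) + r"
    unfolding w_def r_def by blast+
qed

lemma choose_le_power: "(n choose k) \<le> n ^ k"
proof (cases "k \<le> n")
  case True
  then show ?thesis by (rule binomial_le_pow)
qed (simp add: binomial_eq_0)

text \<open>The crude bound \<open>n ^ c\<close> for each binomial is enough: the exponents add up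
  to the length of the word, so ranks have O(n log n) bits.\<close>

lemma multinomial_le:
  assumes "sum_list cs \<le> n"
  shows "multinomial base cs \<le> n ^ sum_list cs * base"
  using assms
proof (induction cs)
  case (Cons c cs)
  have "((c + sum_list cs) choose c) \<le> n ^ c"
    using Cons.prems by (intro order.trans[OF choose_le_power] power_mono) auto
  then have "((c + sum_list cs) choose c) * multinomial base cs \<le> n ^ c * (n ^ sum_list cs * base)"
    using Cons by (intro mult_le_mono) auto
  then show ?case by (simp add: power_add mult.assoc)
qed simp

section \<open>Programs\<close>

abbreviation (input) seq :: "com \<Rightarrow> com \<Rightarrow> com" (infixr ";;" 60) where
  "c ;; d \<equiv> Seq c d"

definition leaf_search :: com where
  "leaf_search = For ''v'' (Const 2) (Reg ''n'')
     (Cond Equal (Elem ''d'' (Reg ''v'')) (Const 1) (Assign ''x'' (Reg ''v'')) Skip)"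

definition prune_alg :: com where
  "prune_alg = Store ''d'' (Reg ''x'') (Const 0) ;;
     Store ''d'' (Elem ''w'' (Reg ''k''))
       (Look ''pred'' (Elem ''d'' (Elem ''w'' (Reg ''k''))) (Const 0))"

definition copy_alg :: "string \<Rightarrow> string \<Rightarrow> string \<Rightarrow> com" where
  "copy_alg a b m = For ''v'' (Const 1) (Reg m) (Store a (Reg ''v'') (Elem b (Reg ''v'')))"

definition sizes_alg :: com where
  "sizes_alg = Assign ''n1'' (Look ''pred'' (Reg ''n'') (Const 0)) ;;
     Assign ''n2'' (Look ''pred'' (Reg ''n1'') (Const 0))"

text \<open>Only n - 2 rounds: the final letter is always 1 and is not stored.\<close>

definition encode_alg :: com where
  "encode_alg = copy_alg ''d'' ''s'' ''n'' ;;
     For ''k'' (Const 1) (Reg ''n2'')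
       (leaf_search ;; Store ''w'' (Reg ''k'') (Elem ''tree'' (Reg ''x'')) ;; prune_alg)"

text \<open>The final letter 1 is put in place first, so that all n - 1 rounds are alike.\<close>

definition decode_alg :: com where
  "decode_alg = Store ''w'' (Reg ''n1'') (Const 1) ;; copy_alg ''d'' ''s'' ''n'' ;;
     For ''k'' (Const 1) (Reg ''n1'')
       (leaf_search ;; Store ''tree'' (Reg ''x'') (Elem ''w'' (Reg ''k'')) ;; prune_alg)"

text \<open>The array is a stack whose height is kept in the register \<open>i\<close>; raising the
  height by look-up records no arithmetic.\<close>

definition push_alg :: "string \<Rightarrow> string \<Rightarrow> exp \<Rightarrow> com" where
  "push_alg a i e = Assign i (Look ''succ'' (Reg i) (Const 0)) ;; Store a (Reg i) e"

text \<open>Sorting by degree with one full scan for each value: quadratically many small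
  comparisons, and ties stay in the order of the vertices.\<close>

definition order_alg :: com where
  "order_alg = Assign ''i'' (Const 0) ;;
     For ''e'' (Const 1) (Reg ''n1'')
       (For ''v'' (Const 1) (Reg ''n'')
         (Cond Equal (Elem ''s'' (Reg ''v'')) (Reg ''e'')
           (push_alg ''o'' ''i'' (Reg ''v''))
           Skip))"

text \<open>The tables shared by the programs. \<open>succ\<close> is only required below
  \<open>n\<close>: an entry must be a product of binomial coefficients with upper index at most
  \<open>n\<close>, and n + 1 need not be one.\<close>

locale machine =
  fixes tb :: tables and n :: nat
  assumes n2: "2 \<le> n"
    and succ: "i < n \<Longrightarrow> tb ''succ'' i 0 = Suc i"
    and pred: "i \<le> n \<Longrightarrow> tb ''pred'' i 0 = i - 1"
    and sub: "i \<le> n \<Longrightarrow> j \<le> n \<Longrightarrow> tb ''sub'' i j = i - j"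
    and binom: "i \<le> n \<Longrightarrow> j \<le> n \<Longrightarrow> tb ''binom'' i j = (i choose j)"
begin

lemma wp_leaf_search:
  assumes "reg \<sigma> ''n'' = n" "\<forall>v\<in>{2..n}. arr \<sigma> ''d'' v \<le> n" "\<exists>v\<in>{2..n}. arr \<sigma> ''d'' v = 1"
  shows "wp tb n (small n) \<mu> leaf_search \<sigma> (\<lambda>\<sigma>' _. reg \<sigma>' ''x'' = leaf n (arr \<sigma> ''d''))"
  unfolding leaf_search_def
proof (rule wp_For[where I = "\<lambda>i \<tau> _. (\<exists>v\<in>{2..<i}. arr \<sigma> ''d'' v = 1) \<longrightarrow>
    reg \<tau> ''x'' = Max {v\<in>{2..<i}. arr \<sigma> ''d'' v = 1}"])
  fix i \<tau> and b :: nat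
  assume i: "2 \<le> i" "i \<le> n" and ag: "agree (For ''v'' (Const 2) (Reg ''n'')
     (Cond Equal (Elem ''d'' (Reg ''v'')) (Const 1) (Assign ''x'' (Reg ''v'')) Skip)) \<sigma> \<tau>"
   and I: "(\<exists>v\<in>{2..<i}. arr \<sigma> ''d'' v = 1) \<longrightarrow>
    reg \<tau> ''x'' = Max {v\<in>{2..<i}. arr \<sigma> ''d'' v = 1}"
  have d: "arr \<tau> ''d'' = arr \<sigma> ''d''" using ag by (simp add: agree_def)
  have S: "{v\<in>{2..<Suc i}. arr \<sigma> ''d'' v = 1} =
      (if arr \<sigma> ''d'' i = 1 then insert i {v\<in>{2..<i}. arr \<sigma> ''d'' v = 1}
       else {v\<in>{2..<i}. arr \<sigma> ''d'' v = 1})"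
    using i by (auto simp: less_Suc_eq)
  \<comment> \<open>The scan ascends, so a leaf just found exceeds all earlier ones.\<close>
  have M: "Max (insert i {v\<in>{2..<i}. arr \<sigma> ''d'' v = 1}) = i"
    by (intro Max_eqI) auto
  show "wp tb n (small n) \<mu> (Cond Equal (Elem ''d'' (Reg ''v'')) (Const 1) (Assign ''x'' (Reg ''v'')) Skip)
    (\<tau>\<lparr>reg := (reg \<tau>)(''v'' := i)\<rparr>)
    (\<lambda>\<tau>' b'. (\<exists>v\<in>{2..<Suc i}. arr \<sigma> ''d'' v = 1) \<longrightarrow>
      reg \<tau>' ''x'' = Max {v\<in>{2..<Suc i}. arr \<sigma> ''d'' v = 1})"
    unfolding S using i I assms(2) n2 M
    by (intro wp_Cond wp_Assign wp_Skip) (auto simp: d less_Suc_eq)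
next
  fix \<tau> and b :: nat
  assume "(\<exists>v\<in>{2..<Suc n}. arr \<sigma> ''d'' v = 1) \<longrightarrow>
    reg \<tau> ''x'' = Max {v\<in>{2..<Suc n}. arr \<sigma> ''d'' v = 1}"
  moreover have "{2..<Suc n} = {2..n}" by auto
  ultimately show "reg \<tau> ''x'' = leaf n (arr \<sigma> ''d'')"
    using assms(3) by (simp add: leaf_def)
qed (use assms n2 in auto)

lemma wp_prune_alg:
  assumes "reg \<sigma> ''x'' = x" "arr \<sigma> ''w'' (reg \<sigma> ''k'') = p" "reg \<sigma> ''k'' \<le> n"
    "x \<le> n" "p \<le> n" "p \<noteq> x" "arr \<sigma> ''d'' p \<le> n"
  shows "wp tb n (small n) \<mu> prune_alg \<sigma> (\<lambda>\<sigma>' _. arr \<sigma>' ''d'' = prune x p (arr \<sigma> ''d''))"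
  unfolding prune_alg_def
  by (intro wp_Seq wp_Store) (use assms pred in \<open>auto simp: prune_def Let_def\<close>)

lemma wp_copy_alg:
  assumes "reg \<sigma> m \<le> n" "m \<noteq> ''v''" "\<forall>v\<in>{1..reg \<sigma> m}. arr \<sigma> b v \<le> n" "a \<noteq> b"
  shows "wp tb n (small n) \<mu> (copy_alg a b m) \<sigma>
    (\<lambda>\<sigma>' _. \<forall>v. arr \<sigma>' a v = (if v \<in> {1..reg \<sigma> m} then arr \<sigma> b v else arr \<sigma> a v))"
  unfolding copy_alg_def
proof (rule wp_For[where I = "\<lambda>i \<tau> _. \<forall>v. arr \<tau> a v = (if v \<in> {1..<i} then arr \<sigma> b v else arr \<sigma> a v)"])
  fix i \<tau> and bb :: nat
  assume "1 \<le> i" "i \<le> reg \<sigma> m"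
    "agree (For ''v'' (Const 1) (Reg m) (Store a (Reg ''v'') (Elem b (Reg ''v'')))) \<sigma> \<tau>"
    "\<forall>v. arr \<tau> a v = (if v \<in> {1..<i} then arr \<sigma> b v else arr \<sigma> a v)"
  then show "wp tb n (small n) \<mu> (Store a (Reg ''v'') (Elem b (Reg ''v'')))
     (\<tau>\<lparr>reg := (reg \<tau>)(''v'' := i)\<rparr>)
      (\<lambda>\<tau>' b'. \<forall>v. arr \<tau>' a v = (if v \<in> {1..<Suc i} then arr \<sigma> b v else arr \<sigma> a v))"
    using assms by (intro wp_Store) (auto simp: agree_def less_Suc_eq)
qed (use assms n2 in \<open>auto simp: less_Suc_eq_le\<close>)

lemma wp_sizes_alg:
  assumes "reg \<sigma> ''n'' = n"
  shows "wp tb n (small n) \<mu> sizes_alg \<sigma> (\<lambda>\<sigma>' _. reg \<sigma>' ''n1'' = n - 1 \<and> reg \<sigma>' ''n2'' = n - 2)"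
  unfolding sizes_alg_def
  by (intro wp_Seq wp_Assign) (use assms pred n2 in auto)

text \<open>Keeps the entries of \<open>d\<close> at most \<open>n\<close>, so that reading and
  comparing them yields small events.\<close>

lemma word_degrees_le:
  assumes "word_degrees n d w" "v \<in> {1..n}" shows "d v \<le> n"
proof -
  have c: "count_list w u \<le> card (rest n d)" for u
    using assms(1) by (metis word_degrees_def count_le_length)
  have "card (rest n d) \<le> card {2..n}" unfolding rest_def by (intro card_mono) auto
  then have "card (rest n d) \<le> n - 1" by simp
  then have le: "count_list w u \<le> n - 1" for u using c[of u] by linarith
  show ?thesis
  proof (cases "v \<in> rest n d")
    case True
    then have "d v = Suc (count_list w v)" using assms(1) by (simp add: word_degrees_def)
    then show ?thesis using le[of v] n2 by simp
  next
    case False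
    then consider "v = 1" | "d v = 0" using assms(2) by (force simp: rest_def)
    then show ?thesis
    proof cases
      case 1
      then show ?thesis using assms(1) le[of 1] by (simp add: word_degrees_def)
    qed simp
  qed
qed

lemma tree_degrees_le:
  assumes "tree_degrees n d f" "v \<in> {1..n}" shows "d v \<le> n"
  using word_degrees_le[OF prufer_code_correct(1)[OF assms(1) refl] assms(2)] .

lemma wp_encode_step:
  assumes r: "reg \<sigma> ''n'' = n" "reg \<sigma> ''k'' \<le> n"
    and t: "tree_degrees n (arr \<sigma> ''d'') (arr \<sigma> ''tree'')" "rest n (arr \<sigma> ''d'') \<noteq> {}"
  defines "x \<equiv> leaf n (arr \<sigma> ''d'')"
  shows "wp tb n (small n) \<mu>
    (leaf_search ;; Store ''w'' (Reg ''k'') (Elem ''tree'' (Reg ''x'')) ;; prune_alg) \<sigma>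
    (\<lambda>\<sigma>' _. arr \<sigma>' ''d'' = prune x (arr \<sigma> ''tree'' x) (arr \<sigma> ''d'') \<and>
      arr \<sigma>' ''w'' = (arr \<sigma> ''w'')(reg \<sigma> ''k'' := arr \<sigma> ''tree'' x))"
proof -
  note x = tree_degrees_leaf[OF t, folded x_def]
  note p = tree_degrees_prune[OF t(1) x]
  have xn: "x \<in> {2..n}" using x by (auto simp: rest_def)
  have pn: "arr \<sigma> ''tree'' x \<in> {1..n}" using p(1) n2 by (auto simp: rest_def)
  show ?thesis
  proof (rule wp_Seq, rule wp_conseq[OF wp_leaf_search])
    fix \<sigma>1 and b1 :: nat
    assume a: "agree leaf_search \<sigma> \<sigma>1" and x1: "reg \<sigma>1 ''x'' = leaf n (arr \<sigma> ''d'')"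
    show "wp tb n (small n) \<mu> (Store ''w'' (Reg ''k'') (Elem ''tree'' (Reg ''x'')) ;; prune_alg) \<sigma>1
       (\<lambda>\<sigma>2 b2. arr \<sigma>2 ''d'' = prune x (arr \<sigma> ''tree'' x) (arr \<sigma> ''d'') \<and>
         arr \<sigma>2 ''w'' = (arr \<sigma> ''w'')(reg \<sigma> ''k'' := arr \<sigma> ''tree'' x))"
    proof (rule wp_Seq, rule wp_Store)
      fix b :: nat
      show "wp tb n (small n) \<mu> prune_alg
        (\<sigma>1\<lparr>arr := (arr \<sigma>1)(''w'' := (arr \<sigma>1 ''w'')(eval_exp tb \<sigma>1 (Reg ''k'') := eval_exp tb \<sigma>1 (Elem ''tree'' (Reg ''x''))))\<rparr>)
        (\<lambda>\<sigma>2 b2. arr \<sigma>2 ''d'' = prune x (arr \<sigma> ''tree'' x) (arr \<sigma> ''d'') \<and>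
         arr \<sigma>2 ''w'' = (arr \<sigma> ''w'')(reg \<sigma> ''k'' := arr \<sigma> ''tree'' x))"
        using a x1 r xn pn p(2) tree_degrees_le[OF t(1) pn]
        by (intro wp_conseq[OF wp_prune_alg[where x = x and p = "arr \<sigma> ''tree'' x"]])
          (auto simp: agree_def leaf_search_def prune_alg_def x_def)
    qed (use a x1 r xn pn in \<open>auto simp: agree_def leaf_search_def x_def\<close>)
  qed (use r x xn tree_degrees_le[OF t(1)] in auto)
qed

lemma wp_decode_step:
  assumes r: "reg \<sigma> ''n'' = n" "reg \<sigma> ''k'' \<le> n"
    and w: "word_degrees n (arr \<sigma> ''d'') (p # w)" "arr \<sigma> ''w'' (reg \<sigma> ''k'') = p"
  defines "x \<equiv> leaf n (arr \<sigma> ''d'')"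
  shows "wp tb n (small n) \<mu>
    (leaf_search ;; Store ''tree'' (Reg ''x'') (Elem ''w'' (Reg ''k'')) ;; prune_alg) \<sigma>
    (\<lambda>\<sigma>' _. arr \<sigma>' ''d'' = prune x p (arr \<sigma> ''d'') \<and>
      arr \<sigma>' ''tree'' = (arr \<sigma> ''tree'')(x := p))"
proof -
  note x = word_degrees_prune[OF w(1), folded x_def]
  have xn: "x \<in> {2..n}" using x by (auto simp: rest_def)
  have pn: "p \<in> {1..n}" using x(3) n2 by (auto simp: rest_def)
  show ?thesis
  proof (rule wp_Seq, rule wp_conseq[OF wp_leaf_search])
    fix \<sigma>1 and b1 :: nat
    assume a: "agree leaf_search \<sigma> \<sigma>1" and x1: "reg \<sigma>1 ''x'' = leaf n (arr \<sigma> ''d'')"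
    show "wp tb n (small n) \<mu> (Store ''tree'' (Reg ''x'') (Elem ''w'' (Reg ''k'')) ;; prune_alg) \<sigma>1
       (\<lambda>\<sigma>2 b2. arr \<sigma>2 ''d'' = prune x p (arr \<sigma> ''d'') \<and>
         arr \<sigma>2 ''tree'' = (arr \<sigma> ''tree'')(x := p))"
    proof (rule wp_Seq, rule wp_Store)
      fix b :: nat
      show "wp tb n (small n) \<mu> prune_alg
        (\<sigma>1\<lparr>arr := (arr \<sigma>1)(''tree'' := (arr \<sigma>1 ''tree'')(eval_exp tb \<sigma>1 (Reg ''x'') := eval_exp tb \<sigma>1 (Elem ''w'' (Reg ''k''))))\<rparr>)
        (\<lambda>\<sigma>2 b2. arr \<sigma>2 ''d'' = prune x p (arr \<sigma> ''d'') \<and>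
          arr \<sigma>2 ''tree'' = (arr \<sigma> ''tree'')(x := p))"
        using a x1 r xn pn x(4) w(2) word_degrees_le[OF w(1) pn]
        by (intro wp_conseq[OF wp_prune_alg[where x = x and p = p]])
          (auto simp: agree_def leaf_search_def prune_alg_def x_def)
    qed (use a x1 r xn pn w(2) in \<open>auto simp: agree_def leaf_search_def x_def\<close>)
  qed (use r x xn word_degrees_le[OF w(1)] in auto)
qed

lemma wp_encode_alg:
  assumes r: "reg \<sigma> ''n'' = n" "reg \<sigma> ''n2'' = n - 2"
    and t: "tree_degrees n (arr \<sigma> ''s'') (arr \<sigma> ''tree'')" "rest n (arr \<sigma> ''s'') = {2..n}"
    and z: "\<forall>v. v \<notin> {1..n} \<longrightarrow> arr \<sigma> ''s'' v = 0 \<and> arr \<sigma> ''d'' v = 0"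
  shows "wp tb n (small n) \<mu> encode_alg \<sigma>
    (\<lambda>\<sigma>' _. map (arr \<sigma>' ''w'') [1..<n - 1] = prufer_code n (n - 2) (arr \<sigma> ''s'') (arr \<sigma> ''tree''))"
  unfolding encode_alg_def
proof (rule wp_Seq, rule wp_conseq[OF wp_copy_alg])
  fix \<sigma>1 and b1 :: nat
  let ?s = "arr \<sigma> ''s''" let ?f = "arr \<sigma> ''tree''"
  let ?body = "leaf_search ;; Store ''w'' (Reg ''k'') (Elem ''tree'' (Reg ''x'')) ;; prune_alg"
  assume a: "agree (copy_alg ''d'' ''s'' ''n'') \<sigma> \<sigma>1"
    and d: "\<forall>v. arr \<sigma>1 ''d'' v = (if v \<in> {1..reg \<sigma> ''n''} then arr \<sigma> ''s'' v else arr \<sigma> ''d'' v)"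
  \<comment> \<open>Outside 1..n both arrays are 0, so copying makes them equal as
    functions.\<close>
  have d: "arr \<sigma>1 ''d'' = ?s" using d z r by auto
  have 1: "arr \<sigma>1 ''tree'' = ?f" "reg \<sigma>1 ''n'' = n" "reg \<sigma>1 ''n2'' = n - 2"
    using a r by (auto simp: agree_def copy_alg_def)
  show "wp tb n (small n) \<mu> (For ''k'' (Const 1) (Reg ''n2'') ?body) \<sigma>1
    (\<lambda>\<sigma>' _. map (arr \<sigma>' ''w'') [1..<n - 1] = prufer_code n (n - 2) ?s ?f)"
  \<comment> \<open>The letters written so far, followed by the code of the remaining tree, form the
    whole code; before round \<open>k\<close> there are \<open>n - k\<close> vertices left besides
    the root.\<close>
  proof (rule wp_For[where I = "\<lambda>k \<tau> _. tree_degrees n (arr \<tau> ''d'') ?f \<and> card (rest n (arr \<tau> ''d'')) = n - k \<and>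
      prufer_code n (n - 2) ?s ?f = map (arr \<tau> ''w'') [1..<k] @ prufer_code n (n - 1 - k) (arr \<tau> ''d'') ?f"])
    fix k \<tau> and b :: nat
    assume k: "1 \<le> k" "k \<le> n - 2" and ag: "agree (For ''k'' (Const 1) (Reg ''n2'') ?body) \<sigma>1 \<tau>"
      and I: "tree_degrees n (arr \<tau> ''d'') ?f \<and> card (rest n (arr \<tau> ''d'')) = n - k \<and>
        prufer_code n (n - 2) ?s ?f = map (arr \<tau> ''w'') [1..<k] @ prufer_code n (n - 1 - k) (arr \<tau> ''d'') ?f"
    have ag: "reg \<tau> ''n'' = n" "arr \<tau> ''tree'' = ?f"
      using ag 1 by (auto simp: agree_def leaf_search_def prune_alg_def)
    have ne: "rest n (arr \<tau> ''d'') \<noteq> {}" using I k by auto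
    let ?x = "leaf n (arr \<tau> ''d'')"
    note x = tree_degrees_leaf[OF conjunct1[OF I] ne]
    note p = tree_degrees_prune[OF conjunct1[OF I] x]
    have e: "n - 1 - k = Suc (n - 1 - Suc k)" using k by simp
    have m: "map ((arr \<tau> ''w'')(k := ?f ?x)) [1..<Suc k] = map (arr \<tau> ''w'') [1..<k] @ [?f ?x]"
      using k by simp
    show "wp tb n (small n) \<mu> ?body (\<tau>\<lparr>reg := (reg \<tau>)(''k'' := k)\<rparr>)
      (\<lambda>\<tau>' b'. tree_degrees n (arr \<tau>' ''d'') ?f \<and> card (rest n (arr \<tau>' ''d'')) = n - Suc k \<and>
        prufer_code n (n - 2) ?s ?f = map (arr \<tau>' ''w'') [1..<Suc k] @ prufer_code n (n - 1 - Suc k) (arr \<tau>' ''d'') ?f)"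
    proof (rule wp_conseq[OF wp_encode_step], goal_cases)
      case (5 \<sigma>' b)
      then have s: "arr \<sigma>' ''d'' = prune ?x (?f ?x) (arr \<tau> ''d'')" "arr \<sigma>' ''w'' = (arr \<tau> ''w'')(k := ?f ?x)"
        using ag by auto
      show ?case
        unfolding s m using p I x unfolding e by (simp del: upt_Suc)
    qed (use ag I ne k in auto)
  next
    fix \<tau> and b :: nat
    assume "tree_degrees n (arr \<tau> ''d'') ?f \<and> card (rest n (arr \<tau> ''d'')) = n - Suc (n - 2) \<and>
      prufer_code n (n - 2) ?s ?f = map (arr \<tau> ''w'') [1..<Suc (n - 2)] @ prufer_code n (n - 1 - Suc (n - 2)) (arr \<tau> ''d'') ?f"
    moreover have "n - 1 - Suc (n - 2) = 0" "Suc (n - 2) = n - 1" using n2 by simp_all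
    ultimately show "map (arr \<tau> ''w'') [1..<n - 1] = prufer_code n (n - 2) ?s ?f"
      by (metis append_Nil2 prufer_code.simps(1))
  next
    show "tree_degrees n (arr \<sigma>1 ''d'') ?f \<and> card (rest n (arr \<sigma>1 ''d'')) = n - 1 \<and>
      prufer_code n (n - 2) ?s ?f = map (arr \<sigma>1 ''w'') [1..<1] @ prufer_code n (n - 1 - 1) (arr \<sigma>1 ''d'') ?f"
      using d t by (simp add: numeral_2_eq_2)
  qed (use 1 n2 in auto)
qed (use r tree_degrees_le[OF t(1)] n2 in auto)

lemma wp_decode_alg:
  assumes r: "reg \<sigma> ''n'' = n" "reg \<sigma> ''n1'' = n - 1"
    and t: "word_degrees n (arr \<sigma> ''s'') (map (arr \<sigma> ''w'') [1..<n - 1] @ [1])"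
    and z: "\<forall>v. v \<notin> {1..n} \<longrightarrow> arr \<sigma> ''s'' v = 0 \<and> arr \<sigma> ''d'' v = 0"
  shows "wp tb n (small n) \<mu> decode_alg \<sigma>
    (\<lambda>\<sigma>' _. arr \<sigma>' ''tree'' =
      prufer_tree n (arr \<sigma> ''s'') (map (arr \<sigma> ''w'') [1..<n - 1] @ [1]) (arr \<sigma> ''tree''))"
  unfolding decode_alg_def
proof (rule wp_Seq, rule wp_Store, goal_cases)
  case (2 b0)
  let ?s = "arr \<sigma> ''s''" let ?g = "arr \<sigma> ''tree''" let ?w = "(arr \<sigma> ''w'')(n - 1 := 1)"
  let ?W = "map ?w [1..<n]"
  let ?body = "leaf_search ;; Store ''tree'' (Reg ''x'') (Elem ''w'' (Reg ''k'')) ;; prune_alg"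
  have "[1..<n] = [1..<n - 1] @ [n - 1]" using n2 upt_Suc_append[of 1 "n - 1"] by auto
  then have W: "map (arr \<sigma> ''w'') [1..<n - 1] @ [1] = ?W" by simp
  let ?\<sigma> = "\<sigma>\<lparr>arr := (arr \<sigma>)(''w'' := (arr \<sigma> ''w'')(eval_exp tb \<sigma> (Reg ''n1'') := eval_exp tb \<sigma> (Const 1)))\<rparr>"
  show ?case
  proof (rule wp_Seq, rule wp_conseq[OF wp_copy_alg], goal_cases)
    case (5 \<sigma>1 b1)
    have d: "arr \<sigma>1 ''d'' = ?s" using 5(2) z r by auto
    have 1: "arr \<sigma>1 ''tree'' = ?g" "arr \<sigma>1 ''w'' = ?w" "reg \<sigma>1 ''n'' = n" "reg \<sigma>1 ''n1'' = n - 1"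
      using 5(1) r by (auto simp: agree_def copy_alg_def)
    show ?case
      unfolding W
    \<comment> \<open>Decoding the unread letters into the current arrays always yields the same
      final tree.\<close>
    proof (rule wp_For[where I = "\<lambda>k \<tau> _. word_degrees n (arr \<tau> ''d'') (drop (k - 1) ?W) \<and>
        prufer_tree n (arr \<tau> ''d'') (drop (k - 1) ?W) (arr \<tau> ''tree'') = prufer_tree n ?s ?W ?g"])
      fix k \<tau> and b :: nat
      assume k: "1 \<le> k" "k \<le> n - 1" and ag: "agree (For ''k'' (Const 1) (Reg ''n1'') ?body) \<sigma>1 \<tau>"
        and I: "word_degrees n (arr \<tau> ''d'') (drop (k - 1) ?W) \<and>
          prufer_tree n (arr \<tau> ''d'') (drop (k - 1) ?W) (arr \<tau> ''tree'') = prufer_tree n ?s ?W ?g"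
      have ag: "reg \<tau> ''n'' = n" "arr \<tau> ''w'' = ?w"
        using ag 1 by (auto simp: agree_def leaf_search_def prune_alg_def)
      have dr: "drop (k - 1) ?W = ?w k # drop k ?W"
        using k Cons_nth_drop_Suc[of "k - 1" ?W] by auto
      let ?x = "leaf n (arr \<tau> ''d'')"
      note x = word_degrees_prune[OF conjunct1[OF I, unfolded dr]]
      show "wp tb n (small n) \<mu> ?body (\<tau>\<lparr>reg := (reg \<tau>)(''k'' := k)\<rparr>)
        (\<lambda>\<tau>' b'. word_degrees n (arr \<tau>' ''d'') (drop (Suc k - 1) ?W) \<and>
          prufer_tree n (arr \<tau>' ''d'') (drop (Suc k - 1) ?W) (arr \<tau>' ''tree'') = prufer_tree n ?s ?W ?g)"
      proof (rule wp_conseq[OF wp_decode_step[where p = "?w k" and w = "drop k ?W"]], goal_cases)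
        case (5 \<sigma>' b)
        then have s: "arr \<sigma>' ''d'' = prune ?x (?w k) (arr \<tau> ''d'')" "arr \<sigma>' ''tree'' = (arr \<tau> ''tree'')(?x := ?w k)"
          by auto
        show ?case unfolding s using x(8) I[unfolded dr] by (simp del: fun_upd_apply)
      qed (use ag I dr k in auto)
    next
      fix \<tau> and b :: nat
      assume "word_degrees n (arr \<tau> ''d'') (drop (Suc (n - 1) - 1) ?W) \<and>
        prufer_tree n (arr \<tau> ''d'') (drop (Suc (n - 1) - 1) ?W) (arr \<tau> ''tree'') = prufer_tree n ?s ?W ?g"
      then show "arr \<tau> ''tree'' = prufer_tree n ?s ?W ?g" by simp
    qed (use 1 n2 d t W in auto)
  qed (use r word_degrees_le[OF t] n2 in auto)
qed (use r n2 in auto)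

end

section \<open>Programs on positions, sums and digits\<close>

definition position_step :: "string \<Rightarrow> com" where
  "position_step a = Assign ''i'' (Const 0) ;;
     For ''j'' (Const 1) (Reg ''N'')
       (Cond Equal (Elem ''w'' (Reg ''j'')) (Elem ''o'' (Reg ''k''))
         (push_alg a ''t'' (Reg ''j''))
         (push_alg ''w'' ''i'' (Elem ''w'' (Reg ''j'')))) ;;
     Assign ''N'' (Reg ''i'')"

definition positions_alg :: "string \<Rightarrow> string \<Rightarrow> com" where
  "positions_alg a m = Assign ''t'' (Const 0) ;; For ''k'' (Const 1) (Reg m) (position_step a)"

definition sum_alg :: "string \<Rightarrow> string \<Rightarrow> string \<Rightarrow> com" where
  "sum_alg W a m = For ''t'' (Const 1) (Reg m)
     (Arith ''rank'' Plus (Reg ''rank'') (Look W (Reg ''t'') (Elem a (Reg ''t''))))"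

text \<open>The machine has no remainder operation; the next \<open>m\<close> is obtained by
  subtracting quotient times place value.\<close>

definition digits_alg :: "string \<Rightarrow> string \<Rightarrow> com" where
  "digits_alg B m = For ''k'' (Const 1) (Reg m)
     (Arith ''y'' Divide (Reg ''m'') (Look B (Reg ''k'') (Const 0)) ;;
      Store ''q'' (Reg ''k'') (Reg ''y'') ;;
      Arith ''y'' Times (Reg ''y'') (Look B (Reg ''k'') (Const 0)) ;;
      Arith ''m'' Minus (Reg ''m'') (Reg ''y''))"

text \<open>\<open>F\<close> lists the free places of the final word in ascending order, and the
  subset unranked from the digit selects among them. Letters thus go straight to their places,
  without the nested merges of \<open>word_of_digits\<close>.\<close>

definition place_step :: "string \<Rightarrow> com" where
  "place_step C = Assign ''y'' (Elem ''q'' (Reg ''k'')) ;;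
     Assign ''l'' (Look C (Reg ''k'') (Const 0)) ;;
     Assign ''i'' (Const 0) ;;
     For ''j'' (Const 1) (Reg ''N'')
       (Assign ''b'' (Look ''binom'' (Look ''sub'' (Reg ''N'') (Reg ''j'')) (Reg ''l'')) ;;
        Cond LessEq (Reg ''b'') (Reg ''y'')
          (Arith ''y'' Minus (Reg ''y'') (Reg ''b'') ;;
           Assign ''l'' (Look ''pred'' (Reg ''l'') (Const 0)) ;;
           Store ''w'' (Elem ''F'' (Reg ''j'')) (Elem ''o'' (Reg ''k'')))
          (push_alg ''F'' ''i'' (Elem ''F'' (Reg ''j'')))) ;;
     Assign ''N'' (Reg ''i'')"

definition identity_alg :: "string \<Rightarrow> string \<Rightarrow> com" where
  "identity_alg a m = For ''v'' (Const 1) (Reg m) (Store a (Reg ''v'') (Reg ''v''))"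

definition place_alg :: "string \<Rightarrow> string \<Rightarrow> com" where
  "place_alg C m = identity_alg ''F'' ''N'' ;; For ''k'' (Const 1) (Reg m) (place_step C)"

text \<open>Every vertex starts with 1 for the edge to its parent, except the root; each child then
  adds 1 to its parent.\<close>

definition degree_alg :: com where
  "degree_alg = For ''v'' (Const 1) (Reg ''n'') (Store ''s'' (Reg ''v'') (Const 1)) ;;
     Store ''s'' (Const 1) (Const 0) ;;
     For ''v'' (Const 2) (Reg ''n'')
       (Store ''s'' (Elem ''tree'' (Reg ''v''))
         (Look ''succ'' (Elem ''s'' (Elem ''tree'' (Reg ''v''))) (Const 0)))"

definition slice :: "(nat \<Rightarrow> 'a) \<Rightarrow> nat \<Rightarrow> 'a list" where
  "slice A k = map A [1..<Suc k]"

lemma length_slice [simp]: "length (slice A k) = k"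
  by (simp add: slice_def)

lemma slice_0 [simp]: "slice A 0 = []"
  by (simp add: slice_def)

lemma nth_slice: "i < k \<Longrightarrow> slice A k ! i = A (Suc i)"
  by (simp add: slice_def del: upt_Suc)

lemma slice_upd_Suc [simp]: "slice (A(Suc k := x)) (Suc k) = slice A k @ [x]"
  by (simp add: slice_def)

lemma slice_upd_ge [simp]: "k < i \<Longrightarrow> slice (A(i := x)) k = slice A k"
  by (auto simp: slice_def)

lemma slice_cong: "(\<And>i. 1 \<le> i \<Longrightarrow> i \<le> k \<Longrightarrow> A i = A' i) \<Longrightarrow> slice A k = slice A' k"
  by (auto simp: slice_def)

text \<open>The bound \<open>m\<close> serves the outer loop of \<open>order_alg\<close>, whose
  invariant speaks of the part of the order already written.\<close>

definition order_upto :: "nat \<Rightarrow> (nat \<Rightarrow> nat) \<Rightarrow> nat \<Rightarrow> nat list" where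
  "order_upto n s m = concat (map (\<lambda>e. filter (\<lambda>v. s v = e) [1..<Suc n]) [1..<m])"

abbreviation vertex_order :: "nat \<Rightarrow> (nat \<Rightarrow> nat) \<Rightarrow> nat list" where
  "vertex_order n s \<equiv> order_upto n s n"

lemma order_upto_1 [simp]: "order_upto n s (Suc 0) = []"
  by (simp add: order_upto_def)

lemma order_upto_Suc:
  "1 \<le> m \<Longrightarrow> order_upto n s (Suc m) = order_upto n s m @ filter (\<lambda>v. s v = m) [1..<Suc n]"
  by (simp add: order_upto_def)

lemma set_order_upto: "set (order_upto n s m) = {v\<in>{1..n}. s v \<in> {1..<m}}"
  by (auto simp: order_upto_def)

lemma distinct_order_upto: "distinct (order_upto n s m)"
proof (induction m)
  case (Suc m)
  then show ?case
    by (cases "1 \<le> m") (auto simp: order_upto_Suc set_order_upto order_upto_def)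
qed (simp add: order_upto_def)

context machine
begin

lemma wp_identity_alg:
  assumes "reg \<sigma> m \<le> n" "m \<noteq> ''v''"
  shows "wp tb n (small n) \<mu> (identity_alg a m) \<sigma>
    (\<lambda>\<sigma>' _. slice (arr \<sigma>' a) (reg \<sigma> m) = [1..<Suc (reg \<sigma> m)])"
  unfolding identity_alg_def
proof (rule wp_For[where lo = 1 and hi = "reg \<sigma> m" and I = "\<lambda>i \<tau> _. slice (arr \<tau> a) (i - 1) = [1..<i]"], goal_cases)
  case (10 i \<tau> b)
  then obtain j where j: "i = Suc j" by (cases i) auto
  have "slice (arr \<tau> a) j = [1..<Suc j]" using 10(4) j by simp
  then show ?case using 10(1,2) assms(1) unfolding j
    by (intro wp_Store) (simp_all del: upt_Suc add: upt_Suc_append)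
qed (use assms n2 in simp_all)

lemma wp_push_alg:
  assumes "reg \<sigma> i = length L" "slice (arr \<sigma> a) (length L) = L" "length L < n"
    "eval_exp tb (\<sigma>\<lparr>reg := (reg \<sigma>)(i := Suc (length L))\<rparr>) e = x"
    "\<forall>ev\<in>set (fetch tb (\<sigma>\<lparr>reg := (reg \<sigma>)(i := Suc (length L))\<rparr>) e). small n ev" "x \<le> n"
  shows "wp tb n (small n) \<mu> (push_alg a i e) \<sigma>
    (\<lambda>\<sigma>' _. arr \<sigma>' a = (arr \<sigma> a)(Suc (length L) := x) \<and> reg \<sigma>' i = length (L @ [x]) \<and> slice (arr \<sigma>' a) (length (L @ [x])) = L @ [x])"
proof -
  define k where "k = length L"
  define \<sigma>1 where "\<sigma>1 = \<sigma>\<lparr>reg := (reg \<sigma>)(i := Suc k)\<rparr>"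
  have k: "reg \<sigma> i = k" "slice (arr \<sigma> a) k = L" "k < n" "eval_exp tb \<sigma>1 e = x"
    "\<forall>ev\<in>set (fetch tb \<sigma>1 e). small n ev" "tb ''succ'' k 0 = Suc k"
    using assms succ[of k] by (simp_all add: k_def \<sigma>1_def)
  have s: "eval_exp tb \<sigma> (Look ''succ'' (Reg i) (Const 0)) = Suc k" using k by simp
  have 1: "reg \<sigma>1 i = Suc k" "arr \<sigma>1 = arr \<sigma>" by (simp_all add: \<sigma>1_def)
  have l: "length (L @ [x]) = Suc k" by (simp add: k_def)
  show ?thesis
    unfolding push_alg_def l
  proof (rule wp_Seq, rule wp_Assign, goal_cases)
    case (2 b)
    show ?case
      unfolding s \<sigma>1_def[symmetric]
      by (rule wp_Store) (use k 1 assms(6) in \<open>simp_all add: k_def[symmetric]\<close>)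
  qed (use k in simp_all)
qed

lemma wp_order_alg:
  assumes r: "reg \<sigma> ''n'' = n" "reg \<sigma> ''n1'' = n - 1"
    and s: "\<forall>v\<in>{1..n}. arr \<sigma> ''s'' v \<le> n"
  shows "wp tb n (small n) \<mu> order_alg \<sigma>
    (\<lambda>\<sigma>' _. slice (arr \<sigma>' ''o'') (length (vertex_order n (arr \<sigma> ''s''))) = vertex_order n (arr \<sigma> ''s''))"
  unfolding order_alg_def
proof (rule wp_Seq, rule wp_Assign, goal_cases)
  case (2 b0)
  let ?s = "arr \<sigma> ''s''"
  \<comment> \<open>\<open>D e v\<close> is what has been pushed when the inner loop reaches
    \<open>v\<close> in the pass for degree \<open>e\<close>.\<close>
  define D where "D e v = order_upto n ?s e @ filter (\<lambda>u. ?s u = e) [1..<v]" for e v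
  let ?J = "\<lambda>e v \<tau>. reg \<tau> ''i'' = length (D e v) \<and> slice (arr \<tau> ''o'') (length (D e v)) = D e v"
  \<comment> \<open>Looking up the successor needs a stack of fewer than \<open>n\<close> entries;
    this holds since the entries and \<open>v\<close> are distinct vertices.\<close>
  have len: "length (D e v) < n" if "1 \<le> v" "v \<le> n" "?s v = e" for e v
  proof -
    have S: "set (D e v @ [v]) = {u\<in>{1..n}. ?s u \<in> {1..<e}} \<union> {u. ?s u = e \<and> u \<in> {1..<v}} \<union> {v}"
      by (auto simp only: D_def set_append set_order_upto set_filter set_upt list.set)
    have "distinct (D e v)"
      unfolding D_def distinct_append set_order_upto using distinct_order_upto by auto
    moreover have "v \<notin> set (D e v)"
      unfolding D_def set_append set_order_upto using that(3) by simp
    ultimately have "distinct (D e v @ [v])" by simp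
    moreover have "set (D e v @ [v]) \<subseteq> {1..n}" unfolding S using that(1,2) by auto
    ultimately have "card (set (D e v @ [v])) = length (D e v @ [v])" "set (D e v @ [v]) \<subseteq> {1..n}"
      by (simp_all only: distinct_card)
    then have "length (D e v @ [v]) \<le> card {1..n}"
      using card_mono[of "{1..n}" "set (D e v @ [v])"] by simp
    then show ?thesis by simp
  qed
  have D0: "D 1 1 = []" by (simp add: D_def)
  have DS: "D e (Suc v) = D e v @ (if ?s v = e then [v] else [])" if "1 \<le> v" for e v
    using that by (simp add: D_def)
  have DE: "D (Suc e) 1 = D e (Suc n)" if "1 \<le> e" for e
    using order_upto_Suc[OF that] by (simp add: D_def del: upt_Suc)
  have DL: "D n 1 = vertex_order n ?s" by (simp add: D_def)
  show ?case
  proof (rule wp_For[where lo = 1 and hi = "n - 1" and I = "\<lambda>e \<tau> _. ?J e 1 \<tau>"], goal_cases)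
    case (10 e \<tau> b)
    note h10 = 10
    have \<tau>: "reg \<tau> ''n'' = n" "arr \<tau> ''s'' = ?s"
      using 10(3) r by (auto simp: agree_def push_alg_def)
    have e: "e \<le> n" using 10 by simp
    show ?case
    proof (rule wp_For[where lo = 1 and hi = n and I = "\<lambda>v \<tau> _. ?J e v \<tau>"], goal_cases)
      case (10 v \<tau>' b')
      have \<tau>': "reg \<tau>' ''e'' = e" "arr \<tau>' ''s'' = ?s"
        using 10(3) \<tau> by (auto simp: agree_def push_alg_def)
      show ?case
      proof (rule wp_Cond, goal_cases)
        case (3 b0)
        then have sv: "?s v = e" using \<tau>' by simp
        show ?case
          using 10 len[OF 10(1,2) sv] sv
          by (intro wp_conseq[OF wp_push_alg[of _ _ "D e v" _ _ v]]) (auto simp: DS)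
      next
        case (4 b0)
        then have sv: "?s v \<noteq> e" using \<tau>' by simp
        show ?case
          using 10 sv by (intro wp_Skip) (auto simp: DS)
      qed (use 10(1,2) e \<tau>' s n2 in auto)
    next
      case (11 \<tau>' b')
      then show ?case using DE[OF h10(1)] by simp
    qed (use h10 \<tau> n2 in auto)
  next
    case (11 \<tau> b)
    then show ?case using n2 DL by simp
  qed (use r n2 D0 in auto)
qed (use n2 in auto)

lemma wp_position_step:
  assumes r: "reg \<sigma> ''N'' = length ws" "arr \<sigma> ''o'' (reg \<sigma> ''k'') = v" "reg \<sigma> ''k'' \<le> n" "v \<le> n"
    and ws: "slice (arr \<sigma> ''w'') (length ws) = ws" "length ws \<le> n" "set ws \<subseteq> {..n}"
    and ps: "reg \<sigma> ''t'' = length ps" "slice (arr \<sigma> a) (length ps) = ps" "length ps + count_list ws v \<le> n"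
    and a: "a \<noteq> ''w''" "a \<noteq> ''o''"
  defines "vs \<equiv> filter (\<lambda>x. x \<noteq> v) ws"
  shows "wp tb n (small n) \<mu> (position_step a) \<sigma> (\<lambda>\<sigma>' _.
    reg \<sigma>' ''N'' = length vs \<and> slice (arr \<sigma>' ''w'') (length vs) = vs \<and>
    reg \<sigma>' ''t'' = length (ps @ occurrences v ws) \<and>
    slice (arr \<sigma>' a) (length (ps @ occurrences v ws)) = ps @ occurrences v ws)"
  unfolding position_step_def
proof (rule wp_Seq, rule wp_Assign, goal_cases)
  case (2 b0)
  \<comment> \<open>After \<open>j\<close> letters, \<open>W j\<close> are those kept and
    \<open>Q j\<close> are all positions emitted.\<close>
  define W where "W j = filter (\<lambda>x. x \<noteq> v) (take j ws)" for j
  define Q where "Q j = ps @ occurrences v (take j ws)" for j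
  let ?I = "\<lambda>j \<tau>. reg \<tau> ''i'' = length (W j) \<and> slice (arr \<tau> ''w'') (length (W j)) = W j \<and>
    (\<forall>m\<in>{Suc j..length ws}. arr \<tau> ''w'' m = ws ! (m - 1)) \<and>
    reg \<tau> ''t'' = length (Q j) \<and> slice (arr \<tau> a) (length (Q j)) = Q j"
  have W0: "W 0 = []" "Q 0 = ps" by (simp_all add: W_def Q_def)
  have WS: "W (Suc j) = (if ws ! j = v then W j else W j @ [ws ! j])"
    "Q (Suc j) = (if ws ! j = v then Q j @ [Suc j] else Q j)" if "j < length ws" for j
    using that by (simp_all add: W_def Q_def take_Suc_conv_app_nth occurrences_snoc)
  \<comment> \<open>Compacting in place is safe: the write index never passes the read index, so the
    unread letters are intact.\<close>
  have WL: "length (W j) \<le> j" for j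
    by (simp add: W_def order.trans[OF length_filter_le])
  have cnt: "count_list (take j ws) v \<le> count_list ws v" for j
    by (metis append_take_drop_id count_list_append le_add1)
  have QL: "length (Q j) < n" if "j < length ws" "ws ! j = v" for j
  proof -
    have "length (Q (Suc j)) = Suc (length (Q j))" using WS(2)[OF that(1)] that(2) by simp
    moreover have "length (Q (Suc j)) \<le> n" using cnt[of "Suc j"] ps(3) by (simp add: Q_def)
    ultimately show ?thesis by linarith
  qed
  have arr0: "arr \<sigma> ''w'' m = ws ! (m - 1)" if "m \<in> {1..length ws}" for m
  proof -
    have "m - 1 < length ws" "Suc (m - 1) = m" using that by auto
    then show ?thesis using ws(1) nth_slice[of "m - 1" "length ws" "arr \<sigma> ''w''"] by metis
  qed
  let ?\<sigma> = "\<sigma>\<lparr>reg := (reg \<sigma>)(''i'' := eval_exp tb \<sigma> (Const 0))\<rparr>"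
  show ?case
  proof (rule wp_Seq, rule wp_For[where lo = 1 and hi = "length ws" and I = "\<lambda>j \<tau> _. ?I (j - 1) \<tau>"], goal_cases)
    case (10 j \<tau> b)
    obtain j' where j': "j = Suc j'" using 10(1) by (cases j) auto
    have \<tau>: "reg \<tau> ''k'' = reg \<sigma> ''k''" "arr \<tau> ''o'' = arr \<sigma> ''o''"
      using 10(3) a by (auto simp: agree_def push_alg_def)
    have I: "?I j' \<tau>" using 10(4) j' by simp
    have jl: "j' < length ws" using 10 j' by simp
    have wj: "arr \<tau> ''w'' (Suc j') = ws ! j'" using I jl by simp
    have wjn: "ws ! j' \<le> n" using ws(3) jl by (meson atMost_iff nth_mem subsetD)
    have jn: "Suc j' \<le> n" using jl ws(2) by simp
    have sj: "Suc j' - 1 = j'" "Suc (Suc j') - 1 = Suc j'" by simp_all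
    let ?\<tau> = "\<tau>\<lparr>reg := (reg \<tau>)(''j'' := Suc j')\<rparr>"
    show ?case
      unfolding j' sj
    proof (rule wp_Cond, goal_cases)
      case (3 b0)
      then have eq: "ws ! j' = v" using \<tau> r wj by simp
      have W': "W (Suc j') = W j'" "Q (Suc j') = Q j' @ [Suc j']" using WS[OF jl] eq by simp_all
      show ?case
        unfolding W'
        using I QL[OF jl eq] jn a
        by (intro wp_conseq[OF wp_push_alg[of _ _ "Q j'" _ _ "Suc j'"]]) (auto simp: agree_def push_alg_def)
    next
      case (4 b0)
      then have eq: "ws ! j' \<noteq> v" using \<tau> r wj by simp
      have W': "W (Suc j') = W j' @ [ws ! j']" "Q (Suc j') = Q j'" using WS[OF jl] eq by simp_all
      have wl: "length (W j') < n" using WL[of j'] jn by simp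
      have ne: "a \<noteq> ''w''" by (rule a(1))
      show ?case
        unfolding W'
      proof (rule wp_conseq[OF wp_push_alg[of _ _ "W j'" _ _ "ws ! j'"]], goal_cases)
        case (7 \<sigma>' b)
        then have "reg \<sigma>' ''t'' = reg \<tau> ''t''" "arr \<sigma>' a = arr \<tau> a"
          using ne by (auto simp: agree_def push_alg_def)
        then show ?case using 7 I WL[of j'] by auto
      qed (use I wl wj wjn jn in auto)
    qed (use \<tau> wj wjn jn r in auto)
  next
    case (11 \<tau> b)
    have F: "W (length ws) = vs" "Q (length ws) = ps @ occurrences v ws" by (simp_all add: W_def Q_def vs_def)
    have "length vs \<le> n" using WL[of "length ws"] ws(2) F by simp
    then show ?case using 11(2) F by (intro wp_Assign) auto
  qed (use r ws(2) n2 arr0 ps W0 in auto)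
qed (use n2 in auto)

lemma wp_positions_alg:
  assumes r: "reg \<sigma> ''N'' = length ws" "reg \<sigma> m = length os" "length os \<le> n"
    and os: "slice (arr \<sigma> ''o'') (length os) = os" "set os \<subseteq> {..n}"
    and ws: "slice (arr \<sigma> ''w'') (length ws) = ws" "length ws \<le> n" "set ws \<subseteq> {..n}"
    and a: "a \<noteq> ''w''" "a \<noteq> ''o''" "m \<notin> {''t'', ''k'', ''i'', ''j'', ''N''}"
  shows "wp tb n (small n) \<mu> (positions_alg a m) \<sigma> (\<lambda>\<sigma>' _.
    slice (arr \<sigma>' a) (length (word_positions os ws)) = word_positions os ws)"
  unfolding positions_alg_def
proof (rule wp_Seq, rule wp_Assign, goal_cases)
  case (2 b0)
  \<comment> \<open>\<open>us\<close> is the word without the letters already treated and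
    \<open>ps\<close> are the positions found; what remains to be emitted depends on
    \<open>us\<close> alone.\<close>
  let ?I = "\<lambda>k \<tau>. \<exists>us ps. reg \<tau> ''N'' = length us \<and> slice (arr \<tau> ''w'') (length us) = us \<and>
    length us \<le> n \<and> set us \<subseteq> {..n} \<and> reg \<tau> ''t'' = length ps \<and> slice (arr \<tau> a) (length ps) = ps \<and>
    length ps + length us \<le> n \<and> ps @ word_positions (drop k os) us = word_positions os ws"
  show ?case
  proof (rule wp_For[where lo = 1 and hi = "length os" and I = "\<lambda>k \<tau> _. ?I (k - 1) \<tau>"], goal_cases)
    case (9)
    then show ?case using r ws by (intro exI[of _ ws] exI[of _ "[]"]) auto
  next
    case (10 k \<tau> b)
    obtain k' where k': "k = Suc k'" using 10(1) by (cases k) auto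
    then have kl: "k' < length os" using 10(2) by simp
    have \<tau>: "arr \<tau> ''o'' = arr \<sigma> ''o''"
      using 10(3) a by (auto simp: agree_def push_alg_def position_step_def)
    obtain us ps where I: "reg \<tau> ''N'' = length us" "slice (arr \<tau> ''w'') (length us) = us"
      "length us \<le> n" "set us \<subseteq> {..n}" "reg \<tau> ''t'' = length ps" "slice (arr \<tau> a) (length ps) = ps"
      "length ps + length us \<le> n" "ps @ word_positions (drop k' os) us = word_positions os ws"
      using 10(4) k' by auto
    let ?v = "os ! k'"
    have ov: "arr \<sigma> ''o'' (Suc k') = ?v" using os(1) kl nth_slice[of k' "length os" "arr \<sigma> ''o''"] by simp
    have vn: "?v \<le> n" using os(2) kl by (meson atMost_iff nth_mem subsetD)
    have dr: "drop k' os = ?v # drop (Suc k') os" using kl by (simp add: Cons_nth_drop_Suc)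
    have sk: "Suc (Suc k') - 1 = Suc k'" by simp
    let ?us = "filter (\<lambda>x. x \<noteq> ?v) us"
    have cl: "count_list us ?v + length ?us = length us" using length_filter_neq[of us ?v] by simp
    show ?case
      unfolding k' sk
    proof (rule wp_conseq[OF wp_position_step[where ws = us and ps = ps and v = ?v]], goal_cases)
      case (13 \<sigma>' b)
      then show ?case
        using I cl
        by (intro exI[of _ ?us] exI[of _ "ps @ occurrences ?v us"]) (auto simp: dr)
    qed (use I \<tau> ov kl r(3) vn a cl in auto)
  next
    case (11 \<tau> b)
    then show ?case by auto
  qed (use r a n2 in auto)
qed (use n2 in auto)

text \<open>What the summation may do: loop control on small numbers, and additions with all numbers
  below a bound \<open>M\<close>, later the number of trees, as demanded of number
  operations.\<close>

definition fits :: "nat \<Rightarrow> event \<Rightarrow> bool" where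
  "fits M e \<longleftrightarrow> small n e \<or> (\<forall>x\<in>numbers e. x < M)"

lemma wp_sum_alg:
  assumes r: "reg \<sigma> m = length ps" "length ps \<le> n" "m \<noteq> ''t''" "m \<noteq> ''rank''"
    and ps: "slice (arr \<sigma> a) (length ps) = ps" "set ps \<subseteq> {..n}"
    and R: "length rs = length ps" "\<And>i j. i < length rs \<Longrightarrow> j \<le> n \<Longrightarrow> tb W (Suc i) j = weight_of (rs ! i) j"
    and M: "reg \<sigma> ''rank'' + sum_list (map2 weight_of rs ps) < M"
  shows "wp tb n (fits M) \<mu> (sum_alg W a m) \<sigma> (\<lambda>\<sigma>' _.
    reg \<sigma>' ''rank'' = reg \<sigma> ''rank'' + sum_list (map2 weight_of rs ps))"
  unfolding sum_alg_def
proof (rule wp_For[where lo = 1 and hi = "length ps" and I = "\<lambda>t \<tau> _. reg \<tau> ''rank'' =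
    reg \<sigma> ''rank'' + sum_list (take (t - 1) (map2 weight_of rs ps))"], goal_cases)
  case (10 t \<tau> b)
  obtain i where t: "t = Suc i" using 10(1) by (cases t) auto
  then have i: "i < length ps" using 10(2) by simp
  let ?ws = "map2 weight_of rs ps"
  have \<tau>: "arr \<tau> a = arr \<sigma> a" using 10(3) by (auto simp: agree_def)
  have p: "arr \<sigma> a (Suc i) = ps ! i" using ps(1) i nth_slice[of i "length ps" "arr \<sigma> a"] by simp
  have pn: "ps ! i \<le> n" using ps(2) i by (meson atMost_iff nth_mem subsetD)
  have w: "tb W (Suc i) (ps ! i) = ?ws ! i" using R i pn by simp
  have sk: "Suc (Suc i) - 1 = Suc i" "Suc i - 1 = i" by simp_all
  have tk: "sum_list (take (Suc i) ?ws) = sum_list (take i ?ws) + ?ws ! i"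
    using R(1) i by (simp add: take_Suc_conv_app_nth)
  \<comment> \<open>Weights are natural numbers, so a partial sum is bounded by the complete one and
    hence by \<open>M\<close>.\<close>
  have "sum_list (take (Suc i) ?ws) + sum_list (drop (Suc i) ?ws) = sum_list ?ws"
    by (metis append_take_drop_id sum_list_append)
  then have lt: "reg \<sigma> ''rank'' + (sum_list (take i ?ws) + ?ws ! i) < M" using M tk by linarith
  have rk: "reg \<tau> ''rank'' = reg \<sigma> ''rank'' + sum_list (take i ?ws)" using 10(4) t by simp
  have tn: "Suc i \<le> n" using i r(2) by simp
  define x where "x = ?ws ! i"
  define y where "y = sum_list (take i ?ws)"
  show ?case
    unfolding t sk tk
    apply (rule wp_Arith)
    using rk lt tn w p pn \<tau>
    by (simp_all add: fits_def Let_def x_def[symmetric] y_def[symmetric])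
next
  case (11 \<tau> b)
  then show ?case using R(1) by simp
qed (use r n2 in \<open>auto simp: fits_def\<close>)

end

lemma multinomial_drop_le: "0 < base \<Longrightarrow> multinomial base (drop k cs) \<le> multinomial base cs"
proof (induction cs arbitrary: k)
  case (Cons c cs)
  have "0 < ((c + sum_list cs) choose c)" by simp
  then have "1 * multinomial base cs \<le> multinomial base (c # cs)"
    unfolding multinomial.simps by (intro mult_le_mono1) (simp add: Suc_le_eq)
  then show ?case using Cons.IH[of "k - 1"] Cons.prems by (cases k) (auto intro: order.trans)
qed simp

section \<open>Masks that select places, and bounded events\<close>

definition select :: "bool \<Rightarrow> 'a list \<Rightarrow> bool list \<Rightarrow> 'a list" where
  "select b xs bs = map fst (filter (\<lambda>(x, y). y = b) (zip xs bs))"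

lemma select_Nil [simp]: "select b [] bs = []" "select b xs [] = []"
  by (simp_all add: select_def)

lemma select_Cons [simp]: "select b (x # xs) (y # ys) = (if y = b then [x] else []) @ select b xs ys"
  by (simp add: select_def)

lemma select_snoc:
  "length xs = length bs \<Longrightarrow> select b (xs @ [x]) (bs @ [y]) = select b xs bs @ (if y = b then [x] else [])"
  by (simp add: select_def)

lemma set_select: "set (select b xs bs) \<subseteq> set xs"
  by (auto simp: select_def dest: set_zip_leftD)

lemma distinct_select: "distinct xs \<Longrightarrow> distinct (select b xs bs)"
proof (induction xs arbitrary: bs)
  case (Cons x xs)
  then show ?case using set_select[of b xs] by (cases bs) auto
qed simp

lemma select_disjoint:
  "distinct xs \<Longrightarrow> x \<in> set (select True xs bs) \<Longrightarrow> x \<notin> set (select False xs bs)"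
proof (induction xs arbitrary: bs)
  case (Cons y xs)
  then show ?case using set_select[of _ xs] by (cases bs) (auto split: if_splits)
qed simp

lemma set_select_Un:
  "length xs = length bs \<Longrightarrow> set (select True xs bs) \<union> set (select False xs bs) = set xs"
  by (induction xs bs rule: list_induct2) auto

lemma length_select: "length xs = length bs \<Longrightarrow> length (select b xs bs) = count_list bs b"
  by (induction xs bs rule: list_induct2) auto

text \<open>Links filling places in an array with the recursive \<open>merge\<close>: the selected
  places hold \<open>v\<close>, and the places left free carry the word of the other
  letters.\<close>

lemma map_eq_merge:
  assumes "length xs = length bs" "\<And>x. x \<in> set (select True xs bs) \<Longrightarrow> f x = v"
  shows "map f xs = merge v bs (map f (select False xs bs))"
  using assms by (induction xs bs rule: list_induct2) auto

lemma choose_le_power_mono: "N \<le> n \<Longrightarrow> l \<le> c \<Longrightarrow> 1 \<le> n \<Longrightarrow> (N choose l) \<le> n ^ c"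
  by (meson choose_le_power le_trans power_increasing power_mono zero_le)

definition bounded :: "nat \<Rightarrow> event \<Rightarrow> bool" where
  "bounded M e \<longleftrightarrow> (\<forall>x\<in>numbers e. x \<le> M)"

lemma bounded_simps [simp]:
  "bounded M (Move x) \<longleftrightarrow> x \<le> M"
  "bounded M (Comp x y) \<longleftrightarrow> x \<le> M \<and> y \<le> M"
  "bounded M (Calc x y z) \<longleftrightarrow> x \<le> M \<and> y \<le> M \<and> z \<le> M"
  by (auto simp: bounded_def)

lemma bounded_if_small: "small n e \<Longrightarrow> n \<le> M \<Longrightarrow> bounded M e"
  by (auto simp: small_def bounded_def)

lemma wp_weaken:
  assumes "wp tb n P \<mu> c \<sigma> Q" "\<And>e. P e \<Longrightarrow> P' e"
    "\<And>\<sigma>' b. agree c \<sigma> \<sigma>' \<Longrightarrow> Q \<sigma>' b \<Longrightarrow> Q' \<sigma>' b"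
  shows "wp tb n P' \<mu> c \<sigma> Q'"
  using assms unfolding wp_def by blast

context machine
begin

lemma wp_digits_alg:
  assumes r: "reg \<sigma> m = length cs" "length cs \<le> n" "n \<le> M"
      "m \<notin> {''k'', ''y'', ''m''}"
    and x: "reg \<sigma> ''m'' = x" "x < multinomial base cs" "multinomial base cs \<le> M" "0 < base"
    and B: "\<And>k. 1 \<le> k \<Longrightarrow> k \<le> length cs \<Longrightarrow> tb B k 0 = multinomial base (drop k cs)"
  shows "wp tb n (bounded M) \<mu> (digits_alg B m) \<sigma> (\<lambda>\<sigma>' _.
    slice (arr \<sigma>' ''q'') (length cs) = digits base cs x \<and> reg \<sigma>' ''m'' = remainder base cs x)"
  unfolding digits_alg_def
\<comment> \<open>The digits stored so far, followed by those of the current \<open>m\<close>, are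
  the digits of \<open>x\<close>; the bound by \<open>x\<close> keeps every intermediate number at
  most \<open>M\<close>.\<close>
proof (rule wp_For[where lo = 1 and hi = "length cs" and I = "\<lambda>k \<tau> _.
    slice (arr \<tau> ''q'') (k - 1) @ digits base (drop (k - 1) cs) (reg \<tau> ''m'') = digits base cs x \<and>
    remainder base (drop (k - 1) cs) (reg \<tau> ''m'') = remainder base cs x \<and> reg \<tau> ''m'' \<le> x"], goal_cases)
  case (10 k \<tau> b)
  obtain i where i: "k = Suc i" using 10(1) by (cases k) auto
  then have il: "i < length cs" using 10(2) by simp
  define y where "y = reg \<tau> ''m''"
  define D where "D = multinomial base (drop (Suc i) cs)"
  have dr: "drop i cs = cs ! i # drop (Suc i) cs" using il by (simp add: Cons_nth_drop_Suc)
  have DM: "D \<le> M" using multinomial_drop_le[OF x(4), of "Suc i" cs] x(3) by (simp add: D_def)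
  have tB: "tb B (Suc i) 0 = D" using B[of "Suc i"] il by (simp add: D_def)
  have yM: "y \<le> x" "x \<le> M" using 10(4) x by (simp_all add: y_def)
  have yD: "y div D * D \<le> M"
    using yM div_mod_decomp[of y D] by linarith
  have kM: "Suc i \<le> M" using il r by simp
  have dM: "y div D \<le> M" using yM by (meson div_le_dividend le_trans)
  have ym: "y - y div D * D = y mod D" by (simp add: minus_div_mult_eq_mod)
  have I: "slice (arr \<tau> ''q'') i @ digits base (drop i cs) y = digits base cs x"
    "remainder base (drop i cs) y = remainder base cs x" using 10(4) i by (simp_all add: y_def)
  have sk: "Suc (Suc i) - 1 = Suc i" by simp
  have mm: "y mod D \<le> x" using yM by (meson mod_less_eq_dividend le_trans)
  show ?case
    unfolding i sk
    apply (intro wp_Seq wp_Arith wp_Store)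
    using kM yM DM dM mm I
    by (simp_all add: yD tB y_def[symmetric] ym dr D_def[symmetric])
next
  case (11 \<tau> b)
  then show ?case by simp
qed (use r x n2 in auto)

text \<open>Binomials met while placing a letter of multiplicity \<open>c\<close> are at most
  \<open>n ^ c\<close>, however large the full rank is. One more factor \<open>n\<close> covers
  counters and positions, also for \<open>c = 0\<close>.\<close>

lemma wp_place_step:
  assumes r: "reg \<sigma> ''N'' = length Fs" "arr \<sigma> ''o'' (reg \<sigma> ''k'') = v" "v \<le> n" "reg \<sigma> ''k'' \<le> n"
    and F: "slice (arr \<sigma> ''F'') (length Fs) = Fs" "set Fs \<subseteq> {1..n}" "length Fs \<le> n"
    and q: "arr \<sigma> ''q'' (reg \<sigma> ''k'') = q" "q < (length Fs choose c)"
    and C: "tb C (reg \<sigma> ''k'') 0 = c"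
  defines "bs \<equiv> subset_unrank (length Fs) c q"
  defines "Gs \<equiv> select False Fs bs"
  shows "wp tb n (bounded (n ^ Suc c)) \<mu> (place_step C) \<sigma> (\<lambda>\<sigma>' _.
    reg \<sigma>' ''N'' = length Gs \<and> slice (arr \<sigma>' ''F'') (length Gs) = Gs \<and>
    arr \<sigma>' ''w'' = (\<lambda>x. if x \<in> set (select True Fs bs) then v else arr \<sigma> ''w'' x))"
proof -
  let ?M = "n ^ Suc c"
  let ?N = "length Fs"
  have n1: "1 \<le> n" using n2 by simp
  have nM: "x \<le> ?M" if "x \<le> n" for x
    using that power_increasing[of 1 "Suc c" n] n1 le_trans[of x n ?M] by (simp del: power_Suc)
  have cM: "(N choose l) \<le> ?M" if "N \<le> n" "l \<le> c" for N l
    using that choose_le_power_mono[of N n l "Suc c"] n1 by simp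
  \<comment> \<open>A digit below the binomial shows that the binomial is positive, so
    \<open>c\<close> does not exceed the number of free places.\<close>
  have cn: "c \<le> n" using q(2) F(3) by (metis binomial_eq_0 le_trans not_le not_less_zero)
  have qM: "q \<le> ?M" using q(2) cM[of ?N c] F(3) by simp
  \<comment> \<open>After \<open>j\<close> free places, \<open>G j\<close> are those that stay free
    and \<open>H j\<close> those that receive \<open>v\<close>.\<close>
  define G where "G j = select False (take j Fs) (take j bs)" for j
  define H where "H j = set (select True (take j Fs) (take j bs))" for j
  have lb: "length bs = ?N" by (simp add: bs_def)
  have G0: "G 0 = []" "H 0 = {}" by (simp_all add: G_def H_def)
  have GS: "G (Suc j) = (if bs ! j then G j else G j @ [Fs ! j])"
    "H (Suc j) = (if bs ! j then insert (Fs ! j) (H j) else H j)" if "j < ?N" for j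
    using that lb by (simp_all add: G_def H_def take_Suc_conv_app_nth select_snoc)
  have GL: "length (G j) \<le> j" for j
  proof -
    have "length (G j) \<le> length (take j Fs)"
      unfolding G_def select_def by (simp add: order.trans[OF length_filter_le])
    then show ?thesis by simp
  qed
  have GN: "G ?N = Gs" "H ?N = set (select True Fs bs)" using lb by (simp_all add: G_def H_def Gs_def)
  \<comment> \<open>The registers \<open>l\<close> and \<open>y\<close> are described by the part of
    the mask they still produce; unread entries of \<open>F\<close> survive because the write index
    lags behind.\<close>
  let ?I = "\<lambda>j \<tau>. reg \<tau> ''i'' = length (G j) \<and> slice (arr \<tau> ''F'') (length (G j)) = G j \<and>
    (\<forall>m\<in>{Suc j..?N}. arr \<tau> ''F'' m = Fs ! (m - 1)) \<and>
    subset_unrank (?N - j) (reg \<tau> ''l'') (reg \<tau> ''y'') = drop j bs \<and> reg \<tau> ''l'' \<le> c \<and> reg \<tau> ''y'' \<le> q \<and>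
    arr \<tau> ''w'' = (\<lambda>x. if x \<in> H j then v else arr \<sigma> ''w'' x)"
  have arr0: "arr \<sigma> ''F'' m = Fs ! (m - 1)" if "m \<in> {1..?N}" for m
  proof -
    have "m - 1 < ?N" "Suc (m - 1) = m" using that by auto
    then show ?thesis using F(1) nth_slice[of "m - 1" ?N "arr \<sigma> ''F''"] by metis
  qed
  let ?\<sigma> = "\<sigma>\<lparr>reg := (reg \<sigma>)(''y'' := q, ''l'' := c, ''i'' := 0)\<rparr>"
  let ?body = "(Assign ''b'' (Look ''binom'' (Look ''sub'' (Reg ''N'') (Reg ''j'')) (Reg ''l'')) ;;
        Cond LessEq (Reg ''b'') (Reg ''y'')
          (Arith ''y'' Minus (Reg ''y'') (Reg ''b'') ;;
           Assign ''l'' (Look ''pred'' (Reg ''l'') (Const 0)) ;;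
           Store ''w'' (Elem ''F'' (Reg ''j'')) (Elem ''o'' (Reg ''k'')))
          (push_alg ''F'' ''i'' (Elem ''F'' (Reg ''j''))))"
  have main: "wp tb n (bounded ?M) \<mu> (For ''j'' (Const 1) (Reg ''N'') ?body ;; Assign ''N'' (Reg ''i'')) ?\<sigma>
    (\<lambda>\<sigma>' _. reg \<sigma>' ''N'' = length Gs \<and> slice (arr \<sigma>' ''F'') (length Gs) = Gs \<and>
      arr \<sigma>' ''w'' = (\<lambda>x. if x \<in> set (select True Fs bs) then v else arr \<sigma> ''w'' x))"
  proof (rule wp_Seq, rule wp_For[where lo = 1 and hi = ?N and I = "\<lambda>j \<tau> _. ?I (j - 1) \<tau>"], goal_cases)
    case 9
    then show ?case using arr0 by (simp add: G0 bs_def)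
  next
    case (10 j' \<tau> b)
    obtain j where j: "j' = Suc j" using 10(1) by (cases j') auto
    have jl: "j < ?N" using 10 j by simp
    have \<tau>: "reg \<tau> ''k'' = reg \<sigma> ''k''" "arr \<tau> ''o'' = arr \<sigma> ''o''" "reg \<tau> ''N'' = ?N"
      using 10(3) r by (auto simp: agree_def push_alg_def)
    have I: "?I j \<tau>" using 10(4) j by simp
    define l where "l = reg \<tau> ''l''"
    define y where "y = reg \<tau> ''y''"
    define B where "B = ((?N - Suc j) choose l)"
    have lc: "l \<le> c" "l \<le> n" "y \<le> q" "y \<le> ?M" using I cn qM by (auto simp: l_def y_def)
    have jn: "Suc j \<le> n" "Suc j \<le> ?N" using jl F(3) by simp_all
    have Bv: "tb ''binom'' (tb ''sub'' ?N (Suc j)) l = B" "tb ''sub'' ?N (Suc j) = ?N - Suc j"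
      using binom[of "?N - Suc j" l] sub[of ?N "Suc j"] F(3) lc jn by (simp_all add: B_def)
    have BM: "B \<le> ?M" unfolding B_def using F(3) lc by (intro cM) auto
    have fj: "arr \<tau> ''F'' (Suc j) = Fs ! j" using I jl by simp
    have fjn: "Fs ! j \<in> {1..n}" using F(2) jl by (meson nth_mem subsetD)
    have "?N - j = Suc (?N - Suc j)" using jl by simp
    then have u: "drop j bs = subset_unrank (Suc (?N - Suc j)) l y" using I by (simp add: l_def y_def)
    have dr: "drop j bs = bs ! j # drop (Suc j) bs" using jl lb by (simp add: Cons_nth_drop_Suc)
    have ub: "bs ! j = (B \<le> y)" "drop (Suc j) bs = (if B \<le> y then subset_unrank (?N - Suc j) (l - 1) (y - B) else subset_unrank (?N - Suc j) l y)"
      using u unfolding dr by (auto simp: B_def split: if_splits)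
    have sk: "Suc (Suc j) - 1 = Suc j" by simp
    let ?\<tau> = "\<tau>\<lparr>reg := (reg \<tau>)(''j'' := Suc j, ''b'' := B)\<rparr>"
    have cond: "wp tb n (bounded ?M) \<mu> (Cond LessEq (Reg ''b'') (Reg ''y'')
          (Arith ''y'' Minus (Reg ''y'') (Reg ''b'') ;;
           Assign ''l'' (Look ''pred'' (Reg ''l'') (Const 0)) ;;
           Store ''w'' (Elem ''F'' (Reg ''j'')) (Elem ''o'' (Reg ''k'')))
          (push_alg ''F'' ''i'' (Elem ''F'' (Reg ''j'')))) ?\<tau>
      (\<lambda>\<tau>' _. ?I (Suc j) \<tau>')"
    proof (rule wp_Cond, goal_cases)
      case (3 b0)
      then have eq: "B \<le> y" by (simp add: y_def)
      then have bj: "bs ! j" "subset_unrank (?N - Suc j) (l - Suc 0) (y - B) = drop (Suc j) bs" using ub by simp_all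
      have GH: "G (Suc j) = G j" "H (Suc j) = insert (Fs ! j) (H j)" using GS[OF jl] bj by simp_all
      have wj: "(arr \<tau> ''w'')(Fs ! j := v) = (\<lambda>x. if x \<in> H (Suc j) then v else arr \<sigma> ''w'' x)"
        using I by (auto simp: GH)
      have pl: "tb ''pred'' l 0 = l - 1" using pred lc by simp
      show ?case
        apply (intro wp_Seq wp_Arith wp_Assign wp_Store)
        using I lc BM \<tau> r fj fjn jn nM bj pl wj GH(1)
        by (simp_all add: l_def[symmetric] y_def[symmetric] le_trans[OF diff_le_self])
    next
      case (4 b0)
      then have eq: "\<not> B \<le> y" by (simp add: y_def)
      then have bj: "\<not> bs ! j" "subset_unrank (?N - Suc j) l y = drop (Suc j) bs" using ub by simp_all
      have GH: "G (Suc j) = G j @ [Fs ! j]" "H (Suc j) = H j" using GS[OF jl] bj by simp_all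
      have gl: "length (G j) < n" using GL[of j] jn by simp
      show ?case
      proof (rule wp_weaken[OF wp_push_alg[of _ _ "G j" _ _ "Fs ! j"] bounded_if_small], goal_cases)
        case (9 \<sigma>' b)
        then have ag: "reg \<sigma>' ''l'' = l" "reg \<sigma>' ''y'' = y" "arr \<sigma>' ''w'' = arr \<tau> ''w''"
          by (auto simp: agree_def push_alg_def l_def y_def)
        have F': "\<forall>m\<in>{Suc (Suc j)..?N}. arr \<sigma>' ''F'' m = Fs ! (m - 1)"
          using 9(2) I GL[of j] by simp
        show ?case using 9(2) I F' lc bj(2) unfolding GH ag by simp
      qed (use I fj fjn jn gl nM in auto)
    qed (use BM lc in \<open>auto simp: y_def\<close>)
    show ?case
      unfolding j sk
    proof (rule wp_Seq, rule wp_Assign, goal_cases)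
      case (2 b')
      have e: "eval_exp tb (\<tau>\<lparr>reg := (reg \<tau>)(''j'' := Suc j)\<rparr>)
          (Look ''binom'' (Look ''sub'' (Reg ''N'') (Reg ''j'')) (Reg ''l'')) = B"
        using \<tau> Bv by (simp add: l_def)
      have st: "\<tau>\<lparr>reg := (reg \<tau>)(''j'' := Suc j)\<rparr>\<lparr>reg := (reg (\<tau>\<lparr>reg := (reg \<tau>)(''j'' := Suc j)\<rparr>))(''b'' := B)\<rparr> = ?\<tau>"
        by simp
      show ?case unfolding e st by (rule cond)
    next
      case 1
      then show ?case using \<tau> Bv BM jn F(3) nM lc by (auto simp: l_def[symmetric])
    qed
  next
    case (11 \<tau> b)
    have "length Gs \<le> n" using GL[of ?N] GN F(3) by simp
    then show ?case using 11(2) GN nM by (intro wp_Assign) auto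
  qed (use r F(3) nM n1 in auto)
  show ?thesis
    unfolding place_step_def
  proof (rule wp_Seq, rule wp_Assign, goal_cases)
    case (2 b0)
    show ?case
    proof (rule wp_Seq, rule wp_Assign, goal_cases)
      case (2 b1)
      show ?case
      proof (rule wp_Seq, rule wp_Assign, goal_cases)
        case (2 b2)
        show ?case using main q(1) C by (simp add: fun_upd_twist)
      qed (use nM in auto)
    qed (use r C nM cn in auto)
  qed (use r q qM nM in auto)
qed

end

lemma nth_digits_less:
  assumes "0 < base" "m < multinomial base cs" "k < length cs"
  shows "digits base cs m ! k < (sum_list (drop k cs) choose (cs ! k))"
  using assms(2,3)
proof (induction cs arbitrary: m k)
  case (Cons c cs)
  have "m mod multinomial base cs < multinomial base cs" using multinomial_pos[OF assms(1)] by simp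
  then show ?case using Cons digit_less[OF assms(1) Cons.prems(1)] by (cases k) auto
qed simp

context machine
begin

text \<open>Amortised cost: a letter of multiplicity \<open>c\<close> costs O((c + 1) n log n), and
  the multiplicities as well as the number of letters sum up to at most \<open>n\<close>. Charging
  every round for the largest possible multiplicity would lose a factor \<open>n\<close>.\<close>

lemma wp_place_alg:
  assumes r: "reg \<sigma> m = length cs" "length cs \<le> n" "reg \<sigma> ''N'' = sum_list cs" "sum_list cs \<le> n"
      "m \<notin> {''v'', ''k'', ''y'', ''l'', ''i'', ''j'', ''b'', ''N''}"
    and o: "length os = length cs" "slice (arr \<sigma> ''o'') (length cs) = os" "set os \<subseteq> {..n}"
    and q: "length qs = length cs" "slice (arr \<sigma> ''q'') (length cs) = qs"
      "\<And>k. k < length cs \<Longrightarrow> qs ! k < (sum_list (drop k cs) choose (cs ! k))"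
    and C: "\<And>k. k < length cs \<Longrightarrow> tb C (Suc k) 0 = cs ! k"
  shows "wp tb n (\<lambda>_. True) event_bits (place_alg C m) \<sigma> (\<lambda>\<sigma>' b.
    slice (arr \<sigma>' ''w'') (sum_list cs) = word_of_digits os cs qs \<and>
    b \<le> bit_length n * (3 * steps n (identity_alg ''F'' ''N'') + 9 + 6 * n + 6 * n * steps n (place_step C)))"
  unfolding place_alg_def
proof (rule wp_Seq, rule wp_charge[where k = "3 * bit_length n", OF wp_identity_alg], goal_cases)
  case (4 \<sigma>1 b1)
  let ?L = "bit_length n" let ?S = "steps n (place_step C)" let ?N = "sum_list cs"
  \<comment> \<open>Three events enter the loop and two more control each round, all of cost at most
    \<open>3 * ?L\<close>; a body of multiplicity \<open>c\<close> has at most \<open>?S\<close>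
    events of cost at most \<open>3 * (c + 1) * ?L\<close>.\<close>
  let ?B = "\<lambda>k. 9 * ?L + 6 * ?L * k + 3 * ?L * ?S * (sum_list (take k cs) + k)"
  \<comment> \<open>The word is correct no matter how it is completed on the free positions \<open>Fs\<close>.\<close>
  let ?I = "\<lambda>k \<tau> b. b \<le> ?B k \<and> (\<exists>Fs. reg \<tau> ''N'' = length Fs \<and> length Fs = sum_list (drop k cs) \<and>
    slice (arr \<tau> ''F'') (length Fs) = Fs \<and> distinct Fs \<and> set Fs \<subseteq> {1..?N} \<and>
    (\<forall>f. (\<forall>x. x \<notin> set Fs \<longrightarrow> f x = arr \<tau> ''w'' x) \<longrightarrow>
      map f Fs = word_of_digits (drop k os) (drop k cs) (drop k qs) \<longrightarrow> slice f ?N = word_of_digits os cs qs))"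
  have 1: "reg \<sigma>1 m = length cs" "reg \<sigma>1 ''N'' = ?N" "arr \<sigma>1 ''o'' = arr \<sigma> ''o''" "arr \<sigma>1 ''q'' = arr \<sigma> ''q''"
    using 4(1) r by (auto simp: agree_def identity_alg_def)
  have ev: "event_bits e \<le> 3 * ?L" if "small n e" for e
    using that by (intro event_bits_le) (auto simp: small_def)
  have n1: "1 \<le> n" using n2 by simp
  show ?case
  proof (rule wp_For[where lo = 1 and hi = "length cs" and I = "\<lambda>k \<tau> b. ?I (k - 1) \<tau> b"], goal_cases)
    case 9
    have "sum_list (map event_bits (fetch tb \<sigma>1 (Const 1) @ fetch tb \<sigma>1 (Reg m))) + event_bits (Comp 1 (length cs)) \<le> 9 * ?L"
      using ev[of "Move 1"] ev[of "Move (length cs)"] ev[of "Comp 1 (length cs)"] 1 r n1 by simp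
    moreover have "slice (arr \<sigma>1 ''F'') ?N = [1..<Suc ?N]" using 4(2) r(3) by simp
    ultimately show ?case using 1(2)
      by (intro conjI exI[of _ "[1..<Suc ?N]"]) (auto simp: slice_def simp del: upt_Suc)
  next
    case (10 k' \<tau> b)
    obtain k where k: "k' = Suc k" using 10(1) by (cases k') auto
    have kl: "k < length cs" using 10 k by simp
    have \<tau>: "arr \<tau> ''o'' = arr \<sigma> ''o''" "arr \<tau> ''q'' = arr \<sigma> ''q''"
      using 10(3) 1 by (auto simp: agree_def place_step_def push_alg_def)
    obtain Fs where b: "b \<le> ?B k" and F: "reg \<tau> ''N'' = length Fs" "length Fs = sum_list (drop k cs)"
      "slice (arr \<tau> ''F'') (length Fs) = Fs" "distinct Fs" "set Fs \<subseteq> {1..?N}"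
      and fin: "\<And>f. (\<And>x. x \<notin> set Fs \<Longrightarrow> f x = arr \<tau> ''w'' x) \<Longrightarrow>
        map f Fs = word_of_digits (drop k os) (drop k cs) (drop k qs) \<Longrightarrow> slice f ?N = word_of_digits os cs qs"
      using 10(4) k by auto
    let ?v = "os ! k" let ?c = "cs ! k" let ?q = "qs ! k"
    let ?bs = "subset_unrank (length Fs) ?c ?q" let ?Gs = "select False Fs ?bs"
    have dr: "drop k cs = ?c # drop (Suc k) cs" "drop k os = ?v # drop (Suc k) os"
      "drop k qs = ?q # drop (Suc k) qs"
      using kl o(1) q(1) by (simp_all add: Cons_nth_drop_Suc)
    have ov: "arr \<sigma> ''o'' (Suc k) = ?v" "arr \<sigma> ''q'' (Suc k) = ?q"
      using o(2) q(2) kl nth_slice[of k "length cs"] by metis+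
    have vn: "?v \<le> n" using o kl by (metis atMost_iff nth_mem subsetD)
    have qlt: "?q < (length Fs choose ?c)" using q(3)[OF kl] F(2) by simp
    have Fn: "set Fs \<subseteq> {1..n}" "length Fs \<le> n"
    proof -
      show 1: "set Fs \<subseteq> {1..n}" using F(5) r(4) by (auto dest!: subsetD)
      show "length Fs \<le> n" using card_mono[OF _ 1] distinct_card[OF F(4)] by simp
    qed
    have lG: "length ?Gs = sum_list (drop (Suc k) cs)"
      using subset_unrank_correct[OF qlt] F(2) dr(1) by (simp add: length_select count_list_False)
    have kn: "Suc k \<le> n" using kl r by simp
    have bM: "event_bits e \<le> 3 * (Suc ?c * ?L)" if "bounded (n ^ Suc ?c) e" for e
      using event_bits_le[of e "n ^ Suc ?c"] bit_length_power[of "Suc ?c" n] that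
      by (auto simp: bounded_def simp del: power_Suc intro: order.trans)
    have sk: "Suc (Suc k) - 1 = Suc k" by simp
    have tk: "sum_list (take (Suc k) cs) = sum_list (take k cs) + ?c"
      using kl by (simp add: take_Suc_conv_app_nth)
    show ?case
      unfolding k sk
    proof (rule wp_charge[OF wp_place_step[where Fs = Fs and v = ?v and q = ?q and c = ?c] conjI[OF TrueI bM]], goal_cases)
      case (12 \<sigma>' b')
      then have \<sigma>': "reg \<sigma>' ''N'' = length ?Gs" "slice (arr \<sigma>' ''F'') (length ?Gs) = ?Gs"
        "arr \<sigma>' ''w'' = (\<lambda>x. if x \<in> set (select True Fs ?bs) then ?v else arr \<tau> ''w'' x)"
        and b': "b' \<le> 3 * (Suc ?c * ?L) * ?S" by auto
      have "event_bits (Move (Suc k)) + event_bits (Comp (Suc k) (length cs)) \<le> 6 * ?L"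
        using ev[of "Move (Suc k)"] ev[of "Comp (Suc k) (length cs)"] kn r(2) by simp
      moreover have "?B (Suc k) = ?B k + 6 * ?L + 3 * (Suc ?c * ?L) * ?S"
        unfolding tk by (simp add: algebra_simps)
      ultimately have bound: "b + event_bits (Move (Suc k)) + b' + event_bits (Comp (Suc k) (length cs)) \<le> ?B (Suc k)"
        using b b' by linarith
      have fin': "slice f ?N = word_of_digits os cs qs"
        if f: "\<forall>x. x \<notin> set ?Gs \<longrightarrow> f x = arr \<sigma>' ''w'' x"
          "map f ?Gs = word_of_digits (drop (Suc k) os) (drop (Suc k) cs) (drop (Suc k) qs)" for f
      proof (rule fin)
        have un: "set (select True Fs ?bs) \<union> set ?Gs = set Fs" by (intro set_select_Un) simp
        show "f x = arr \<tau> ''w'' x" if "x \<notin> set Fs" for x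
        proof -
          have "x \<notin> set ?Gs" "x \<notin> set (select True Fs ?bs)" using that un by blast+
          then show ?thesis using f(1) \<sigma>'(3) by simp
        qed
        have "map f Fs = merge ?v ?bs (map f ?Gs)"
        proof (rule map_eq_merge)
          fix x assume x: "x \<in> set (select True Fs ?bs)"
          then have "x \<notin> set ?Gs" using select_disjoint[OF F(4)] by blast
          then show "f x = ?v" using f(1) \<sigma>'(3) x by simp
        qed simp
        then show "map f Fs = word_of_digits (drop k os) (drop k cs) (drop k qs)"
          unfolding dr using f(2) F(2) dr(1) by simp
      qed
      show ?case
        using bound \<sigma>' lG F(4,5) distinct_select[OF F(4)] set_select[of False Fs ?bs] fin'
        by (intro conjI exI[of _ ?Gs]) auto
    qed (use F \<tau> ov vn kn Fn qlt C[OF kl] in auto)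
  next
    case (11 \<tau> b)
    then have b: "b \<le> ?B (length cs)" and "\<exists>Fs. length Fs = 0 \<and> (\<forall>f. (\<forall>x. x \<notin> set Fs \<longrightarrow> f x = arr \<tau> ''w'' x) \<longrightarrow>
      map f Fs = [] \<longrightarrow> slice f ?N = word_of_digits os cs qs)" using o(1) q(1) by auto
    then have "slice (arr \<tau> ''w'') ?N = word_of_digits os cs qs" by auto
    moreover have "b1 + b \<le> ?L * (3 * steps n (identity_alg ''F'' ''N'') + 9 + 6 * n + 6 * n * ?S)"
    proof -
      have "?B (length cs) \<le> 9 * ?L + 6 * ?L * n + 3 * ?L * ?S * (n + n)"
        using r(2,4) by (intro add_mono mult_le_mono) auto
      moreover have "b1 \<le> 3 * ?L * steps n (identity_alg ''F'' ''N'')" using 4(3) by simp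
      ultimately have "b1 + b \<le> 3 * ?L * steps n (identity_alg ''F'' ''N'') + (9 * ?L + 6 * ?L * n + 3 * ?L * ?S * (n + n))"
        using b by linarith
      also have "\<dots> = ?L * (3 * steps n (identity_alg ''F'' ''N'') + 9 + 6 * n + 6 * n * ?S)"
        by (simp add: algebra_simps)
      finally show ?thesis .
    qed
    ultimately show ?case by blast
  qed (use 1 r n2 in auto)
next
  case (3 e)
  then show ?case using event_bits_le[of e n] by (auto simp: small_def)
qed (use r n2 in auto)

lemma wp_degree_alg:
  assumes r: "reg \<sigma> ''n'' = n" and t: "\<forall>i\<in>{2..n}. arr \<sigma> ''tree'' i \<in> {1..n}"
  shows "wp tb n (small n) \<mu> degree_alg \<sigma> (\<lambda>\<sigma>' _. \<forall>v. arr \<sigma>' ''s'' v = (if v \<in> {1..n}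
    then (if v \<in> {2..n} then 1 else 0) + card {u\<in>{2..n}. arr \<sigma> ''tree'' u = v} else arr \<sigma> ''s'' v))"
  unfolding degree_alg_def
proof (rule wp_Seq, rule wp_For[where lo = 1 and hi = n and I = "\<lambda>i \<tau> _.
    \<forall>v. arr \<tau> ''s'' v = (if v \<in> {1..<i} then 1 else arr \<sigma> ''s'' v)"], goal_cases)
  case (10 i \<tau> b)
  then show ?case using n2 by (intro wp_Store) (auto simp: less_Suc_eq)
next
  case (11 \<tau> b)
  let ?f = "arr \<sigma> ''tree''"
  let ?d = "\<lambda>i v. if v \<in> {1..n} then (if v \<in> {2..n} then 1 else 0) + card {u\<in>{2..<i}. ?f u = v} else arr \<sigma> ''s'' v"
  have \<tau>: "reg \<tau> ''n'' = n" "arr \<tau> ''tree'' = ?f" using 11(1) r by (auto simp: agree_def)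
  show ?case
  proof (rule wp_Seq, rule wp_Store, goal_cases)
    case (2 b1)
    show ?case
    proof (rule wp_For[where lo = 2 and hi = n and I = "\<lambda>i \<tau> _. \<forall>v. arr \<tau> ''s'' v = ?d i v"], goal_cases)
      case 9
      then show ?case using 11(2) n2 by auto
    next
      case (10 i \<tau>' b')
      have \<tau>': "arr \<tau>' ''tree'' = ?f" using 10(3) \<tau> by (auto simp: agree_def)
      let ?p = "?f i"
      have p: "?p \<in> {1..n}" using t 10 by simp
      have "card {u\<in>{2..<i}. ?f u = ?p} \<le> card {2..<i}" by (intro card_mono) auto
      then have "card {u\<in>{2..<i}. ?f u = ?p} + 2 \<le> i" using 10(1) by simp
      \<comment> \<open>At most \<open>i - 2\<close> children have been counted, so the entry is
        still below \<open>n\<close> and its successor can be looked up.\<close>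
      then have lt: "?d i ?p < n" using p 10(2) by (cases "?p \<in> {2..n}") simp_all
      have ins: "card {u\<in>{2..<Suc i}. ?f u = v} = card {u\<in>{2..<i}. ?f u = v} + (if v = ?p then 1 else 0)" for v
      proof (cases "v = ?p")
        case True
        then have "{u\<in>{2..<Suc i}. ?f u = v} = insert i {u\<in>{2..<i}. ?f u = v}" using 10(1) by auto
        then show ?thesis using True by simp
      next
        case False
        then have "{u\<in>{2..<Suc i}. ?f u = v} = {u\<in>{2..<i}. ?f u = v}" by (auto simp: less_Suc_eq)
        then show ?thesis using False by simp
      qed
      have sp: "arr \<tau>' ''s'' ?p = ?d i ?p" using 10(4) by blast
      have upd: "?d (Suc i) v = (if v = ?p then Suc (?d i ?p) else ?d i v)" for v
        unfolding ins using p by auto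
      show ?case
        unfolding upd
        using 10(2,4) \<tau>' p succ[OF lt] lt sp
        by (intro wp_Store) (auto simp del: One_nat_def)
    next
      case (11 \<tau>' b')
      then show ?case by (simp add: atLeastLessThanSuc_atLeastAtMost)
    qed (use \<tau> n2 in auto)
  qed (use n2 in auto)
qed (use r n2 in auto)

end

section \<open>Preprocessed tables and the ranks of trees\<close>

text \<open>Letter counts of a Pruefer word in the order of increasing degree: a vertex of degree
  \<open>e\<close> occurs \<open>e - 1\<close> times. Which vertices have degree \<open>e\<close>
  does not enter.\<close>

definition tree_content :: "nat \<Rightarrow> nat multiset \<Rightarrow> nat list" where
  "tree_content n S = concat (map (\<lambda>e. replicate (count S e) (e - 1)) [1..<n])"

text \<open>The letter counts of a degree word, whose letters are the values 1 to n - 1.\<close>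

definition degree_content :: "nat \<Rightarrow> nat multiset \<Rightarrow> nat list" where
  "degree_content n S = map (count S) [1..<n]"

definition weight_entry :: "nat \<Rightarrow> nat list \<Rightarrow> nat \<Rightarrow> nat \<Rightarrow> nat" where
  "weight_entry base cs t j = (if t \<in> {1..sum_list cs} then weight_of (rows base cs ! (t - 1)) j else 0)"

definition base_entry :: "nat \<Rightarrow> nat list \<Rightarrow> nat \<Rightarrow> nat" where
  "base_entry base cs k = (if k \<in> {1..length cs} then multinomial base (drop k cs) else 0)"

definition count_entry :: "nat list \<Rightarrow> nat \<Rightarrow> nat" where
  "count_entry cs k = (if k \<in> {1..length cs} then cs ! (k - 1) else 0)"

text \<open>Small numbers are added and subtracted by table look-up: every arithmetic operation has to
  be one on numbers below the number of trees, which may be 1.\<close>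

definition prep :: "nat \<Rightarrow> nat multiset \<Rightarrow> tables" where
  "prep n S t i j = (
    let tc = tree_content n S; dc = degree_content n S; M = multinomial 1 tc
    in if \<not> (i \<le> n \<and> j \<le> n) then 0
       else if t = ''succ'' then min (Suc i) n
       else if t = ''pred'' then i - 1
       else if t = ''sub'' then i - j
       else if t = ''binom'' then i choose j
       else if t = ''treeW'' then weight_entry 1 tc i j
       else if t = ''treeB'' then base_entry 1 tc i
       else if t = ''treeC'' then count_entry tc i
       else if t = ''degW'' then weight_entry M dc i j
       else if t = ''degB'' then base_entry M dc i
       else if t = ''degC'' then count_entry dc i
       else 0)"

lemma sum_list_concat: "sum_list (concat xss) = sum_list (map sum_list xss)"
  for xss :: "nat list list"
  by (induction xss) auto

lemma binomial_product_choose: "a \<le> n \<Longrightarrow> binomial_product n (a choose b)"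
  unfolding binomial_product_def by (intro exI[of _ "[(a, b)]"]) simp

lemma binomial_product_le: "v \<le> n \<Longrightarrow> binomial_product n v"
  using binomial_product_choose[of v n 1] by simp

lemma binomial_product_mult:
  assumes "binomial_product n u" "binomial_product n v" shows "binomial_product n (u * v)"
proof -
  obtain ps qs where "\<forall>(a, b)\<in>set ps. a \<le> n" "u = (\<Prod>(a, b)\<leftarrow>ps. a choose b)"
    "\<forall>(a, b)\<in>set qs. a \<le> n" "v = (\<Prod>(a, b)\<leftarrow>qs. a choose b)"
    using assms unfolding binomial_product_def by auto
  then show ?thesis
    unfolding binomial_product_def by (intro exI[of _ "ps @ qs"]) auto
qed

lemma binomial_product_1: "binomial_product n 1"
  unfolding binomial_product_def by (intro exI[of _ "[]"]) simp

lemma binomial_product_multinomial: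
  assumes "sum_list cs \<le> n" "binomial_product n base"
  shows "binomial_product n (multinomial base cs)"
  using assms by (induction cs) (auto intro!: binomial_product_mult binomial_product_choose)

lemma sum_list_drop_le: "sum_list (drop k cs) \<le> sum_list (cs :: nat list)"
  by (metis append_take_drop_id le_add2 sum_list_append)

lemma binomial_product_rows:
  assumes "sum_list cs \<le> n" "binomial_product n base" "(N, l, B) \<in> set (rows base cs)"
  shows "N \<le> n" "binomial_product n B"
  using assms by (induction cs) (auto intro: binomial_product_multinomial)

lemma binomial_product_weight_entry:
  assumes "sum_list cs \<le> n" "binomial_product n base"
  shows "binomial_product n (weight_entry base cs t j)"
proof (cases "t \<in> {1..sum_list cs}")
  case True
  obtain N l B where r: "rows base cs ! (t - 1) = (N, l, B)" by (metis prod_cases3)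
  have "(N, l, B) \<in> set (rows base cs)"
    using True r nth_mem[of "t - 1" "rows base cs"] by auto
  then have "N \<le> n" "binomial_product n B" using binomial_product_rows[OF assms] by blast+
  then have "binomial_product n (((N - j) choose l) * B)"
    by (intro binomial_product_mult binomial_product_choose) auto
  then show ?thesis using True r by (simp add: weight_entry_def)
next
  case False
  then show ?thesis
    unfolding weight_entry_def if_not_P[OF False] by (intro binomial_product_le) simp
qed

lemma binomial_product_base_entry:
  assumes "sum_list cs \<le> n" "binomial_product n base"
  shows "binomial_product n (base_entry base cs k)"
  using assms sum_list_drop_le[of k cs]
  by (auto simp: base_entry_def binomial_product_le intro!: binomial_product_multinomial)

lemma count_entry_le: "count_entry cs k \<le> sum_list cs"
  by (auto simp: count_entry_def intro!: elem_le_sum_list)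

section \<open>Pruefer words and degree words of trees\<close>

definition tree_fun :: "nat \<Rightarrow> (nat \<times> nat) set \<Rightarrow> nat \<Rightarrow> nat" where
  "tree_fun n T = (\<lambda>i. if i \<in> {2..n} then parent T i else 0)"

definition tree_word :: "nat \<Rightarrow> (nat \<times> nat) set \<Rightarrow> nat list" where
  "tree_word n T = prufer_code n (n - 2) (deg T) (tree_fun n T)"

definition degree_word :: "nat \<Rightarrow> (nat \<times> nat) set \<Rightarrow> nat list" where
  "degree_word n T = map (deg T) [1..<Suc n]"

definition trees_with_degrees :: "nat \<Rightarrow> (nat \<Rightarrow> nat) \<Rightarrow> (nat \<times> nat) set set" where
  "trees_with_degrees n d = {T. rooted_tree n T \<and> deg T = d}"

lemma rooted_tree_tree_fun:
  assumes "rooted_tree n T"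
  shows "parent_map n (tree_fun n T)" "T = edges_of n (tree_fun n T)"
proof -
  obtain f where f: "parent_map n f" "T = edges_of n f"
    using rooted_tree_imp_parent_map[OF assms] .
  have eq: "\<forall>i\<in>{2..n}. f i = tree_fun n T i" by (simp add: tree_fun_def f(2) parent_edges_of)
  show "parent_map n (tree_fun n T)" using parent_map_cong[OF eq f(1)] .
  show "T = edges_of n (tree_fun n T)" by (rule trans[OF f(2) edges_of_cong[OF eq]])
qed

lemma deg_outside:
  assumes "rooted_tree n T" "i \<notin> {1..n}" shows "deg T i = 0"
proof -
  have c: "{u\<in>{2..n}. tree_fun n T u = i} = {}"
    using rooted_tree_tree_fun(1)[OF assms(1)] assms(2) unfolding parent_map_def by blast
  have i: "i \<notin> {2..n}" using assms(2) by auto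
  have "deg T i = deg (edges_of n (tree_fun n T)) i"
    by (rule arg_cong[OF rooted_tree_tree_fun(2)[OF assms(1)]])
  also have "\<dots> = 0"
    unfolding deg_edges_of[OF rooted_tree_tree_fun(1)[OF assms(1)]] c using i by simp
  finally show ?thesis .
qed

text \<open>Before any removal, the pruning invariant says that \<open>f\<close> is a rooted tree
  with degrees \<open>d\<close>.\<close>

lemma tree_degrees_iff_parent_map:
  assumes "rest n d = {2..n}" "1 \<le> n" "\<forall>v. v \<notin> {1..n} \<longrightarrow> d v = 0"
  shows "tree_degrees n d f \<longleftrightarrow> parent_map n f \<and> deg (edges_of n f) = d"
proof -
  have ins: "insert 1 {2..n} = {1..n}" using assms(2) by auto
  have "deg (edges_of n f) = d \<longleftrightarrow> (\<forall>v\<in>{2..n}. d v = Suc (card {u\<in>{2..n}. f u = v})) \<and>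
      d 1 = card {u\<in>{2..n}. f u = 1}" if pm: "parent_map n f"
  proof
    assume "deg (edges_of n f) = d"
    then show "(\<forall>v\<in>{2..n}. d v = Suc (card {u\<in>{2..n}. f u = v})) \<and> d 1 = card {u\<in>{2..n}. f u = 1}"
      using deg_edges_of[OF pm] by auto
  next
    assume r: "(\<forall>v\<in>{2..n}. d v = Suc (card {u\<in>{2..n}. f u = v})) \<and> d 1 = card {u\<in>{2..n}. f u = 1}"
    have "deg (edges_of n f) v = d v" for v
    proof (cases "v \<in> {1..n}")
      case True
      then consider "v = 1" | "v \<in> {2..n}" by force
      then show ?thesis using r deg_edges_of[OF pm, of v] by cases auto
    next
      case False
      then show ?thesis
        using assms(3) deg_outside[OF parent_map_imp_rooted_tree[OF pm assms(2)]] by simp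
    qed
    then show "deg (edges_of n f) = d" by blast
  qed
  then show ?thesis
    unfolding tree_degrees_def assms(1) ins parent_map_def[symmetric] by blast
qed

text \<open>Encoding reads only the parents of removed leaves, and these lie in 2..n.\<close>

lemma prufer_code_cong:
  assumes "tree_degrees n d f" "\<forall>v\<in>{2..n}. f v = f' v" "k \<le> card (rest n d)"
  shows "prufer_code n k d f = prufer_code n k d f'"
  using assms(1,3)
proof (induction k arbitrary: d)
  case (Suc k)
  then have "rest n d \<noteq> {}" by auto
  note x = tree_degrees_leaf[OF Suc.prems(1) this]
  note p = tree_degrees_prune[OF Suc.prems(1) x]
  have "f (leaf n d) = f' (leaf n d)" using assms(2) x(1) by (auto simp: rest_def)
  then show ?case using Suc.IH[OF p(4)] Suc.prems(2) x(1) p(3) by simp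
qed simp

text \<open>One setting for both parts: in (a), \<open>S\<close> is the multiset underlying the
  given sequence, and its tables serve there as well.\<close>

locale prepared =
  fixes n :: nat and S :: "nat multiset"
  assumes n_ge_2: "2 \<le> n" and S_range: "set_mset S \<subseteq> {1..n - 1}"
    and S_sum: "(\<Sum>i=1..n - 1. count S i * i) = 2 * n - 2" and S_size: "(\<Sum>i=1..n - 1. count S i) = n"
begin

abbreviation "tc \<equiv> tree_content n S"
abbreviation "dc \<equiv> degree_content n S"
abbreviation "M \<equiv> multinomial 1 tc"

lemma interval: "{1..n - 1} = {1..<n}" using n_ge_2 by auto

lemma sum_list_dc: "sum_list dc = n"
  using S_size unfolding degree_content_def interval by (simp add: interv_sum_list_conv_sum_set_nat)

lemma length_dc: "length dc = n - 1"
  by (simp add: degree_content_def)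

lemma length_tc: "length tc = n"
  using S_size unfolding tree_content_def interval
  by (simp add: length_concat o_def interv_sum_list_conv_sum_set_nat)

text \<open>Subtracting 1 from each of the \<open>n\<close> degrees leaves (2n - 2) - n.\<close>

lemma sum_list_tc: "sum_list tc = n - 2"
proof -
  have "sum_list tc = (\<Sum>e\<in>{1..n - 1}. count S e * (e - 1))"
    unfolding tree_content_def interval
    by (simp add: sum_list_concat o_def sum_list_replicate interv_sum_list_conv_sum_set_nat)
  moreover have "(\<Sum>e\<in>{1..n - 1}. count S e * (e - 1)) + (\<Sum>i=1..n - 1. count S i) = (\<Sum>i=1..n - 1. count S i * i)"
    unfolding sum.distrib[symmetric] by (intro sum.cong) (auto simp: algebra_simps mult_eq_if)
  ultimately show ?thesis using S_sum S_size by simp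
qed

lemma M_pos: "0 < M" by (intro multinomial_pos) simp

lemma binomial_tables_prep: "binomial_tables n (prep n S)"
proof -
  have s: "sum_list tc \<le> n" "sum_list dc \<le> n" by (simp_all add: sum_list_tc sum_list_dc)
  have M: "binomial_product n M" by (intro binomial_product_multinomial s binomial_product_1)
  have if_I: "binomial_product n (if b then u else v)" if "binomial_product n u" "binomial_product n v" for b u v
    using that by simp
  have "binomial_product n (prep n S t i j)" for t i j
  proof (cases "i \<le> n \<and> j \<le> n")
    case True
    have "binomial_product n (min (Suc i) n)" "binomial_product n (i - 1)"
      "binomial_product n (i - j)" "binomial_product n (i choose j)" "binomial_product n 0"
      "binomial_product n (count_entry tc i)" "binomial_product n (count_entry dc i)"
      using True count_entry_le[of tc i] count_entry_le[of dc i] s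
      by (auto intro: binomial_product_choose binomial_product_le)
    with True show ?thesis
      unfolding prep_def Let_def
      by (intro if_I binomial_product_weight_entry binomial_product_base_entry s M binomial_product_1)
  next
    case False
    then have "prep n S t i j = 0" by (simp add: prep_def)
    then show ?thesis by (simp add: binomial_product_le)
  qed
  then show ?thesis unfolding binomial_tables_def by (auto simp: prep_def)
qed

lemma tree_tables:
  "\<And>i j. i < length (rows 1 tc) \<Longrightarrow> j \<le> n \<Longrightarrow> prep n S ''treeW'' (Suc i) j = weight_of (rows 1 tc ! i) j"
  "\<And>k. 1 \<le> k \<Longrightarrow> k \<le> length tc \<Longrightarrow> prep n S ''treeB'' k 0 = multinomial 1 (drop k tc)"
  "\<And>k. k < length tc \<Longrightarrow> prep n S ''treeC'' (Suc k) 0 = tc ! k"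
  using sum_list_tc length_tc
  by (auto simp: prep_def Let_def weight_entry_def base_entry_def count_entry_def)

lemma degree_tables:
  "\<And>i j. i < length (rows M dc) \<Longrightarrow> j \<le> n \<Longrightarrow> prep n S ''degW'' (Suc i) j = weight_of (rows M dc ! i) j"
  "\<And>k. 1 \<le> k \<Longrightarrow> k \<le> length dc \<Longrightarrow> prep n S ''degB'' k 0 = multinomial M (drop k dc)"
  "\<And>k. k < length dc \<Longrightarrow> prep n S ''degC'' (Suc k) 0 = dc ! k"
  using sum_list_dc length_dc
  by (auto simp: prep_def Let_def weight_entry_def base_entry_def count_entry_def)

sublocale machine "prep n S" n
  by unfold_locales (use n_ge_2 in \<open>auto simp: prep_def Let_def\<close>)

definition degrees :: "(nat \<Rightarrow> nat) \<Rightarrow> bool" where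
  "degrees d \<longleftrightarrow> mset (map d [1..<Suc n]) = S \<and> (\<forall>v. v \<notin> {1..n} \<longrightarrow> d v = 0)"

lemma degrees_range: "degrees d \<Longrightarrow> v \<in> {1..n} \<Longrightarrow> d v \<in> {1..n - 1}"
proof -
  assume d: "degrees d" and v: "v \<in> {1..n}"
  have "d v \<in> set (map d [1..<Suc n])" using v by (auto simp del: upt_Suc)
  also have "set (map d [1..<Suc n]) = set_mset S"
    using d unfolding degrees_def by (metis set_mset_mset)
  finally show ?thesis using S_range by (rule subsetD[rotated])
qed

lemma degrees_rest:
  assumes "degrees d" shows "rest n d = {2..n}"
proof -
  have "0 < d v" if "v \<in> {2..n}" for v using degrees_range[OF assms, of v] that by simp
  then show ?thesis by (auto simp: rest_def)
qed

lemma set_vertex_order: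
  assumes "degrees d" shows "set (vertex_order n d) = {1..n}"
  using degrees_range[OF assms] unfolding set_order_upto interval by blast

text \<open>This is why the tables depend on the multiset alone: sorted by degree, all degree
  sequences with the same multiset have the same list of letter counts.\<close>

lemma map_vertex_order:
  assumes "degrees d" shows "map (\<lambda>v. d v - 1) (vertex_order n d) = tc"
proof -
  have c: "count S e = length (filter (\<lambda>v. d v = e) [1..<Suc n])" for e
  proof -
    have "count_list (map d xs) e = length (filter (\<lambda>v. d v = e) xs)" for xs
      by (induction xs) auto
    moreover have "S = mset (map d [1..<Suc n])" 
      using assms unfolding degrees_def by (rule conjE) (rule sym)
    ultimately show ?thesis by (simp only: count_mset)
  qed
  have "map (\<lambda>v. d v - 1) (filter (\<lambda>v. d v = e) xs) = replicate (length (filter (\<lambda>v. d v = e) xs)) (e - 1)" for e xs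
    by (induction xs) auto
  then show ?thesis
    unfolding order_upto_def tree_content_def map_concat map_map o_def c by simp
qed

lemma length_vertex_order: "degrees d \<Longrightarrow> length (vertex_order n d) = n"
  using arg_cong[OF map_vertex_order, of d length] length_tc by simp

abbreviation "tree_words d \<equiv> words (vertex_order n d) (\<lambda>v. d v - 1)"

lemma tree_words_length:
  assumes "degrees d" "w \<in> tree_words d" shows "length w = n - 2"
  using words_length[OF assms(2) distinct_order_upto]
  unfolding map_vertex_order[OF assms(1)] sum_list_tc .

text \<open>The root has no parent edge and so occurs in the full code as often as its degree says.
  Splitting off the final 1 brings it in line with the other vertices, which occur one time
  less.\<close>

lemma word_degrees_iff:
  assumes d: "degrees d"
  shows "word_degrees n d (w @ [1]) \<longleftrightarrow> w \<in> tree_words d"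
proof
  have ins: "insert 1 {2..n} = {1..n}" using n_ge_2 by auto
  {
    assume wd: "word_degrees n d (w @ [1])"
    have "count_list w v = d v - 1" if "v \<in> {1..n}" for v
      using wd that n_ge_2 unfolding word_degrees_def degrees_rest[OF d]
      by (cases "v = 1") auto
    moreover have "set w \<subseteq> {1..n}"
      using wd unfolding word_degrees_def degrees_rest[OF d] ins by simp
    ultimately show "w \<in> tree_words d" unfolding words_def set_vertex_order[OF d] by blast
  }
  {
    assume w: "w \<in> tree_words d"
    have c: "d v = Suc (count_list w v)" if "v \<in> {1..n}" for v
      using w degrees_range[OF d that] that unfolding words_def set_vertex_order[OF d] by auto
    have "set w \<subseteq> {1..n}" using w unfolding words_def set_vertex_order[OF d] by blast
    then show "word_degrees n d (w @ [1])"
      unfolding word_degrees_def degrees_rest[OF d] ins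
      using tree_words_length[OF d w] c n_ge_2 by auto
  }
qed

lemma tree_degrees_tree_fun:
  assumes "T \<in> trees_with_degrees n d" "degrees d"
  shows "tree_degrees n d (tree_fun n T)"
  using rooted_tree_tree_fun[of n T] assms tree_degrees_iff_parent_map[OF degrees_rest[OF assms(2)]] n_ge_2
  by (auto simp: trees_with_degrees_def degrees_def)

lemma prufer_code_tree_word:
  assumes "tree_degrees n d f" "degrees d"
  shows "prufer_code n (n - 1) d f = prufer_code n (n - 2) d f @ [1]"
proof -
  let ?w = "prufer_code n (n - 1) d f"
  have wd: "word_degrees n d ?w"
    using assms degrees_rest by (intro prufer_code_correct) auto
  have "length ?w \<noteq> 0" using n_ge_2 by simp
  then have ne: "?w \<noteq> []" by (metis list.size(3))
  have "last ?w = 1" using wd ne unfolding word_degrees_def by blast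
  moreover have "butlast ?w = prufer_code n (n - 2) d f"
    using prufer_code_take[of "n - 2" "n - 1" n d f] by (simp add: butlast_conv_take numeral_2_eq_2)
  ultimately show ?thesis using append_butlast_last_id[OF ne] by simp
qed

lemma tree_word_in:
  assumes "T \<in> trees_with_degrees n d" "degrees d"
  shows "tree_word n T \<in> tree_words d"
proof -
  have d: "deg T = d" using assms by (simp add: trees_with_degrees_def)
  have "word_degrees n d (prufer_code n (n - 1) d (tree_fun n T))"
    using tree_degrees_tree_fun[OF assms] degrees_rest[OF assms(2)] by (intro prufer_code_correct) auto
  then show ?thesis
    unfolding prufer_code_tree_word[OF tree_degrees_tree_fun[OF assms] assms(2)] word_degrees_iff[OF assms(2)]
    by (simp add: tree_word_def d)
qed

lemma tree_word_inj:
  assumes "T \<in> trees_with_degrees n d" "T' \<in> trees_with_degrees n d" "degrees d"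
    "tree_word n T = tree_word n T'"
  shows "T = T'"
proof -
  have d: "deg T = d" "deg T' = d" using assms by (simp_all add: trees_with_degrees_def)
  note t = tree_degrees_tree_fun[OF assms(1,3)] tree_degrees_tree_fun[OF assms(2,3)]
  have e: "prufer_code n (n - 1) d (tree_fun n T) = prufer_code n (n - 1) d (tree_fun n T')"
    unfolding prufer_code_tree_word[OF t(1) assms(3)] prufer_code_tree_word[OF t(2) assms(3)]
    using assms(4) d by (simp add: tree_word_def)
  have c: "card (rest n d) = n - 1" using degrees_rest[OF assms(3)] by simp
  have "\<forall>i\<in>{2..n}. tree_fun n T i = tree_fun n T' i"
    using prufer_code_correct(2)[OF t(1) c, of "\<lambda>_. 0"] prufer_code_correct(2)[OF t(2) c, of "\<lambda>_. 0"] e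
      degrees_rest[OF assms(3)] by (metis (mono_tags, lifting))
  then show ?thesis
    using rooted_tree_tree_fun(2)[of n T] rooted_tree_tree_fun(2)[of n T'] edges_of_cong assms
    by (metis (no_types, lifting) mem_Collect_eq trees_with_degrees_def)
qed

lemma decoded_tree:
  fixes g :: "nat \<Rightarrow> nat"
  assumes "w \<in> tree_words d" "degrees d"
  defines "T \<equiv> edges_of n (prufer_tree n d (w @ [1]) g)"
  shows "T \<in> trees_with_degrees n d" "tree_word n T = w"
proof -
  let ?f = "prufer_tree n d (w @ [1]) g"
  have wd: "word_degrees n d (w @ [1])" using word_degrees_iff assms by blast
  note f = prufer_tree_correct[OF wd, of g]
  have pm: "parent_map n ?f" "deg T = d"
    using f(1) tree_degrees_iff_parent_map[OF degrees_rest[OF assms(2)], of ?f] assms(2) n_ge_2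
    by (auto simp: degrees_def T_def)
  then show T: "T \<in> trees_with_degrees n d"
    using parent_map_imp_rooted_tree[OF pm(1)] n_ge_2 by (simp add: trees_with_degrees_def T_def)
  have "\<forall>i\<in>{2..n}. ?f i = tree_fun n T i" by (simp add: tree_fun_def T_def parent_edges_of)
  then have "prufer_code n (n - 2) d ?f = tree_word n T"
    unfolding tree_word_def pm(2) using f(1) degrees_rest[OF assms(2)] by (intro prufer_code_cong) auto
  moreover have l: "length (w @ [1]) = n - 1"
    using tree_words_length[OF assms(2,1)] n_ge_2 by simp
  have "prufer_code n (n - 1) d ?f = w @ [1]"
    using f(2) unfolding l .
  with calculation show "tree_word n T = w"
    using prufer_code_tree_word[OF f(1) assms(2)] by simp
qed

definition tree_rank :: "(nat \<times> nat) set \<Rightarrow> nat" where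
  "tree_rank T = word_rank 1 tc (word_positions (vertex_order n (deg T)) (tree_word n T))"

lemma tree_rank_eq:
  assumes "T \<in> trees_with_degrees n d" "degrees d"
  shows "tree_rank T = word_rank 1 (map (\<lambda>v. d v - 1) (vertex_order n d)) (word_positions (vertex_order n d) (tree_word n T))"
  using assms map_vertex_order by (simp add: tree_rank_def trees_with_degrees_def)

lemma tree_rank_less:
  assumes "T \<in> trees_with_degrees n d" "degrees d" shows "tree_rank T < M"
  using word_rank_less[OF tree_word_in[OF assms] distinct_order_upto, of 0 1]
  unfolding tree_rank_eq[OF assms] map_vertex_order[OF assms(2)] by simp

lemma tree_rank_inj:
  assumes "T \<in> trees_with_degrees n d" "T' \<in> trees_with_degrees n d" "degrees d" "tree_rank T = tree_rank T'"
  shows "T = T'"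
proof (rule tree_word_inj[OF assms(1-3)])
  show "tree_word n T = tree_word n T'"
    using word_rank_inj[OF tree_word_in[OF assms(1,3)] tree_word_in[OF assms(2,3)] distinct_order_upto, of 0 1 0]
      assms(4) unfolding tree_rank_eq[OF assms(1,3)] tree_rank_eq[OF assms(2,3)] by simp
qed

definition unrank_word :: "(nat \<Rightarrow> nat) \<Rightarrow> nat \<Rightarrow> nat list" where
  "unrank_word d m = word_of_digits (vertex_order n d) tc (digits 1 tc m)"

lemma unrank_word:
  assumes "m < M" "degrees d"
  shows "unrank_word d m \<in> tree_words d"
    "edges_of n (prufer_tree n d (unrank_word d m @ [1]) g) \<in> trees_with_degrees n d"
    "tree_rank (edges_of n (prufer_tree n d (unrank_word d m @ [1]) g)) = m"
proof -
  note u = word_of_digits_correct[OF distinct_order_upto zero_less_one,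
      of m "\<lambda>v. d v - 1" n d n, unfolded map_vertex_order[OF assms(2)], OF assms(1), folded unrank_word_def]
  note t = decoded_tree[OF u(1) assms(2)]
  show "unrank_word d m \<in> tree_words d" by (rule u(1))
  show "edges_of n (prufer_tree n d (unrank_word d m @ [1]) g) \<in> trees_with_degrees n d" by (rule t(1))
  show "tree_rank (edges_of n (prufer_tree n d (unrank_word d m @ [1]) g)) = m"
    using u(2,3) unfolding tree_rank_eq[OF t(1) assms(2)] t(2) map_vertex_order[OF assms(2)] by simp
qed

text \<open>In particular the number of trees is \<open>M\<close> for every degree sequence with
  this multiset, which makes \<open>M\<close> a uniform base for the degree words in (b).\<close>

lemma tree_rank_bij:
  assumes "degrees d" shows "bij_betw tree_rank (trees_with_degrees n d) {0..<M}"
  unfolding bij_betw_def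
proof
  show "inj_on tree_rank (trees_with_degrees n d)"
    using tree_rank_inj assms by (blast intro: inj_onI)
  show "tree_rank ` trees_with_degrees n d = {0..<M}"
  proof (intro equalityI subsetI)
    show "m \<in> {0..<M}" if "m \<in> tree_rank ` trees_with_degrees n d" for m
      using that tree_rank_less assms by auto
    show "m \<in> tree_rank ` trees_with_degrees n d" if "m \<in> {0..<M}" for m
      using that unrank_word(2,3)[of m d "\<lambda>_. 0"] assms by (metis atLeastLessThan_iff imageI)
  qed
qed

section \<open>Ranks of trees with a prescribed multiset of degrees\<close>

definition full_rank :: "(nat \<times> nat) set \<Rightarrow> nat" where
  "full_rank T = word_rank M dc (word_positions [1..<n] (degree_word n T)) + tree_rank T"

lemma words_iff_mset: "w \<in> words [1..<n] (count S) \<longleftrightarrow> mset w = S"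
proof
  assume w: "w \<in> words [1..<n] (count S)"
  have "count (mset w) v = count S v" for v
  proof (cases "v \<in> {1..<n}")
    case True
    then show ?thesis using w by (simp add: words_def count_mset)
  next
    case False
    then have "v \<notin> set w" "v \<notin># S" using w S_range interval by (auto simp: words_def)
    then show ?thesis by (simp add: count_mset not_in_iff count_list_0_iff)
  qed
  then show "mset w = S" by (intro multiset_eqI)
next
  assume "mset w = S"
  then show "w \<in> words [1..<n] (count S)"
    using S_range interval by (auto simp: words_def count_mset[symmetric])
qed

lemma trees_with_degree_multiset_iff:
  "T \<in> trees_with_degree_multiset n S \<longleftrightarrow> T \<in> trees_with_degrees n (deg T) \<and> degrees (deg T)"
proof -
  have "mset_set {1..n} = mset [1..<Suc n]" by (simp add: atLeastLessThanSuc_atLeastAtMost del: upt_Suc)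
  then have "image_mset (deg T) (mset_set {1..n}) = mset (map (deg T) [1..<Suc n])" by (simp only: mset_map)
  then show ?thesis
    using deg_outside unfolding trees_with_degree_multiset_def trees_with_degrees_def degrees_def by auto
qed

lemma degree_word_in: "degrees (deg T) \<Longrightarrow> degree_word n T \<in> words [1..<n] (count S)"
  unfolding words_iff_mset degrees_def degree_word_def by blast

text \<open>Zero outside 1..n, in agreement with \<open>deg_outside\<close>, so that degrees can be
  compared as functions.\<close>

definition word_fun :: "nat list \<Rightarrow> nat \<Rightarrow> nat" where
  "word_fun w = (\<lambda>v. if v \<in> {1..n} then w ! (v - 1) else 0)"

lemma map_word_fun: "length w = n \<Longrightarrow> map (word_fun w) [1..<Suc n] = w"
  by (intro nth_equalityI) (auto simp: word_fun_def simp del: upt_Suc)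

lemma degrees_word_fun:
  assumes "w \<in> words [1..<n] (count S)" shows "degrees (word_fun w)"
proof -
  have "length w = n" using words_length[OF assms] sum_list_dc by (simp add: degree_content_def)
  then show ?thesis using map_word_fun assms words_iff_mset by (auto simp: degrees_def word_fun_def)
qed

lemma full_rank_less:
  assumes "T \<in> trees_with_degree_multiset n S" shows "full_rank T < multinomial M dc"
proof -
  note t = assms[unfolded trees_with_degree_multiset_iff]
  show ?thesis
    unfolding full_rank_def degree_content_def
    using t tree_rank_less[of T "deg T"] by (intro word_rank_less degree_word_in) auto
qed

lemma full_rank_inj:
  assumes "T \<in> trees_with_degree_multiset n S" "T' \<in> trees_with_degree_multiset n S" "full_rank T = full_rank T'"
  shows "T = T'"
proof -
  note t = assms(1)[unfolded trees_with_degree_multiset_iff] assms(2)[unfolded trees_with_degree_multiset_iff]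
  have "degree_word n T = degree_word n T' \<and> tree_rank T = tree_rank T'"
  proof (rule word_rank_inj[of _ "[1..<n]" "count S" _ _ M])
    show "degree_word n T \<in> words [1..<n] (count S)" "degree_word n T' \<in> words [1..<n] (count S)"
      using t by (blast intro: degree_word_in)+
    show "tree_rank T < M" "tree_rank T' < M" using t tree_rank_less by blast+
  qed (use assms(3) in \<open>simp_all only: full_rank_def degree_content_def distinct_upt\<close>)
  then have r: "tree_rank T = tree_rank T'" and w: "map (deg T) [1..<Suc n] = map (deg T') [1..<Suc n]"
    unfolding degree_word_def by blast+
  from w have eq: "\<forall>v\<in>set [1..<Suc n]. deg T v = deg T' v" unfolding map_eq_conv .
  have "deg T v = deg T' v" for v
  proof (cases "v \<in> {1..n}")
    case True
    then show ?thesis using eq[rule_format, of v] by (simp del: upt_Suc)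
  next
    case False
    then show ?thesis using t by (simp add: degrees_def)
  qed
  then have "deg T = deg T'" by blast
  then show ?thesis using t tree_rank_inj[of T "deg T" T'] r by simp
qed

lemma full_unrank:
  fixes g :: "nat \<Rightarrow> nat"
  assumes "m < multinomial M dc"
  defines "w \<equiv> word_of_digits [1..<n] dc (digits M dc m)" and "r \<equiv> remainder M dc m"
  defines "d \<equiv> word_fun w"
  defines "T \<equiv> edges_of n (prufer_tree n d (unrank_word d r @ [1]) g)"
  shows "w \<in> words [1..<n] (count S)" "r < M" "degrees d" "T \<in> trees_with_degree_multiset n S" "full_rank T = m"
proof -
  note u = word_of_digits_correct[where os = "[1..<n]" and c = "count S" and base = M and m = m,
      folded degree_content_def, OF distinct_upt M_pos assms(1), folded w_def r_def]
  show w: "w \<in> words [1..<n] (count S)" "r < M" by (rule u)+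
  show d: "degrees d" unfolding d_def by (rule degrees_word_fun[OF w(1)])
  note t = unrank_word(2,3)[OF w(2) d, where g = g, folded T_def]
  have dT: "deg T = d" using t(1) by (simp add: trees_with_degrees_def)
  show "T \<in> trees_with_degree_multiset n S" using t(1) d dT by (simp add: trees_with_degree_multiset_iff)
  have "length w = n" using words_length[OF w(1)] sum_list_dc by (simp add: degree_content_def)
  then have "degree_word n T = w" unfolding degree_word_def dT d_def by (rule map_word_fun)
  then show "full_rank T = m" using u(3) t(2) by (simp add: full_rank_def)
qed

lemma full_rank_bij: "bij_betw full_rank (trees_with_degree_multiset n S) {0..<multinomial M dc}"
  unfolding bij_betw_def
proof
  show "inj_on full_rank (trees_with_degree_multiset n S)"
    using full_rank_inj by (blast intro: inj_onI)
  show "full_rank ` trees_with_degree_multiset n S = {0..<multinomial M dc}"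
  proof (intro equalityI subsetI)
    show "m \<in> {0..<multinomial M dc}" if "m \<in> full_rank ` trees_with_degree_multiset n S" for m
      using that full_rank_less by auto
    show "m \<in> full_rank ` trees_with_degree_multiset n S" if "m \<in> {0..<multinomial M dc}" for m
      using that full_unrank(4,5)[of m] by (metis atLeastLessThan_iff imageI)
  qed
qed

text \<open>The Pruefer word and the degree word contribute a factor of at most \<open>n ^ n\<close>
  each, so all ranks have at most 2n times the length of \<open>n\<close> in bits.\<close>

lemma multinomial_le_power: "M \<le> n ^ (2 * n)" "multinomial M dc \<le> n ^ (2 * n)"
proof -
  have "M \<le> n ^ (n - 2)" using multinomial_le[of tc n 1] by (simp add: sum_list_tc)
  also have "\<dots> \<le> n ^ n" using n_ge_2 by (intro power_increasing) auto
  finally have M: "M \<le> n ^ n" .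
  also have "\<dots> \<le> n ^ (2 * n)" using n_ge_2 by (intro power_increasing) auto
  finally show "M \<le> n ^ (2 * n)" .
  have "multinomial M dc \<le> n ^ n * M" using multinomial_le[of dc n M] by (simp add: sum_list_dc)
  also have "\<dots> \<le> n ^ n * n ^ n" using M by (intro mult_le_mono2)
  finally show "multinomial M dc \<le> n ^ (2 * n)" by (simp add: mult_2 power_add)
qed

end

section \<open>Ranking and unranking\<close>

definition tree_positions_alg :: com where
  "tree_positions_alg = encode_alg ;; order_alg ;; Assign ''N'' (Reg ''n2'') ;;
     positions_alg ''tpos'' ''n''"

definition place_tree_alg :: com where
  "place_tree_alg = order_alg ;; digits_alg ''treeB'' ''n'' ;; Assign ''N'' (Reg ''n2'') ;;
     place_alg ''treeC'' ''n'' ;; decode_alg"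

definition sequence_positions_alg :: com where
  "sequence_positions_alg = sizes_alg ;; tree_positions_alg"

definition multiset_positions_alg :: com where
  "multiset_positions_alg = sizes_alg ;; degree_alg ;; identity_alg ''o'' ''n1'' ;;
     copy_alg ''w'' ''s'' ''n'' ;; Assign ''N'' (Reg ''n'') ;; positions_alg ''dpos'' ''n1'' ;;
     tree_positions_alg"

definition sequence_sum_alg :: com where
  "sequence_sum_alg = sum_alg ''treeW'' ''tpos'' ''n2''"

definition multiset_sum_alg :: com where
  "multiset_sum_alg = sum_alg ''degW'' ''dpos'' ''n'' ;; sum_alg ''treeW'' ''tpos'' ''n2''"

definition sequence_unrank_alg :: com where
  "sequence_unrank_alg = sizes_alg ;; place_tree_alg"

definition multiset_unrank_alg :: com where
  "multiset_unrank_alg = sizes_alg ;; identity_alg ''o'' ''n1'' ;; digits_alg ''degB'' ''n1'' ;;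
     Assign ''N'' (Reg ''n'') ;; place_alg ''degC'' ''n1'' ;; copy_alg ''s'' ''w'' ''n'' ;;
     place_tree_alg"

lemmas alg_defs = leaf_search_def prune_alg_def copy_alg_def sizes_alg_def encode_alg_def
  decode_alg_def push_alg_def order_alg_def position_step_def positions_alg_def sum_alg_def
  digits_alg_def place_step_def identity_alg_def place_alg_def degree_alg_def
  tree_positions_alg_def place_tree_alg_def sequence_positions_alg_def multiset_positions_alg_def
  sequence_sum_alg_def multiset_sum_alg_def sequence_unrank_alg_def multiset_unrank_alg_def

section \<open>Step counts\<close>

lemma steps_components:
  "steps n sizes_alg = 8" "steps n (copy_alg a b m) = 3 + 6 * n" "steps n (identity_alg a m) = 3 + 5 * n"
  "steps n leaf_search = 3 + 8 * n" "steps n prune_alg = 11" "steps n (push_alg a i (Reg x)) = 7"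
  "steps n (push_alg a i (Elem x (Reg y))) = 8" "steps n degree_alg = 9 + 15 * n"
  "steps n (position_step a) = 7 + 22 * n" "steps n (place_step C) = 14 + 32 * n"
  "steps n (sum_alg W a m) = 3 + 9 * n" "steps n (digits_alg B m) = 3 + 21 * n"
  by (simp_all add: alg_defs)

lemma steps_nested:
  "steps n encode_alg = 6 + 26 * n + 8 * (n * n)" "steps n decode_alg = 9 + 26 * n + 8 * (n * n)"
  "steps n order_alg = 5 + 5 * n + 13 * (n * n)" "steps n (positions_alg a m) = 5 + 9 * n + 22 * (n * n)"
  by (simp_all add: encode_alg_def decode_alg_def order_alg_def positions_alg_def steps_components
    distrib_left)

text \<open>200 and 50 are round numbers. Lower order terms are absorbed by
  \<open>2 * n \<le> n * n\<close> and \<open>4 \<le> n * n\<close>, valid from n = 2 on.\<close>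

lemma steps_positions:
  assumes "2 \<le> n"
  shows "steps n sequence_positions_alg \<le> 200 * (n * n)" "steps n multiset_positions_alg \<le> 200 * (n * n)"
    "steps n sequence_sum_alg \<le> 50 * n" "steps n multiset_sum_alg \<le> 50 * n"
proof -
  have n: "2 * n \<le> n * n" "4 \<le> n * n"
    using mult_le_mono[OF assms le_refl[of n]] mult_le_mono[OF assms assms] by simp_all
  have "steps n sequence_positions_alg = 26 + 40 * n + 43 * (n * n)"
    "steps n multiset_positions_alg = 48 + 75 * n + 65 * (n * n)"
    "steps n sequence_sum_alg = 3 + 9 * n" "steps n multiset_sum_alg = 6 + 18 * n"
    by (simp_all add: sequence_positions_alg_def multiset_positions_alg_def tree_positions_alg_def
        sequence_sum_alg_def multiset_sum_alg_def steps_components steps_nested)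
  then show "steps n sequence_positions_alg \<le> 200 * (n * n)" "steps n multiset_positions_alg \<le> 200 * (n * n)"
    "steps n sequence_sum_alg \<le> 50 * n" "steps n multiset_sum_alg \<le> 50 * n"
    using n assms by linarith+
qed

section \<open>From step counts to the complexity bounds\<close>

context machine
begin

text \<open>\<open>A\<close> contributes O(n^2) events of O(log n) bits and no number operation,
  \<open>B\<close> contributes O(n) events of O(n log n) bits; either part amounts to O(n^2 log n)
  bits.\<close>

lemma rank_certificate:
  assumes wp: "wp tb n (small n) (\<lambda>_. 0) A \<sigma> (\<lambda>\<sigma>1 _. wp tb n (fits X) (\<lambda>_. 0) B \<sigma>1 (\<lambda>\<sigma>' _. reg \<sigma>' ''rank'' = R))"
    and run: "run tb (A ;; B) \<sigma> = (\<sigma>', tr)" and X: "X \<le> n ^ (2 * n)"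
    and st: "steps n A \<le> 200 * (n * n)" "steps n B \<le> 50 * n"
  shows "reg \<sigma>' ''rank'' = R" "real (length (filter (small_comparison n) tr)) \<le> 10000 * real n ^ 2"
    "real (length (filter (number_operation n) tr)) \<le> 10000 * real n"
    "\<forall>e\<in>set tr. number_operation n e \<longrightarrow> (\<forall>x\<in>numbers e. x < X)"
    "real (bit_operations tr) \<le> 10000 * (real n ^ 2 * log 2 (real n))"
proof -
  obtain \<sigma>1 tr1 where 1: "run tb A \<sigma> = (\<sigma>1, tr1)" by fastforce
  obtain tr2 where 2: "run tb B \<sigma>1 = (\<sigma>', tr2)" "tr = tr1 @ tr2"
    using run 1 by (auto split: prod.splits)
  have s: "\<forall>e\<in>set tr1. small n e" "length tr1 \<le> steps n A"
    and f: "\<forall>e\<in>set tr2. fits X e" "length tr2 \<le> steps n B" and R: "reg \<sigma>' ''rank'' = R"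
    using wp 1 2 unfolding wp_def by blast+
  show "reg \<sigma>' ''rank'' = R" by (rule R)
  have no: "\<not> number_operation n e" if "small n e" for e using that by (cases e) auto
  have "filter (number_operation n) tr1 = []" using s no by (auto simp: filter_empty_conv)
  then have "length (filter (number_operation n) tr) \<le> steps n B"
    using 2 f(2) by (auto intro: order.trans[OF length_filter_le])
  then have "length (filter (number_operation n) tr) \<le> 50 * n" using st by linarith
  then show "real (length (filter (number_operation n) tr)) \<le> 10000 * real n" by linarith
  show "\<forall>e\<in>set tr. number_operation n e \<longrightarrow> (\<forall>x\<in>numbers e. x < X)"
    using s f no 2 unfolding fits_def by auto
  have nn: "n \<le> n * n" using n2 by simp
  have "length (filter (small_comparison n) tr) \<le> length tr" by (rule length_filter_le)
  also have "\<dots> \<le> 200 * (n * n) + 50 * n" using 2 s f st by simp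
  also have "\<dots> \<le> 250 * (n * n)" using nn by simp
  finally have "real (length (filter (small_comparison n) tr)) \<le> real (250 * (n * n))" by (rule of_nat_mono)
  also have "real (250 * (n * n)) \<le> 10000 * real n ^ 2" by (simp add: power2_eq_square)
  finally show "real (length (filter (small_comparison n) tr)) \<le> 10000 * real n ^ 2" .
  let ?L = "bit_length n"
  have sb: "event_bits e \<le> 3 * ?L" if "small n e" for e
    using that by (intro event_bits_le) (auto simp: small_def)
  \<comment> \<open>Three numbers of at most \<open>2 * n * ?L\<close> bits each.\<close>
  have fb: "event_bits e \<le> 6 * n * ?L" if "fits X e" for e
  proof (cases "small n e")
    case True
    have "3 * ?L \<le> 6 * n * ?L" using n2 by simp
    then show ?thesis using sb[OF True] by linarith
  next
    case False
    then have "\<forall>x\<in>numbers e. x \<le> n ^ (2 * n)" using that X unfolding fits_def by fastforce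
    then have "event_bits e \<le> 3 * bit_length (n ^ (2 * n))" by (rule event_bits_le)
    also have "\<dots> \<le> 3 * (2 * n * ?L)" using n2 by (intro mult_le_mono2 bit_length_power) auto
    finally show ?thesis by simp
  qed
  have sum_le: "sum_list (map event_bits t) \<le> k * length t" if "\<forall>e\<in>set t. event_bits e \<le> k" for t k
    using that by (induction t) auto
  have "bit_operations tr \<le> 3 * ?L * length tr1 + 6 * n * ?L * length tr2"
    unfolding bit_operations_def 2(2) using sum_le[of tr1 "3 * ?L"] sum_le[of tr2 "6 * n * ?L"] s f sb fb
    by (simp add: add_mono)
  also have "\<dots> \<le> 3 * ?L * (200 * (n * n)) + 6 * n * ?L * (50 * n)"
    using s f st by (intro add_mono mult_le_mono2) auto
  also have "\<dots> = 900 * (n * n) * ?L" by (simp add: algebra_simps)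
  finally have "real (bit_operations tr) \<le> real (900 * (n * n) * ?L)" by (rule of_nat_mono)
  also have "\<dots> = 900 * real n ^ 2 * real ?L" by (simp add: power2_eq_square)
  also have "\<dots> \<le> 900 * real n ^ 2 * (2 * log 2 (real n))"
    using bit_length_le_log[OF n2] by (intro mult_left_mono) auto
  also have "\<dots> = 1800 * (real n ^ 2 * log 2 (real n))" by simp
  also have "\<dots> \<le> 10000 * (real n ^ 2 * log 2 (real n))"
    using n2 by (intro mult_right_mono) auto
  finally show "real (bit_operations tr) \<le> 10000 * (real n ^ 2 * log 2 (real n))" .
qed

lemma wp_small_bits:
  assumes "wp tb n (small n) (\<lambda>_. 0) c \<sigma> Q"
    "\<And>\<sigma>' b. agree c \<sigma> \<sigma>' \<Longrightarrow> Q \<sigma>' 0 \<Longrightarrow> b \<le> bit_length n * (3 * steps n c) \<Longrightarrow> Q' \<sigma>' b"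
  shows "wp tb n (\<lambda>_. True) event_bits c \<sigma> Q'"
proof (rule wp_charge[OF assms(1), of _ _ "3 * bit_length n"])
  show "True \<and> event_bits e \<le> 3 * bit_length n" if "small n e" for e
    using that event_bits_le[of e n] by (auto simp: small_def)
qed (use assms(2) in \<open>auto simp: mult_ac\<close>)

lemma wp_bounded_bits:
  assumes "wp tb n (bounded (n ^ (2 * n))) (\<lambda>_. 0) c \<sigma> Q"
    "\<And>\<sigma>' b. agree c \<sigma> \<sigma>' \<Longrightarrow> Q \<sigma>' 0 \<Longrightarrow> b \<le> bit_length n * (6 * n * steps n c) \<Longrightarrow> Q' \<sigma>' b"
  shows "wp tb n (\<lambda>_. True) event_bits c \<sigma> Q'"
proof (rule wp_charge[OF assms(1), of _ _ "6 * n * bit_length n"])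
  show "True \<and> event_bits e \<le> 6 * n * bit_length n" if "bounded (n ^ (2 * n)) e" for e
    using that event_bits_le[of e "n ^ (2 * n)"] bit_length_power[of "2 * n" n] n2
    by (auto simp: bounded_def)
qed (use assms(2) in \<open>auto simp: mult_ac\<close>)

definition place_cost :: "string \<Rightarrow> nat" where
  "place_cost C = 3 * steps n (identity_alg ''F'' ''N'') + 9 + 6 * n + 6 * n * steps n (place_step C)"

text \<open>The factor 2 of \<open>bit_length_le_log\<close> turns 3000 into 6000, still below
  10000.\<close>

lemma unrank_cost:
  assumes "b \<le> bit_length n * c" "c \<le> 3000 * (n * n)"
  shows "real b \<le> 10000 * (real n ^ 2 * log 2 (real n))"
proof -
  have "b \<le> bit_length n * (3000 * (n * n))" using assms by (meson le_trans mult_le_mono2)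
  then have "real b \<le> real (bit_length n * (3000 * (n * n)))" by (rule of_nat_mono)
  also have "\<dots> = 3000 * real n ^ 2 * real (bit_length n)" by (simp add: power2_eq_square)
  also have "\<dots> \<le> 3000 * real n ^ 2 * (2 * log 2 (real n))"
    using bit_length_le_log[OF n2] by (intro mult_left_mono) auto
  also have "\<dots> = 6000 * (real n ^ 2 * log 2 (real n))" by simp
  also have "\<dots> \<le> 10000 * (real n ^ 2 * log 2 (real n))"
    using n2 by (intro mult_right_mono) auto
  finally show ?thesis .
qed

definition tree_cost :: nat where
  "tree_cost = 3 * steps n order_alg + 6 * n * steps n (digits_alg ''treeB'' ''n'') + 6 + place_cost ''treeC'' +
     3 * steps n decode_alg"

definition full_cost :: nat where
  "full_cost = 3 * steps n sizes_alg + 3 * steps n (identity_alg ''o'' ''n1'') +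
     6 * n * steps n (digits_alg ''degB'' ''n1'') + 6 + place_cost ''degC'' +
     3 * steps n (copy_alg ''s'' ''w'' ''n'') + tree_cost"

lemma full_cost_le: "full_cost \<le> 3000 * (n * n)"
proof -
  have n: "2 * n \<le> n * n" "4 \<le> n * n"
    using mult_le_mono[OF n2 le_refl[of n]] mult_le_mono[OF n2 n2] by simp_all
  have "full_cost = 132 + 372 * n + 699 * (n * n)"
    by (simp add: full_cost_def tree_cost_def place_cost_def steps_components steps_nested distrib_left)
  then show ?thesis using n by linarith
qed

end

section \<open>Correctness of the complete programs\<close>

context prepared
begin

lemma wp_tree_positions:
  assumes r: "reg \<sigma> ''n'' = n" "reg \<sigma> ''n1'' = n - 1" "reg \<sigma> ''n2'' = n - 2"
    and T: "T \<in> trees_with_degrees n d" "degrees d"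
    and a: "arr \<sigma> ''s'' = d" "arr \<sigma> ''tree'' = tree_fun n T" "\<forall>v. v \<notin> {1..n} \<longrightarrow> arr \<sigma> ''d'' v = 0"
  shows "wp (prep n S) n (small n) \<mu> tree_positions_alg \<sigma> (\<lambda>\<sigma>' _.
    slice (arr \<sigma>' ''tpos'') (n - 2) = word_positions (vertex_order n d) (tree_word n T))"
proof -
  let ?w = "tree_word n T" let ?o = "vertex_order n d"
  have d: "deg T = d" using T by (simp add: trees_with_degrees_def)
  have dn: "d v \<le> n" if "v \<in> {1..n}" for v using degrees_range[OF T(2) that] unfolding atLeastAtMost_iff by linarith
  note w = tree_word_in[OF T]
  have lw: "length ?w = n - 2" using tree_words_length[OF T(2) w] .
  have lo: "length ?o = n" using length_vertex_order[OF T(2)] .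
  have so: "set ?o = {1..n}" using set_vertex_order[OF T(2)] .
  have sw: "set ?w \<subseteq> {..n}" using w so unfolding words_def by auto
  have lp: "length (word_positions ?o ?w) = n - 2" using length_word_positions[OF w distinct_order_upto] lw by simp
  show ?thesis
    unfolding tree_positions_alg_def
  proof (rule wp_Seq, rule wp_conseq[OF wp_encode_alg], goal_cases)
    case (6 \<sigma>1 b1)
    have s1: "slice (arr \<sigma>1 ''w'') (n - 2) = ?w"
      using 6(2) n2 unfolding a tree_word_def d by (simp add: slice_def Suc_diff_Suc numeral_2_eq_2)
    have f1: "reg \<sigma>1 ''n'' = n" "reg \<sigma>1 ''n1'' = n - 1" "reg \<sigma>1 ''n2'' = n - 2" "arr \<sigma>1 ''s'' = d"
      using 6(1) r a by (auto simp: agree_def alg_defs)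
    show ?case
    proof (rule wp_Seq, rule wp_conseq[OF wp_order_alg], goal_cases)
      case (4 \<sigma>2 b2)
      have s2: "slice (arr \<sigma>2 ''o'') n = ?o" using 4(2) f1 lo by simp
      have f2: "reg \<sigma>2 ''n'' = n" "reg \<sigma>2 ''n2'' = n - 2" "arr \<sigma>2 ''w'' = arr \<sigma>1 ''w''"
        using 4(1) f1 by (auto simp: agree_def alg_defs)
      show ?case
      proof (rule wp_Seq, rule wp_Assign, goal_cases)
        case (2 b3)
        show ?case
          by (rule wp_conseq[OF wp_positions_alg[where ws = ?w and os = ?o]])
            (use s1 s2 f2 lw lo sw so lp in auto)
      qed (use f2 in auto)
    qed (use f1 dn in auto)
  qed (use r a T dn tree_degrees_tree_fun[OF T] degrees_rest[OF T(2)] in \<open>auto simp: degrees_def\<close>)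
qed

lemma wp_tree_sum:
  assumes r: "reg \<sigma> ''n2'' = n - 2" and T: "T \<in> trees_with_degrees n d" "degrees d"
    and p: "slice (arr \<sigma> ''tpos'') (n - 2) = word_positions (vertex_order n d) (tree_word n T)"
    and X: "reg \<sigma> ''rank'' + tree_rank T < X"
  shows "wp (prep n S) n (fits X) \<mu> (sum_alg ''treeW'' ''tpos'' ''n2'') \<sigma> (\<lambda>\<sigma>' _.
    reg \<sigma>' ''rank'' = reg \<sigma> ''rank'' + tree_rank T)"
proof -
  let ?w = "tree_word n T" let ?o = "vertex_order n d"
  note w = tree_word_in[OF T]
  have lw: "length ?w = n - 2" using tree_words_length[OF T(2) w] .
  have lp: "length (word_positions ?o ?w) = n - 2" using length_word_positions[OF w distinct_order_upto] lw by simp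
  have sp: "set (word_positions ?o ?w) \<subseteq> {..n}" using word_positions_range[of _ ?o ?w] lw by fastforce
  have R: "sum_list (map2 weight_of (rows 1 tc) (word_positions ?o ?w)) = tree_rank T"
    using T by (simp add: tree_rank_def trees_with_degrees_def word_rank_def)
  show ?thesis
    using wp_sum_alg[of \<sigma> "''n2''" "word_positions ?o ?w" "''tpos''" "rows 1 tc" "''treeW''" X \<mu>] r p X lp sp tree_tables(1)
    unfolding R by (simp add: sum_list_tc)
qed

lemma wp_degree_sum:
  assumes r: "reg \<sigma> ''n'' = n" and T: "degrees (deg T)"
    and p: "slice (arr \<sigma> ''dpos'') n = word_positions [1..<n] (degree_word n T)"
    and X: "reg \<sigma> ''rank'' + word_rank M dc (word_positions [1..<n] (degree_word n T)) < X"
  shows "wp (prep n S) n (fits X) \<mu> (sum_alg ''degW'' ''dpos'' ''n'') \<sigma> (\<lambda>\<sigma>' _.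
    reg \<sigma>' ''rank'' = reg \<sigma> ''rank'' + word_rank M dc (word_positions [1..<n] (degree_word n T)))"
proof -
  let ?w = "degree_word n T" let ?o = "[1..<n]"
  have lw: "length ?w = n" by (simp add: degree_word_def)
  have lp: "length (word_positions ?o ?w) = n" using length_word_positions[OF degree_word_in[OF T] distinct_upt] lw by simp
  have sp: "set (word_positions ?o ?w) \<subseteq> {..n}" using word_positions_range[of _ ?o ?w] lw by fastforce
  show ?thesis
    using wp_sum_alg[of \<sigma> "''n''" "word_positions ?o ?w" "''dpos''" "rows M dc" "''degW''" X \<mu>] r p X lp sp degree_tables(1)
    unfolding word_rank_def by (simp add: sum_list_dc)
qed

lemma wp_place_tree:
  assumes r: "reg \<sigma> ''n'' = n" "reg \<sigma> ''n1'' = n - 1" "reg \<sigma> ''n2'' = n - 2" "reg \<sigma> ''m'' = x" "x < M"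
    and d: "degrees d" "arr \<sigma> ''s'' = d" "\<forall>v. v \<notin> {1..n} \<longrightarrow> arr \<sigma> ''d'' v = 0"
  shows "wp (prep n S) n (\<lambda>_. True) event_bits place_tree_alg \<sigma> (\<lambda>\<sigma>' b.
    arr \<sigma>' ''tree'' = prufer_tree n d (unrank_word d x @ [1]) (arr \<sigma> ''tree'') \<and> b \<le> bit_length n * tree_cost)"
proof -
  let ?o = "vertex_order n d" let ?q = "digits 1 tc x" let ?w = "unrank_word d x"
  have dn: "d v \<le> n" if "v \<in> {1..n}" for v using degrees_range[OF d(1) that] unfolding atLeastAtMost_iff by linarith
  have lo: "length ?o = n" using length_vertex_order[OF d(1)] .
  have so: "set ?o \<subseteq> {..n}" using set_vertex_order[OF d(1)] by auto
  have nM: "n \<le> n ^ (2 * n)" using n2 power_increasing[of 1 "2 * n" n] by simp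
  have wd: "word_degrees n d (?w @ [1])"
    using unrank_word(1)[OF r(5) d(1)] word_degrees_iff[OF d(1)] by blast
  show ?thesis
    unfolding place_tree_alg_def
  proof (rule wp_Seq, rule wp_small_bits[OF wp_order_alg], goal_cases)
    case (4 \<sigma>1 b1)
    have s1: "slice (arr \<sigma>1 ''o'') n = ?o" using 4(2) d lo by simp
    have f1: "reg \<sigma>1 ''n'' = n" "reg \<sigma>1 ''n1'' = n - 1" "reg \<sigma>1 ''n2'' = n - 2" "reg \<sigma>1 ''m'' = x"
      "arr \<sigma>1 ''s'' = d" "arr \<sigma>1 ''d'' = arr \<sigma> ''d''" "arr \<sigma>1 ''tree'' = arr \<sigma> ''tree''"
      using 4(1) r d by (auto simp: agree_def alg_defs)
    note b1 = 4(3)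
    show ?case
    proof (rule wp_Seq, rule wp_bounded_bits[OF wp_digits_alg[where cs = tc and base = 1 and x = x]], goal_cases)
      case (10 \<sigma>2 b2)
      have s2: "slice (arr \<sigma>2 ''q'') n = ?q" using 10(2) length_tc by simp
      have f2: "reg \<sigma>2 ''n'' = n" "reg \<sigma>2 ''n1'' = n - 1" "reg \<sigma>2 ''n2'' = n - 2"
        "arr \<sigma>2 ''s'' = d" "arr \<sigma>2 ''d'' = arr \<sigma> ''d''" "arr \<sigma>2 ''tree'' = arr \<sigma> ''tree''" "arr \<sigma>2 ''o'' = arr \<sigma>1 ''o''"
        using 10(1) f1 by (auto simp: agree_def alg_defs)
      note b2 = 10(3)
      show ?case
      proof (rule wp_Seq, rule wp_small_bits[OF wp_Assign[where Q = "\<lambda>\<sigma>' _. \<sigma>' = \<sigma>2\<lparr>reg := (reg \<sigma>2)(''N'' := n - 2)\<rparr>"]], goal_cases)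
        case (3 \<sigma>3 b3)
        note \<sigma>3 = 3(2) and b3 = 3(3)
        show ?case
        proof (rule wp_Seq, rule wp_conseq[OF wp_place_alg[where os = ?o and cs = tc and qs = ?q]], goal_cases)
          case (13 \<sigma>4 b4)
          have "map (arr \<sigma>4 ''w'') [1..<Suc (n - 2)] = ?w"
            using 13(2) by (simp add: sum_list_tc unrank_word_def slice_def)
          moreover have "Suc (n - 2) = n - 1" using n2 by simp
          ultimately have s4: "map (arr \<sigma>4 ''w'') [1..<n - 1] = ?w" by simp
          have f4: "reg \<sigma>4 ''n'' = n" "reg \<sigma>4 ''n1'' = n - 1"
            "arr \<sigma>4 ''s'' = d" "arr \<sigma>4 ''d'' = arr \<sigma> ''d''" "arr \<sigma>4 ''tree'' = arr \<sigma> ''tree''"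
            using 13(1) f2 \<sigma>3 by (auto simp: agree_def alg_defs)
          have b4: "b4 \<le> bit_length n * place_cost ''treeC''" using 13(2) by (simp add: place_cost_def)
          show ?case
          proof (rule wp_small_bits[OF wp_decode_alg], goal_cases)
            case (5 \<sigma>5 b5)
            have "b1 + (b2 + (b3 + (b4 + b5))) \<le> bit_length n * tree_cost"
              using b1 b2 b3 b4 5(3) unfolding tree_cost_def distrib_left by simp
            then show ?case using 5(2) s4 f4 by simp
          qed (use f4 s4 wd d in \<open>auto simp: degrees_def\<close>)
        qed (use s1 s2 f2 \<sigma>3 lo so length_tc sum_list_tc tree_tables(3) r(5) nth_digits_less[of 1 x tc] in auto)
      qed (use f2 n2 in auto)
    qed (use f1 r(5) nM length_tc multinomial_le_power(1) tree_tables(2) in auto)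
  qed (use r d dn in auto)
qed

lemma wp_sequence_rank:
  assumes d: "degrees d" and T: "T \<in> trees_with_degrees n d"
    and m: "reg \<sigma> = (\<lambda>_. 0)(''n'' := n)" "arr \<sigma> ''s'' = d" "arr \<sigma> ''tree'' = tree_fun n T" "arr \<sigma> ''d'' = (\<lambda>_. 0)"
  shows "wp (prep n S) n (small n) (\<lambda>_. 0) sequence_positions_alg \<sigma> (\<lambda>\<sigma>1 _.
    wp (prep n S) n (fits M) (\<lambda>_. 0) sequence_sum_alg \<sigma>1 (\<lambda>\<sigma>' _. reg \<sigma>' ''rank'' = tree_rank T))"
  unfolding sequence_positions_alg_def sequence_sum_alg_def
proof (rule wp_Seq, rule wp_conseq[OF wp_sizes_alg], goal_cases)
  case (2 \<sigma>1 b1)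
  \<comment> \<open>The register \<open>rank\<close> is 0 at the start, like all registers but
    \<open>n\<close>, and is not written before the summation.\<close>
  have f1: "reg \<sigma>1 ''n'' = n" "reg \<sigma>1 ''rank'' = 0" "arr \<sigma>1 = arr \<sigma>"
    using 2(1) m by (auto simp: agree_def alg_defs)
  show ?case
  proof (rule wp_conseq[OF wp_tree_positions[where T = T and d = d]], goal_cases)
    case (9 \<sigma>2 b2)
    have f2: "reg \<sigma>2 ''n2'' = n - 2" "reg \<sigma>2 ''rank'' = 0"
      using 9(1) 2(2) f1 by (auto simp: agree_def alg_defs)
    show ?case
      by (rule wp_conseq[OF wp_tree_sum[where T = T and d = d]])
        (use 9(2) f2 T d tree_rank_less[OF T d] in auto)
  qed (use f1 2(2) T d m in auto)
qed (use m in auto)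

lemma wp_multiset_rank:
  assumes T: "T \<in> trees_with_degree_multiset n S"
    and m: "reg \<sigma> = (\<lambda>_. 0)(''n'' := n)" "arr \<sigma> ''s'' = (\<lambda>_. 0)" "arr \<sigma> ''tree'' = tree_fun n T" "arr \<sigma> ''d'' = (\<lambda>_. 0)"
  shows "wp (prep n S) n (small n) (\<lambda>_. 0) multiset_positions_alg \<sigma> (\<lambda>\<sigma>1 _.
    wp (prep n S) n (fits (multinomial M dc)) (\<lambda>_. 0) multiset_sum_alg \<sigma>1 (\<lambda>\<sigma>' _. reg \<sigma>' ''rank'' = full_rank T))"
proof -
  have Td: "T \<in> trees_with_degrees n (deg T)" and d: "degrees (deg T)"
    using T trees_with_degree_multiset_iff by blast+
  have rt: "rooted_tree n T" using Td by (simp add: trees_with_degrees_def)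
  note pm = rooted_tree_tree_fun[OF rt]
  have tf: "\<forall>i\<in>{2..n}. tree_fun n T i \<in> {1..n}" using pm(1) unfolding parent_map_def by blast
  \<comment> \<open>Brings the degrees into the form computed by \<open>degree_alg\<close>, with
    zeros outside 1..n.\<close>
  have dT: "deg T v = (if v \<in> {1..n} then (if v \<in> {2..n} then 1 else 0) + card {u\<in>{2..n}. tree_fun n T u = v} else 0)" for v
  proof (cases "v \<in> {1..n}")
    case True
    have "deg T v = deg (edges_of n (tree_fun n T)) v" by (rule arg_cong[OF pm(2)])
    also have "\<dots> = (if v \<in> {2..n} then 1 else 0) + card {u\<in>{2..n}. tree_fun n T u = v}"
      by (rule deg_edges_of[OF pm(1)])
    finally show ?thesis using True by simp
  next
    case False
    show ?thesis unfolding if_not_P[OF False] by (rule deg_outside[OF rt False])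
  qed
  have dn: "deg T v \<le> n" if "v \<in> {1..n}" for v using degrees_range[OF d that] unfolding atLeastAtMost_iff by linarith
  let ?w = "degree_word n T"
  have lw: "length ?w = n" by (simp add: degree_word_def)
  have sw: "set ?w \<subseteq> {..n}" using dn by (auto simp: degree_word_def simp del: upt_Suc)
  have lp: "length (word_positions [1..<n] ?w) = n" using length_word_positions[OF degree_word_in[OF d] distinct_upt] lw by simp
  have bound: "word_rank M dc (word_positions [1..<n] ?w) + tree_rank T < multinomial M dc"
    using full_rank_less[OF T] by (simp add: full_rank_def)
  show ?thesis
    unfolding multiset_positions_alg_def multiset_sum_alg_def
  proof (rule wp_Seq, rule wp_conseq[OF wp_sizes_alg], goal_cases)
    case (2 \<sigma>1 b1)
    have f1: "reg \<sigma>1 ''n'' = n" "reg \<sigma>1 ''n1'' = n - 1" "reg \<sigma>1 ''n2'' = n - 2" "reg \<sigma>1 ''rank'' = 0" "arr \<sigma>1 = arr \<sigma>"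
      using 2 m by (auto simp: agree_def alg_defs)
    show ?case
    proof (rule wp_Seq, rule wp_conseq[OF wp_degree_alg], goal_cases)
      case (3 \<sigma>2 b2)
      have "arr \<sigma>2 ''s'' v = deg T v" for v
        using 3(2) unfolding dT f1(5) m(2,3) by simp
      then have s2: "arr \<sigma>2 ''s'' = deg T" by blast
      have f2: "reg \<sigma>2 ''n'' = n" "reg \<sigma>2 ''n1'' = n - 1" "reg \<sigma>2 ''n2'' = n - 2" "reg \<sigma>2 ''rank'' = 0"
        "arr \<sigma>2 ''tree'' = tree_fun n T" "arr \<sigma>2 ''d'' = (\<lambda>_. 0)"
        using 3(1) f1 m by (auto simp: agree_def alg_defs)
      show ?case
      proof (rule wp_Seq, rule wp_conseq[OF wp_identity_alg], goal_cases)
        case (3 \<sigma>3 b3)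
        \<comment> \<open>The letters of the degree word are the degree values themselves, processed
          in their natural order.\<close>
        have s3: "slice (arr \<sigma>3 ''o'') (n - 1) = [1..<n]" using 3(2) f2 n2 by simp
        have f3: "reg \<sigma>3 ''n'' = n" "reg \<sigma>3 ''n1'' = n - 1" "reg \<sigma>3 ''n2'' = n - 2" "reg \<sigma>3 ''rank'' = 0"
          "arr \<sigma>3 ''tree'' = tree_fun n T" "arr \<sigma>3 ''d'' = (\<lambda>_. 0)" "arr \<sigma>3 ''s'' = deg T"
          using 3(1) f2 s2 by (auto simp: agree_def alg_defs)
        show ?case
        proof (rule wp_Seq, rule wp_conseq[OF wp_copy_alg], goal_cases)
          case (5 \<sigma>4 b4)
          have "slice (arr \<sigma>4 ''w'') n = slice (deg T) n"
            using 5(2) f3 by (intro slice_cong) simp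
          then have s4: "slice (arr \<sigma>4 ''w'') n = ?w" by (simp add: slice_def degree_word_def)
          have f4: "reg \<sigma>4 ''n'' = n" "reg \<sigma>4 ''n1'' = n - 1" "reg \<sigma>4 ''n2'' = n - 2" "reg \<sigma>4 ''rank'' = 0"
            "arr \<sigma>4 ''tree'' = tree_fun n T" "arr \<sigma>4 ''d'' = (\<lambda>_. 0)" "arr \<sigma>4 ''s'' = deg T" "arr \<sigma>4 ''o'' = arr \<sigma>3 ''o''"
            using 5(1) f3 by (auto simp: agree_def alg_defs)
          show ?case
          proof (rule wp_Seq, rule wp_Assign, goal_cases)
            case (2 b5)
            show ?case
            proof (rule wp_Seq, rule wp_conseq[OF wp_positions_alg[where ws = ?w and os = "[1..<n]"]], goal_cases)
              case (12 \<sigma>6 b6)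
              have s6: "slice (arr \<sigma>6 ''dpos'') n = word_positions [1..<n] ?w" using 12(2) lp by simp
              have f6: "reg \<sigma>6 ''n'' = n" "reg \<sigma>6 ''n1'' = n - 1" "reg \<sigma>6 ''n2'' = n - 2" "reg \<sigma>6 ''rank'' = 0"
                "arr \<sigma>6 ''tree'' = tree_fun n T" "arr \<sigma>6 ''d'' = (\<lambda>_. 0)" "arr \<sigma>6 ''s'' = deg T"
                using 12(1) f4 by (auto simp: agree_def alg_defs)
              show ?case
              proof (rule wp_conseq[OF wp_tree_positions[where T = T and d = "deg T"]], goal_cases)
                case (9 \<sigma>7 b7)
                have f7: "reg \<sigma>7 ''n'' = n" "reg \<sigma>7 ''n2'' = n - 2" "reg \<sigma>7 ''rank'' = 0" "arr \<sigma>7 ''dpos'' = arr \<sigma>6 ''dpos''"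
                  using 9(1) f6 by (auto simp: agree_def alg_defs)
                show ?case
                proof (rule wp_Seq, rule wp_conseq[OF wp_degree_sum[where T = T]], goal_cases)
                  case (5 \<sigma>8 b8)
                  have f8: "reg \<sigma>8 ''n2'' = n - 2" "reg \<sigma>8 ''rank'' = word_rank M dc (word_positions [1..<n] ?w)" "arr \<sigma>8 = arr \<sigma>7"
                    using 5 f7 by (auto simp: agree_def alg_defs)
                  show ?case
                    by (rule wp_conseq[OF wp_tree_sum[where T = T and d = "deg T"]])
                      (use 9(2) f8 Td d bound in \<open>auto simp: full_rank_def\<close>)
                qed (use f7 s6 d bound in auto)
              qed (use f6 Td d in auto)
            qed (use f4 s3 s4 lw sw n2 in auto)
          qed (use f4 in auto)
        qed (use f3 dn in auto)
      qed (use f2 n2 in auto)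
    qed (use f1 tf m in auto)
  qed (use m in auto)
qed

lemma wp_sequence_unrank:
  assumes d: "degrees d" and x: "x < M"
    and m: "reg \<sigma> ''n'' = n" "reg \<sigma> ''m'' = x" "arr \<sigma> ''s'' = d" "arr \<sigma> ''d'' = (\<lambda>_. 0)"
  shows "wp (prep n S) n (\<lambda>_. True) event_bits sequence_unrank_alg \<sigma> (\<lambda>\<sigma>' b.
    arr \<sigma>' ''tree'' = prufer_tree n d (unrank_word d x @ [1]) (arr \<sigma> ''tree'') \<and> b \<le> bit_length n * full_cost)"
  unfolding sequence_unrank_alg_def
proof (rule wp_Seq, rule wp_small_bits[OF wp_sizes_alg], goal_cases)
  case (2 \<sigma>1 b1)
  have f1: "reg \<sigma>1 ''n'' = n" "reg \<sigma>1 ''m'' = x" "arr \<sigma>1 = arr \<sigma>"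
    using 2(1) m by (auto simp: agree_def alg_defs)
  show ?case
  proof (rule wp_conseq[OF wp_place_tree[where x = x and d = d]], goal_cases)
    case (9 \<sigma>2 b2)
    have "b1 + b2 \<le> bit_length n * (3 * steps n sizes_alg + tree_cost)"
      using 2(3) 9(2) unfolding distrib_left by simp
    also have "\<dots> \<le> bit_length n * full_cost"
      by (intro mult_le_mono2) (simp add: full_cost_def)
    finally show ?case using 9(2) f1 by simp
  qed (use f1 2(2) x d m in auto)
qed (use m in auto)

lemma wp_multiset_unrank:
  assumes x: "x < multinomial M dc"
    and m: "reg \<sigma> ''n'' = n" "reg \<sigma> ''m'' = x" "arr \<sigma> ''s'' = (\<lambda>_. 0)" "arr \<sigma> ''d'' = (\<lambda>_. 0)"
  defines "w \<equiv> word_of_digits [1..<n] dc (digits M dc x)" and "r \<equiv> remainder M dc x"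
  defines "d \<equiv> word_fun w"
  shows "wp (prep n S) n (\<lambda>_. True) event_bits multiset_unrank_alg \<sigma> (\<lambda>\<sigma>' b.
    arr \<sigma>' ''tree'' = prufer_tree n d (unrank_word d r @ [1]) (arr \<sigma> ''tree'') \<and> b \<le> bit_length n * full_cost)"
proof -
  let ?q = "digits M dc x"
  note u = full_unrank(1-3)[OF x, folded w_def r_def d_def]
  have lw: "length w = n" using words_length[OF u(1)] sum_list_dc by (simp add: degree_content_def)
  have nM: "n \<le> n ^ (2 * n)" using n2 power_increasing[of 1 "2 * n" n] by simp
  have dn: "d v \<le> n" if "v \<in> {1..n}" for v using degrees_range[OF u(3) that] unfolding atLeastAtMost_iff by linarith
  have m1: "''m'' \<noteq> ''n1''" by simp
  show ?thesis
    unfolding multiset_unrank_alg_def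
  proof (rule wp_Seq, rule wp_small_bits[OF wp_sizes_alg], goal_cases)
    case (2 \<sigma>1 b1)
    have f1: "reg \<sigma>1 ''n'' = n" "reg \<sigma>1 ''n1'' = n - 1" "reg \<sigma>1 ''n2'' = n - 2" "reg \<sigma>1 ''m'' = x" "arr \<sigma>1 = arr \<sigma>"
      using 2 m by (auto simp: agree_def alg_defs)
    note b1 = 2(3)
    show ?case
    proof (rule wp_Seq, rule wp_small_bits[OF wp_identity_alg], goal_cases)
      case (3 \<sigma>2 b2)
      have s2: "slice (arr \<sigma>2 ''o'') (n - 1) = [1..<n]" using 3(2) f1 n2 by simp
      have f2: "reg \<sigma>2 ''n'' = n" "reg \<sigma>2 ''n1'' = n - 1" "reg \<sigma>2 ''n2'' = n - 2" "reg \<sigma>2 ''m'' = x"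
        "arr \<sigma>2 ''s'' = (\<lambda>_. 0)" "arr \<sigma>2 ''d'' = (\<lambda>_. 0)" "arr \<sigma>2 ''tree'' = arr \<sigma> ''tree''"
        using 3(1) f1 m by (auto simp: agree_def alg_defs)
      note b2 = 3(3)
      show ?case
      proof (rule wp_Seq, rule wp_bounded_bits[OF wp_digits_alg[where cs = dc and base = M and x = x]], goal_cases)
        case (10 \<sigma>3 b3)
        \<comment> \<open>What division leaves in the register \<open>m\<close> is the rank of the
          tree among those with the decoded degrees, ready for
          \<open>place_tree_alg\<close>.\<close>
        have s3: "slice (arr \<sigma>3 ''q'') (n - 1) = ?q" "reg \<sigma>3 ''m'' = r"
          using 10(2) length_dc by (simp_all add: r_def)
        have f3: "reg \<sigma>3 ''n'' = n" "reg \<sigma>3 ''n1'' = n - 1" "reg \<sigma>3 ''n2'' = n - 2"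
          "arr \<sigma>3 ''s'' = (\<lambda>_. 0)" "arr \<sigma>3 ''d'' = (\<lambda>_. 0)" "arr \<sigma>3 ''tree'' = arr \<sigma> ''tree''" "arr \<sigma>3 ''o'' = arr \<sigma>2 ''o''"
          using 10(1) f2 by (auto simp: agree_def alg_defs)
        note b3 = 10(3)
        show ?case
        proof (rule wp_Seq, rule wp_small_bits[OF wp_Assign[where Q = "\<lambda>\<sigma>' _. \<sigma>' = \<sigma>3\<lparr>reg := (reg \<sigma>3)(''N'' := n)\<rparr>"]], goal_cases)
          case (3 \<sigma>4 b4)
          note \<sigma>4 = 3(2) and b4 = 3(3)
          show ?case
          proof (rule wp_Seq, rule wp_conseq[OF wp_place_alg[where os = "[1..<n]" and cs = dc and qs = ?q]], goal_cases)
            case (13 \<sigma>5 b5)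
            have s5: "slice (arr \<sigma>5 ''w'') n = w" using 13(2) by (simp add: sum_list_dc w_def)
            have f5: "reg \<sigma>5 ''n'' = n" "reg \<sigma>5 ''n1'' = n - 1" "reg \<sigma>5 ''n2'' = n - 2" "reg \<sigma>5 ''m'' = r"
              "arr \<sigma>5 ''s'' = (\<lambda>_. 0)" "arr \<sigma>5 ''d'' = (\<lambda>_. 0)" "arr \<sigma>5 ''tree'' = arr \<sigma> ''tree''"
              using 13(1) f3 s3 \<sigma>4 by (auto simp: agree_def alg_defs)
            have b5: "b5 \<le> bit_length n * place_cost ''degC''" using 13(2) by (simp add: place_cost_def)
            have wv: "arr \<sigma>5 ''w'' v = d v" if "v \<in> {1..n}" for v
            proof -
              have "v - 1 < n" "Suc (v - 1) = v" using that by auto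
              then show ?thesis using nth_slice[of "v - 1" n "arr \<sigma>5 ''w''"] that
                unfolding s5 d_def word_fun_def by simp
            qed
            show ?case
            proof (rule wp_Seq, rule wp_small_bits[OF wp_copy_alg], goal_cases)
              case (5 \<sigma>6 b6)
              have "arr \<sigma>6 ''s'' v = d v" for v
                using 5(2) wv f5 by (cases "v \<in> {1..n}") (auto simp: d_def word_fun_def)
              then have s6: "arr \<sigma>6 ''s'' = d" by blast
              have f6: "reg \<sigma>6 ''n'' = n" "reg \<sigma>6 ''n1'' = n - 1" "reg \<sigma>6 ''n2'' = n - 2" "reg \<sigma>6 ''m'' = r"
                "arr \<sigma>6 ''d'' = (\<lambda>_. 0)" "arr \<sigma>6 ''tree'' = arr \<sigma> ''tree''"
                using 5(1) f5 by (auto simp: agree_def alg_defs)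
              note b6 = 5(3)
              show ?case
              proof (rule wp_conseq[OF wp_place_tree[where x = r and d = d]], goal_cases)
                case (9 \<sigma>7 b7)
                have "b1 + (b2 + (b3 + (b4 + (b5 + (b6 + b7))))) \<le> bit_length n * full_cost"
                  using b1 b2 b3 b4 b5 b6 9(2) unfolding full_cost_def distrib_left by simp
                then show ?case using 9(2) f6 by simp
              qed (use f6 s6 u in auto)
            qed (use f5 wv dn in auto)
          qed (use s2 s3 f3 \<sigma>4 length_dc sum_list_dc degree_tables(3) nth_digits_less[OF M_pos x] in auto)
        qed (use f3 n2 in auto)
      qed (use f2 x M_pos nM length_dc multinomial_le_power(2) degree_tables(2) in auto)
    qed (use f1 n2 in auto)
  qed (use m in auto)
qed

end

section \<open>Admissible degree sequences and the final guarantees\<close>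

lemma length_le_sum_list:
  "(\<forall>x\<in>set xs. 1 \<le> x) \<Longrightarrow> length xs \<le> sum_list (xs :: nat list)"
  by (induction xs) auto

text \<open>No entry exceeds n - 1, because the other n - 1 entries are at least 1 and the total is
  2n - 2.\<close>

lemma prepared_mset:
  assumes "2 \<le> n" "length s = n" "\<forall>i<n. 0 < s ! i" "(\<Sum>i<n. s ! i) = 2 * n - 2"
  shows "prepared n (mset s)"
proof
  have total: "sum_list s = 2 * n - 2"
    using assms(2,4) by (simp add: sum_list_sum_nth lessThan_atLeast0)
  have pos: "\<forall>x\<in>set s. 1 \<le> x" using assms(2,3) by (auto simp: in_set_conv_nth Suc_le_eq)
  have le: "x \<le> n - 1" if "x \<in> set s" for x
  proof -
    have "length (remove1 x s) \<le> sum_list (remove1 x s)"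
      using pos by (intro length_le_sum_list) (meson notin_set_remove1)
    moreover have "sum_list s = x + sum_list (remove1 x s)"
      using sum_list_map_remove1[OF that, of "\<lambda>x. x"] by simp
    ultimately show ?thesis using total assms(1,2) that by (simp add: length_remove1)
  qed
  show sub: "set_mset (mset s) \<subseteq> {1..n - 1}" using pos le by auto
  \<comment> \<open>Summing over values with multiplicity is summing over the list; \<open>f\<close>
    is the identity for the total and constantly 1 for the length.\<close>
  have c: "(\<Sum>i = 1..n - 1. count (mset s) i * f i) = sum_list (map f s)" for f :: "nat \<Rightarrow> nat"
    using sum_list_map_eq_sum_count2[of s "{1..n - 1}" f] sub by (simp add: count_mset)
  show "(\<Sum>i = 1..n - 1. count (mset s) i * i) = 2 * n - 2" using c[of "\<lambda>x. x"] total by simp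
  show "(\<Sum>i = 1..n - 1. count (mset s) i) = n" using c[of "\<lambda>_. 1"] assms(2) by (simp add: sum_list_triv)
qed (rule assms)

lemma stored_tree_eq: "stored_tree n \<sigma> = edges_of n (arr \<sigma> ''tree'')"
  by (simp add: stored_tree_def edges_of_def)

context prepared
begin

lemma computes_rankI:
  assumes "\<And>T. T \<in> X \<Longrightarrow> wp (prep n S) n (small n) (\<lambda>_. 0) A (with_tree n T \<sigma>)
      (\<lambda>\<sigma>1 _. wp (prep n S) n (fits (card X)) (\<lambda>_. 0) B \<sigma>1 (\<lambda>\<sigma>' _. reg \<sigma>' ''rank'' = rank T))"
    and "card X \<le> n ^ (2 * n)" "steps n A \<le> 200 * (n * n)" "steps n B \<le> 50 * n"
  shows "computes_rank 10000 n X (prep n S) \<sigma> (A ;; B) rank"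
  unfolding computes_rank_def using rank_certificate[OF assms(1) _ assms(2-4)] by blast

lemma computes_unrankI:
  assumes "\<And>m. m < card X \<Longrightarrow> wp (prep n S) n (\<lambda>_. True) event_bits P (with_number m \<sigma>)
      (\<lambda>\<sigma>' b. stored_tree n \<sigma>' \<in> X \<and> rank (stored_tree n \<sigma>') = m \<and> b \<le> bit_length n * full_cost)"
  shows "computes_unrank 10000 n X (prep n S) \<sigma> P rank"
  unfolding computes_unrank_def bit_operations_def
  using assms unrank_cost[OF _ full_cost_le] unfolding wp_def by blast

lemma sequence_algorithms:
  assumes S: "S = mset s"
  defines "X \<equiv> trees_with_degree_sequence n s"
  shows "bij_betw tree_rank X {0..<card X}"
    "computes_rank 10000 n X (prep n S) (sequence_instance n s) (sequence_positions_alg ;; sequence_sum_alg) tree_rank"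
    "computes_unrank 10000 n X (prep n S) (sequence_instance n s) sequence_unrank_alg tree_rank"
proof -
  let ?d = "word_fun s"
  have d: "degrees ?d"
    by (rule degrees_word_fun) (unfold words_iff_mset, rule S[symmetric])
  \<comment> \<open>Degrees outside 1..n vanish in every rooted tree, so the conditions on 1..n
    determine the whole degree function.\<close>
  have X: "X = trees_with_degrees n ?d"
    using deg_outside unfolding X_def trees_with_degree_sequence_def trees_with_degrees_def
    by (auto simp: word_fun_def fun_eq_iff)
  have c: "card X = M" using bij_betw_same_card[OF tree_rank_bij[OF d]] X by simp
  have i: "arr (sequence_instance n s) ''s'' = ?d"
    by (auto simp: sequence_instance_def instance_mem_def word_fun_def)
  show "bij_betw tree_rank X {0..<card X}" using tree_rank_bij[OF d] c X by simp
  show "computes_rank 10000 n X (prep n S) (sequence_instance n s) (sequence_positions_alg ;; sequence_sum_alg) tree_rank"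
  proof (rule computes_rankI)
    fix T assume "T \<in> X"
    then show "wp (prep n S) n (small n) (\<lambda>_. 0) sequence_positions_alg (with_tree n T (sequence_instance n s))
      (\<lambda>\<sigma>1 _. wp (prep n S) n (fits (card X)) (\<lambda>_. 0) sequence_sum_alg \<sigma>1 (\<lambda>\<sigma>' _. reg \<sigma>' ''rank'' = tree_rank T))"
      unfolding c using d i X
      by (intro wp_sequence_rank) (auto simp: with_tree_def tree_fun_def sequence_instance_def instance_mem_def)
  qed (use c multinomial_le_power steps_positions n2 in auto)
  show "computes_unrank 10000 n X (prep n S) (sequence_instance n s) sequence_unrank_alg tree_rank"
  proof (rule computes_unrankI)
    fix m assume "m < card X"
    then have m: "m < M" using c by simp
    show "wp (prep n S) n (\<lambda>_. True) event_bits sequence_unrank_alg (with_number m (sequence_instance n s))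
      (\<lambda>\<sigma>' b. stored_tree n \<sigma>' \<in> X \<and> tree_rank (stored_tree n \<sigma>') = m \<and> b \<le> bit_length n * full_cost)"
      unfolding stored_tree_eq X
      by (rule wp_conseq[OF wp_sequence_unrank[OF d m]])
        (use i unrank_word(2,3)[OF m d] in \<open>auto simp: with_number_def sequence_instance_def instance_mem_def\<close>)
  qed
qed

lemma multiset_algorithms:
  defines "X \<equiv> trees_with_degree_multiset n S"
  shows "bij_betw full_rank X {0..<card X}"
    "computes_rank 10000 n X (prep n S) (multiset_instance n S) (multiset_positions_alg ;; multiset_sum_alg) full_rank"
    "computes_unrank 10000 n X (prep n S) (multiset_instance n S) multiset_unrank_alg full_rank"
proof -
  have c: "card X = multinomial M dc" using bij_betw_same_card[OF full_rank_bij] X_def by simp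
  show "bij_betw full_rank X {0..<card X}" using full_rank_bij c X_def by simp
  show "computes_rank 10000 n X (prep n S) (multiset_instance n S) (multiset_positions_alg ;; multiset_sum_alg) full_rank"
  proof (rule computes_rankI)
    fix T assume "T \<in> X"
    then show "wp (prep n S) n (small n) (\<lambda>_. 0) multiset_positions_alg (with_tree n T (multiset_instance n S))
      (\<lambda>\<sigma>1 _. wp (prep n S) n (fits (card X)) (\<lambda>_. 0) multiset_sum_alg \<sigma>1 (\<lambda>\<sigma>' _. reg \<sigma>' ''rank'' = full_rank T))"
      unfolding c unfolding X_def
      by (intro wp_multiset_rank) (auto simp: with_tree_def tree_fun_def multiset_instance_def instance_mem_def)
  qed (use c multinomial_le_power steps_positions n2 in auto)
  show "computes_unrank 10000 n X (prep n S) (multiset_instance n S) multiset_unrank_alg full_rank"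
  proof (rule computes_unrankI)
    fix m assume "m < card X"
    then have m: "m < multinomial M dc" using c by simp
    show "wp (prep n S) n (\<lambda>_. True) event_bits multiset_unrank_alg (with_number m (multiset_instance n S))
      (\<lambda>\<sigma>' b. stored_tree n \<sigma>' \<in> X \<and> full_rank (stored_tree n \<sigma>') = m \<and> b \<le> bit_length n * full_cost)"
      unfolding stored_tree_eq X_def
      by (rule wp_conseq[OF wp_multiset_unrank[OF m]])
        (use full_unrank(4,5)[OF m] in \<open>auto simp: with_number_def multiset_instance_def instance_mem_def\<close>)
  qed
qed

end

theorem mainTheorem1:
  shows "\<exists>(K :: real)
      (prep\<^sub>a :: nat list \<Rightarrow> tables) (rank_alg\<^sub>a :: com) (unrank_alg\<^sub>a :: com)
      (prep\<^sub>b :: nat multiset \<Rightarrow> tables) (rank_alg\<^sub>b :: com) (unrank_alg\<^sub>b :: com).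
    (\<forall>(n :: nat) (s :: nat list).
       2 \<le> n \<longrightarrow> length s = n \<longrightarrow> (\<forall>i<n. 0 < s ! i) \<longrightarrow> (\<Sum>i<n. s ! i) = 2 * n - 2 \<longrightarrow>
       binomial_tables n (prep\<^sub>a s) \<and>
       (\<exists>rank. bij_betw rank (trees_with_degree_sequence n s)
                  {0..<card (trees_with_degree_sequence n s)} \<and>
          computes_rank K n (trees_with_degree_sequence n s) (prep\<^sub>a s)
            (sequence_instance n s) rank_alg\<^sub>a rank \<and>
          computes_unrank K n (trees_with_degree_sequence n s) (prep\<^sub>a s)
            (sequence_instance n s) unrank_alg\<^sub>a rank)) \<and>
    (\<forall>(n :: nat) (S :: nat multiset).
       2 \<le> n \<longrightarrow> set_mset S \<subseteq> {1..n - 1} \<longrightarrow>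
       (\<Sum>i=1..n - 1. count S i * i) = 2 * n - 2 \<longrightarrow> (\<Sum>i=1..n - 1. count S i) = n \<longrightarrow>
       binomial_tables n (prep\<^sub>b S) \<and>
       (\<exists>rank. bij_betw rank (trees_with_degree_multiset n S)
                  {0..<card (trees_with_degree_multiset n S)} \<and>
          computes_rank K n (trees_with_degree_multiset n S) (prep\<^sub>b S)
            (multiset_instance n S) rank_alg\<^sub>b rank \<and>
          computes_unrank K n (trees_with_degree_multiset n S) (prep\<^sub>b S)
            (multiset_instance n S) unrank_alg\<^sub>b rank))"
proof (intro exI conjI allI impI)
  fix n :: nat and s :: "nat list"
  assume a: "2 \<le> n" "length s = n" "\<forall>i<n. 0 < s ! i" "(\<Sum>i<n. s ! i) = 2 * n - 2"
  interpret prepared n "mset s" using a by (rule prepared_mset)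
  note alg = sequence_algorithms[OF refl]
  \<comment> \<open>The preprocessing receives only the sequence and recovers \<open>n\<close> as
    its length; the shape of this goal fixes the witness.\<close>
  show "binomial_tables n ((\<lambda>s. prep (length s) (mset s)) s)" using binomial_tables_prep a(2) by simp
  show "bij_betw tree_rank (trees_with_degree_sequence n s) {0..<card (trees_with_degree_sequence n s)}"
    by (rule alg)
  show "computes_rank 10000 n (trees_with_degree_sequence n s) ((\<lambda>s. prep (length s) (mset s)) s)
      (sequence_instance n s) (sequence_positions_alg ;; sequence_sum_alg) tree_rank"
    using alg(2) a(2) by simp
  show "computes_unrank 10000 n (trees_with_degree_sequence n s) ((\<lambda>s. prep (length s) (mset s)) s)
      (sequence_instance n s) sequence_unrank_alg tree_rank"
    using alg(3) a(2) by simp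
next
  fix n :: nat and S :: "nat multiset"
  assume a: "2 \<le> n" "set_mset S \<subseteq> {1..n - 1}" "(\<Sum>i=1..n - 1. count S i * i) = 2 * n - 2"
    "(\<Sum>i=1..n - 1. count S i) = n"
  interpret prepared n S using a by unfold_locales
  \<comment> \<open>The preprocessing receives only \<open>S\<close> and recovers \<open>n\<close>
    as its size; the given sum of multiplicities is this size because 1..n - 1 contains all elements
    of \<open>S\<close>.\<close>
  have size: "size S = n"
    using a(2,4) sum.mono_neutral_left[of "{1..n - 1}" "set_mset S" "count S"]
    by (simp add: size_multiset_overloaded_eq not_in_iff)
  show "binomial_tables n ((\<lambda>S. prep (size S) S) S)" using binomial_tables_prep size by simp
  show "bij_betw full_rank (trees_with_degree_multiset n S) {0..<card (trees_with_degree_multiset n S)}"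
    by (rule multiset_algorithms)
  show "computes_rank 10000 n (trees_with_degree_multiset n S) ((\<lambda>S. prep (size S) S) S)
      (multiset_instance n S) (multiset_positions_alg ;; multiset_sum_alg) full_rank"
    using multiset_algorithms(2) size by simp
  show "computes_unrank 10000 n (trees_with_degree_multiset n S) ((\<lambda>S. prep (size S) S) S)
      (multiset_instance n S) multiset_unrank_alg full_rank"
    using multiset_algorithms(3) size by simp
qed

end
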